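(* Let $K$ be the quotient field of a principal ideal domain $\mathcal{O}_K$, let $L/K$ be a finite Galois extension with Galois group $G=J\rtimes G'$ ($J$ normal in $G$), put $E=L^{G'}$ and $F=L^J$, and let $\mathcal{O}_L,\mathcal{O}_E,\mathcal{O}_F$ be the integral closures of $\mathcal{O}_K$ in $L,E,F$. Let $L/K$ be equipped with an induced Hopf Galois structure, with Hopf algebra $H=H_1\otimes_K\overline H$, where $H_1$ and $\overline H$ are the Hopf algebras of the corresponding Hopf Galois structures of $E/K$ and $F/K$. If $E/K$ and $F/K$ are arithmetically disjoint, then: 1. $\mathfrak{A}_H=\mathfrak{A}_{H_1}\otimes_{\mathcal{O}_K}\mathfrak{A}_{\overline H}$. 2. If $\mathcal{O}_E$ is $\mathfrak{A}_{H_1}$-free and $\mathcal{O}_F$ is $\mathfrak{A}_{\overline H}$-free, then $\mathcal{O}_L$ is $\mathfrak{A}_H$-free. Moreover, if $\gamma$ is a free generator of $\mathcal{O}_E$ as $\mathfrak{A}_{H_1}$-module and $\delta$ is a free generator of $\mathcal{O}_F$ as $\mathfrak{A}_{\overline H}$-module, then $\gamma\delta$ is a free generator of $\mathcal{O}_L$ as $\mathfrak{A}_H$-module.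
   Context: Arithmetically disjoint: $E/K$ and $F/K$ are arithmetically disjoint if $\mathcal{O}_{EF}=\mathcal{O}_E\otimes_{\mathcal{O}_K}\mathcal{O}_F$, i.e. $E,F$ are linearly disjoint over $K$ and the canonical map $\mathcal{O}_E\otimes_{\mathcal{O}_K}\mathcal{O}_F\to\mathcal{O}_{EF}$ is an isomorphism (here $EF=L$). Associated order: if a $K$-Hopf algebra $A$ acts on a finite separable extension $M/K$ through a Hopf Galois structure, then $\mathfrak{A}_A=\{\alpha\in A\mid \alpha\cdot x\in\mathcal{O}_M\text{ for all }x\in\mathcal{O}_M\}$. Thus $\mathfrak{A}_H,\mathfrak{A}_{H_1},\mathfrak{A}_{\overline H}$ are the associated orders of $\mathcal{O}_L,\mathcal{O}_E,\mathcal{O}_F$ respectively. A free generator of $\mathcal{O}_M$ as $\mathfrak{A}_A$-module is $\beta\in\mathcal{O}_M$ such that $\mathfrak{A}_A\to\mathcal{O}_M$, $a\mapsto a\cdot\beta$, is bijective; freeness means that such a generator exists. Induced Hopf Galois structures. Let $\lambda':G'\to\mathrm{Perm}(G')$ and $\lambda:G\to\mathrm{Perm}(G)$ be the left regular representations, and $\lambda_c:G\to\mathrm{Perm}(J)$, $\lambda_c(\sigma\tau)(\sigma')=\sigma\tau\sigma'\tau^{-1}$ for $\sigma,\sigma'\in J$, $\tau\in G'$. A subgroup of $\mathrm{Perm}(Y)$ is regular if it acts simply transitively on $Y$. Let $N_1\le\mathrm{Perm}(J)$ be regular and normalized by $\lambda_c(G)$, and $N_2\le\mathrm{Perm}(G')$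 regular and normalized by $\lambda'(G')$. Then: - $H_1=L[N_1]^G$ ($G$ acting on $L$ by the Galois action and on $N_1$ by conjugation via $\lambda_c$) acts on $E$ by $(\sum_i c_in_i)\cdot x=\sum_i c_in_i^{-1}(1_J)(x)$, giving a Hopf Galois structure of $E/K$; - $\overline H=F[N_2]^{G/J}$ (with $G/J\cong G'$ acting on $F$ by the Galois action and on $N_2$ by conjugation via $\lambda'$) acts on $F$ by $(\sum_j d_jm_j)\cdot z=\sum_j d_jm_j^{-1}(1_{G'})(z)$, giving a Hopf Galois structure of $F/K$ (the one corresponding to the structure $L[N_2]^{G'}$ of $L/E$); - with $\iota(\varphi,\psi)(\sigma\tau)=\varphi(\sigma)\psi(\tau)$, the group $N=\iota(N_1\times N_2)\le\mathrm{Perm}(G)$ is regular and normalized by $\lambda(G)$. The induced Hopf Galois structure of $L/K$ has Hopf algebra $H=L[N]^G$ ($G$ acting on $N$ by conjugation via $\lambda$) with action $(\sum_k c_kn_k)\cdot x=\sum_k c_kn_k^{-1}(1_G)(x)$ on $L$. One has $H=H_1\otimes_K\overline H$ via $(\sum_i c_in_i)\otimes(\sum_j d_jm_j)\mapsto\sum_{i,j}c_id_j\,\iota(n_i,m_j)$, and $\mathfrak{A}_{H_1}\otimes_{\mathcal{O}_K}\mathfrak{A}_{\overline H}$ is regarded inside $H$ through this identification. *)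

theory Defs
  imports "HOL-Algebra.Algebra" "HOL-Algebra.Algebraic_Closure_Type" "HOL-Library.Poly_Mapping"
begin

text \<open>
  The big field \<open>L\<close> is a type \<^typ>\<open>'a\<close> of class \<open>field\<close>; subrings and subfields of it are sets.
  The ring record of \<^typ>\<open>'a\<close> is \<^const>\<open>ring_of_type_algebra\<close>, through which the notions of
  HOL-Algebra are used.
\<close>

definition quotient_field :: "'a::field set \<Rightarrow> 'a set" where
  "quotient_field R = {a / b | a b. a \<in> R \<and> b \<in> R \<and> b \<noteq> 0}"

definition integral_closure :: "'a::field set \<Rightarrow> 'a set \<Rightarrow> 'a set" where
  "integral_closure R M =
     {x \<in> M. \<exists>p :: 'a poly. (\<forall>i. Polynomial.coeff p i \<in> R) \<and>
        Polynomial.coeff p (Polynomial.degree p) = 1 \<and> poly p x = 0}"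

definition Gal :: "'a::field set \<Rightarrow> ('a \<Rightarrow> 'a) monoid" where
  "Gal K = \<lparr>carrier = {\<sigma> \<in> ring_iso ring_of_type_algebra ring_of_type_algebra. \<forall>k\<in>K. \<sigma> k = k},
            monoid.mult = (\<circ>), one = id\<rparr>"

definition fixed_field :: "('a \<Rightarrow> 'a) set \<Rightarrow> 'a set" where
  "fixed_field S = {x. \<forall>\<sigma>\<in>S. \<sigma> x = x}"

definition finite_Galois :: "'a::field set \<Rightarrow> bool" where
  "finite_Galois K \<longleftrightarrow>
     subfield K (ring_of_type_algebra :: 'a ring) \<and>
     ring.finite_dimension (ring_of_type_algebra :: 'a ring) K UNIV \<and>
     fixed_field (carrier (Gal K)) = K"

definition scalar_mult :: "'r::comm_ring_1 \<Rightarrow> ('i \<Rightarrow>\<^sub>0 'r) \<Rightarrow> ('i \<Rightarrow>\<^sub>0 'r)" where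
  "scalar_mult r u = Poly_Mapping.map ((*) r) u"

definition free_module :: "'r::comm_ring_1 set \<Rightarrow> 'i set \<Rightarrow> ('i \<Rightarrow>\<^sub>0 'r) set" where
  "free_module R S = {u. Poly_Mapping.keys u \<subseteq> S \<and> (\<forall>i. Poly_Mapping.lookup u i \<in> R)}"

text \<open>
  For \<open>R\<close>-modules \<open>M\<close> and \<open>N\<close>, given as sets with scalar multiplications \<open>s\<close> and \<open>t\<close>, the tensor
  product of \<open>M\<close> and \<open>N\<close> over \<open>R\<close> is the free \<open>R\<close>-module on \<open>M \<times> N\<close> modulo the submodule generated by
  the bilinearity relations.
\<close>

inductive_set tensor_relations ::
  "'r::comm_ring_1 set \<Rightarrow> ('r \<Rightarrow> 'm::ab_group_add \<Rightarrow> 'm) \<Rightarrow> 'm set \<Rightarrow>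
   ('r \<Rightarrow> 'n::ab_group_add \<Rightarrow> 'n) \<Rightarrow> 'n set \<Rightarrow> ('m \<times> 'n \<Rightarrow>\<^sub>0 'r) set"
  for R s M t N where
  zero: "0 \<in> tensor_relations R s M t N"
| add: "u \<in> tensor_relations R s M t N \<Longrightarrow> v \<in> tensor_relations R s M t N \<Longrightarrow>
        u + v \<in> tensor_relations R s M t N"
| scalar_mult: "r \<in> R \<Longrightarrow> u \<in> tensor_relations R s M t N \<Longrightarrow> scalar_mult r u \<in> tensor_relations R s M t N"
| add_left: "x \<in> M \<Longrightarrow> x' \<in> M \<Longrightarrow> y \<in> N \<Longrightarrow>
    Poly_Mapping.single (x + x', y) 1 - Poly_Mapping.single (x, y) 1 - Poly_Mapping.single (x', y) 1
      \<in> tensor_relations R s M t N"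
| add_right: "x \<in> M \<Longrightarrow> y \<in> N \<Longrightarrow> y' \<in> N \<Longrightarrow>
    Poly_Mapping.single (x, y + y') 1 - Poly_Mapping.single (x, y) 1 - Poly_Mapping.single (x, y') 1
      \<in> tensor_relations R s M t N"
| scale_left: "r \<in> R \<Longrightarrow> x \<in> M \<Longrightarrow> y \<in> N \<Longrightarrow>
    Poly_Mapping.single (s r x, y) 1 - Poly_Mapping.single (x, y) r \<in> tensor_relations R s M t N"
| scale_right: "r \<in> R \<Longrightarrow> x \<in> M \<Longrightarrow> y \<in> N \<Longrightarrow>
    Poly_Mapping.single (x, t r y) 1 - Poly_Mapping.single (x, y) r \<in> tensor_relations R s M t N"

definition tensor_product ::
  "'r::comm_ring_1 set \<Rightarrow> ('r \<Rightarrow> 'm::ab_group_add \<Rightarrow> 'm) \<Rightarrow> 'm set \<Rightarrow>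
   ('r \<Rightarrow> 'n::ab_group_add \<Rightarrow> 'n) \<Rightarrow> 'n set \<Rightarrow> ('m \<times> 'n \<Rightarrow>\<^sub>0 'r) set set" where
  "tensor_product R s M t N =
     free_module R (M \<times> N) //
       {(u, v). u \<in> free_module R (M \<times> N) \<and> v \<in> free_module R (M \<times> N) \<and>
                u - v \<in> tensor_relations R s M t N}"

definition linear_extension ::
  "('r::zero \<Rightarrow> 'p \<Rightarrow> 'p::comm_monoid_add) \<Rightarrow> ('m \<Rightarrow> 'n \<Rightarrow> 'p) \<Rightarrow> ('m \<times> 'n \<Rightarrow>\<^sub>0 'r) \<Rightarrow> 'p" where
  "linear_extension s b u =
     (\<Sum>(x, y)\<in>Poly_Mapping.keys u. s (Poly_Mapping.lookup u (x, y)) (b x y))"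

text \<open>
  The map induced on the tensor product by a bilinear map \<open>b\<close> into a module with scalar
  multiplication \<open>s\<close>: since \<open>linear_extension s b\<close> is constant on each class, its image of a class
  is a singleton.
\<close>

definition tensor_map ::
  "('r::zero \<Rightarrow> 'p \<Rightarrow> 'p::comm_monoid_add) \<Rightarrow> ('m \<Rightarrow> 'n \<Rightarrow> 'p) \<Rightarrow> ('m \<times> 'n \<Rightarrow>\<^sub>0 'r) set \<Rightarrow> 'p" where
  "tensor_map s b C = the_elem (linear_extension s b ` C)"

definition compositum :: "'a::field set \<Rightarrow> 'a set \<Rightarrow> 'a set" where
  "compositum E F = generate_field ring_of_type_algebra (E \<union> F)"

definition linearly_disjoint :: "'a::field set \<Rightarrow> 'a set \<Rightarrow> 'a set \<Rightarrow> bool" where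
  "linearly_disjoint K E F \<longleftrightarrow> inj_on (tensor_map (*) (*)) (tensor_product K (*) E (*) F)"

definition arithmetically_disjoint :: "'a::field set \<Rightarrow> 'a set \<Rightarrow> 'a set \<Rightarrow> 'a set \<Rightarrow> bool" where
  "arithmetically_disjoint R K E F \<longleftrightarrow>
     linearly_disjoint K E F \<and>
     bij_betw (tensor_map (*) (*))
       (tensor_product R (*) (integral_closure R E) (*) (integral_closure R F))
       (integral_closure R (compositum E F))"

definition Perm :: "'y set \<Rightarrow> ('y \<Rightarrow> 'y) monoid" where
  "Perm Y = \<lparr>carrier = {p. p permutes Y}, monoid.mult = (\<circ>), one = id\<rparr>"

definition regular :: "'y set \<Rightarrow> ('y \<Rightarrow> 'y) set \<Rightarrow> bool" where
  "regular Y N \<longleftrightarrow> subgroup N (Perm Y) \<and> (\<forall>x\<in>Y. \<forall>y\<in>Y. \<exists>!n. n \<in> N \<and> n x = y)"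

definition conj_perm :: "('y \<Rightarrow> 'y) \<Rightarrow> ('y \<Rightarrow> 'y) \<Rightarrow> ('y \<Rightarrow> 'y)" where
  "conj_perm p n = p \<circ> n \<circ> inv_into UNIV p"

definition normalized_by :: "('y \<Rightarrow> 'y) set \<Rightarrow> ('g \<Rightarrow> 'y \<Rightarrow> 'y) \<Rightarrow> 'g set \<Rightarrow> bool" where
  "normalized_by N \<rho> \<Gamma> \<longleftrightarrow> (\<forall>g\<in>\<Gamma>. conj_perm (\<rho> g) ` N = N)"

text \<open>
  The groups below are groups of automorphisms of \<^typ>\<open>'a\<close>, with composition as multiplication and
  \<^const>\<open>id\<close> as unit. Permutations of a set of automorphisms are the identity outside of that set.
\<close>

definition semidirect :: "('g, 'b) monoid_scheme \<Rightarrow> 'g set \<Rightarrow> 'g set \<Rightarrow> bool" where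
  "semidirect \<G> J G' \<longleftrightarrow> J \<lhd> \<G> \<and> subgroup G' \<G> \<and> J \<inter> G' = {\<one>\<^bsub>\<G>\<^esub>} \<and> J <#>\<^bsub>\<G>\<^esub> G' = carrier \<G>"

definition J_part :: "('a \<Rightarrow> 'a) set \<Rightarrow> ('a \<Rightarrow> 'a) set \<Rightarrow> ('a \<Rightarrow> 'a) \<Rightarrow> ('a \<Rightarrow> 'a)" where
  "J_part J G' g = (THE \<sigma>. \<sigma> \<in> J \<and> (\<exists>\<tau>\<in>G'. g = \<sigma> \<circ> \<tau>))"

definition G'_part :: "('a \<Rightarrow> 'a) set \<Rightarrow> ('a \<Rightarrow> 'a) set \<Rightarrow> ('a \<Rightarrow> 'a) \<Rightarrow> ('a \<Rightarrow> 'a)" where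
  "G'_part J G' g = (THE \<tau>. \<tau> \<in> G' \<and> (\<exists>\<sigma>\<in>J. g = \<sigma> \<circ> \<tau>))"

definition left_regular :: "('a \<Rightarrow> 'a) set \<Rightarrow> ('a \<Rightarrow> 'a) \<Rightarrow> ('a \<Rightarrow> 'a) \<Rightarrow> ('a \<Rightarrow> 'a)" where
  "left_regular Y g = (\<lambda>h. if h \<in> Y then g \<circ> h else h)"

definition lambda_c ::
  "('a \<Rightarrow> 'a) set \<Rightarrow> ('a \<Rightarrow> 'a) set \<Rightarrow> ('a \<Rightarrow> 'a) \<Rightarrow> ('a \<Rightarrow> 'a) \<Rightarrow> ('a \<Rightarrow> 'a)" where
  "lambda_c J G' g =
     (\<lambda>h. if h \<in> J then J_part J G' g \<circ> G'_part J G' g \<circ> h \<circ> inv_into UNIV (G'_part J G' g) else h)"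

definition iota ::
  "('a \<Rightarrow> 'a) set \<Rightarrow> ('a \<Rightarrow> 'a) set \<Rightarrow> ('a \<Rightarrow> 'a) set \<Rightarrow>
   (('a \<Rightarrow> 'a) \<Rightarrow> ('a \<Rightarrow> 'a)) \<Rightarrow> (('a \<Rightarrow> 'a) \<Rightarrow> ('a \<Rightarrow> 'a)) \<Rightarrow> ('a \<Rightarrow> 'a) \<Rightarrow> ('a \<Rightarrow> 'a)" where
  "iota G J G' \<phi> \<psi> = (\<lambda>g. if g \<in> G then \<phi> (J_part J G' g) \<circ> \<psi> (G'_part J G' g) else g)"

text \<open>
  The element \<open>\<Sum>\<^sub>i c\<^sub>i n\<^sub>i\<close> of the group algebra \<open>M[N]\<close> is the finitely supported function
  \<open>n\<^sub>i \<mapsto> c\<^sub>i\<close>, that is, \<open>M[N]\<close> is \<open>free_module M N\<close>. The automorphism \<open>\<sigma>\<close> acts on it by \<open>\<sigma>\<close> on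
  coefficients and by conjugation with \<open>p\<close> on \<open>N\<close>.
\<close>

definition galois_act :: "('a \<Rightarrow> 'a) \<Rightarrow> ('y \<Rightarrow> 'y) \<Rightarrow> (('y \<Rightarrow> 'y) \<Rightarrow>\<^sub>0 'a) \<Rightarrow> (('y \<Rightarrow> 'y) \<Rightarrow>\<^sub>0 'a::field)" where
  "galois_act \<sigma> p c =
     (\<Sum>n\<in>Poly_Mapping.keys c. Poly_Mapping.single (conj_perm p n) (\<sigma> (Poly_Mapping.lookup c n)))"

definition fixed_group_algebra ::
  "'a::field set \<Rightarrow> ('y \<Rightarrow> 'y) set \<Rightarrow> ('a \<Rightarrow> 'a) set \<Rightarrow> (('a \<Rightarrow> 'a) \<Rightarrow> 'y \<Rightarrow> 'y) \<Rightarrow>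
   (('y \<Rightarrow> 'y) \<Rightarrow>\<^sub>0 'a) set" where
  "fixed_group_algebra M N \<Gamma> \<rho> = {c \<in> free_module M N. \<forall>g\<in>\<Gamma>. galois_act g (\<rho> g) c = c}"

text \<open>
  The action \<open>(\<Sum>\<^sub>i c\<^sub>i n\<^sub>i) \<cdot> x = \<Sum>\<^sub>i c\<^sub>i n\<^sub>i\<^sup>-\<^sup>1(1)(x)\<close>, where \<open>1\<close> is the unit of the group of
  automorphisms on which the \<open>n\<^sub>i\<close> act.
\<close>

definition hopf_act :: "((('a \<Rightarrow> 'a) \<Rightarrow> ('a \<Rightarrow> 'a)) \<Rightarrow>\<^sub>0 'a) \<Rightarrow> 'a \<Rightarrow> 'a::field" where
  "hopf_act c x = (\<Sum>n\<in>Poly_Mapping.keys c. Poly_Mapping.lookup c n * (inv_into UNIV n id) x)"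

text \<open>The identification \<open>(\<Sum>\<^sub>i c\<^sub>i n\<^sub>i) \<otimes> (\<Sum>\<^sub>j d\<^sub>j m\<^sub>j) \<mapsto> \<Sum>\<^sub>i\<^sub>j c\<^sub>i d\<^sub>j \<iota>(n\<^sub>i, m\<^sub>j)\<close>.\<close>

definition group_algebra_product ::
  "('p \<Rightarrow> 'q \<Rightarrow> 'k) \<Rightarrow> ('p \<Rightarrow>\<^sub>0 'a) \<Rightarrow> ('q \<Rightarrow>\<^sub>0 'a) \<Rightarrow> ('k \<Rightarrow>\<^sub>0 'a::field)" where
  "group_algebra_product \<iota> c d =
     (\<Sum>n\<in>Poly_Mapping.keys c. \<Sum>m\<in>Poly_Mapping.keys d.
        Poly_Mapping.single (\<iota> n m) (Poly_Mapping.lookup c n * Poly_Mapping.lookup d m))"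

definition associated_order ::
  "((('a \<Rightarrow> 'a) \<Rightarrow> ('a \<Rightarrow> 'a)) \<Rightarrow>\<^sub>0 'a) set \<Rightarrow> 'a::field set \<Rightarrow> ((('a \<Rightarrow> 'a) \<Rightarrow> ('a \<Rightarrow> 'a)) \<Rightarrow>\<^sub>0 'a) set" where
  "associated_order A OM = {\<alpha> \<in> A. \<forall>x\<in>OM. hopf_act \<alpha> x \<in> OM}"

definition free_generator ::
  "((('a \<Rightarrow> 'a) \<Rightarrow> ('a \<Rightarrow> 'a)) \<Rightarrow>\<^sub>0 'a) set \<Rightarrow> 'a::field set \<Rightarrow> 'a \<Rightarrow> bool" where
  "free_generator \<AA> OM \<beta> \<longleftrightarrow> \<beta> \<in> OM \<and> bij_betw (\<lambda>a. hopf_act a \<beta>) \<AA> OM"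

definition is_free :: "((('a \<Rightarrow> 'a) \<Rightarrow> ('a \<Rightarrow> 'a)) \<Rightarrow>\<^sub>0 'a) set \<Rightarrow> 'a::field set \<Rightarrow> bool" where
  "is_free \<AA> OM \<longleftrightarrow> (\<exists>\<beta>. free_generator \<AA> OM \<beta>)"

end

(*
  Let O be the principal ideal domain. For x in E and y in F one has (h (x) c)(x y) = h(x) c(y),
  where h is in H_1 and c in the second Hopf algebra. Trace forms embed O_E, O_F and A_1 into free
  O-modules of finite rank, so all three are free. Let b run through a basis of A_1 and v through a
  basis of O_F. By Galois descent every element of H is a sum of b (x) c_b with unique c_b. Writing
  c_b(y) = sum_v k_vb v, the value at x y becomes sum_v (sum_b k_vb b)(x) v, and by arithmetic
  disjointness the v are a basis of O_L over O_E (and independent over E). So the element maps O_L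
  into itself iff sum_b k_vb b lies in A_1 for all v and y, that is, iff all k_vb are in O, that is,
  iff all c_b lie in A_2. Evaluation at gamma delta is treated by the same expansion.
*)

theory Submission
  imports Defs
begin

subsection \<open>Lattices over principal ideal domains\<close>

text \<open>Separability never appears through minimal polynomials, and no dimensions are compared.
  One device does this work: elements l_i, m_i of the big field such that the sum over i of g(l_i)
  h(m_i) is 1 if g = h and 0 otherwise, for g, h in G. It shows that the trace form is
  nondegenerate, that only the elements of a subgroup U fix the fixed field of U, that E and F
  generate L and that the Hopf algebras act faithfully, and it turns descent into an explicit
  formula. Where the m_i have to come from a subfield, it is enough that this subfield separates the
  automorphisms in question from the identity. Coordinate functionals of a lattice are total and
  K-linear on the whole ambient module. Thus coordinates for a basis of A_1 or O_F also make sense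
  on H_1 or F, and membership in the lattice becomes a condition on coordinates. A basis of O_F is
  independent over E, although it is constructed over O only, because G' fixes E and J fixes
  F.\<close>

locale pid_subring =
  fixes R :: "'a::field set"
  assumes R_zero: "0 \<in> R" and R_one: "1 \<in> R"
    and R_add: "\<lbrakk>x \<in> R; y \<in> R\<rbrakk> \<Longrightarrow> x + y \<in> R"
    and R_uminus: "x \<in> R \<Longrightarrow> - x \<in> R"
    and R_mult: "\<lbrakk>x \<in> R; y \<in> R\<rbrakk> \<Longrightarrow> x * y \<in> R"
    and principal: "\<lbrakk>I \<subseteq> R; 0 \<in> I; \<And>x y. \<lbrakk>x \<in> I; y \<in> I\<rbrakk> \<Longrightarrow> x + y \<in> I;
      \<And>r x. \<lbrakk>r \<in> R; x \<in> I\<rbrakk> \<Longrightarrow> r * x \<in> I\<rbrakk> \<Longrightarrow> \<exists>d\<in>I. \<forall>x\<in>I. \<exists>r\<in>R. x = r * d"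
begin

abbreviation K :: "'a set" where "K \<equiv> quotient_field R"

lemma R_diff: "\<lbrakk>x \<in> R; y \<in> R\<rbrakk> \<Longrightarrow> x - y \<in> R"
  using R_add[of x "- y"] R_uminus by simp

lemma R_sum: "(\<And>i. i \<in> I \<Longrightarrow> f i \<in> R) \<Longrightarrow> sum f I \<in> R"
  by (induction I rule: infinite_finite_induct) (auto intro: R_zero R_add)

lemma R_power: "x \<in> R \<Longrightarrow> x ^ n \<in> R"
  by (induction n) (auto intro: R_one R_mult)

lemma R_subset_K: "x \<in> R \<Longrightarrow> x \<in> K"
  unfolding quotient_field_def mem_Collect_eq
  by (rule exI[of _ x], rule exI[of _ 1]) (use R_one in simp)

lemma K_frac: "\<lbrakk>a \<in> R; b \<in> R; b \<noteq> 0\<rbrakk> \<Longrightarrow> a / b \<in> K"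
  unfolding quotient_field_def by auto

lemma K_E:
  assumes "x \<in> K"
  obtains a b where "a \<in> R" "b \<in> R" "b \<noteq> 0" "x = a / b"
  using assms unfolding quotient_field_def by auto

lemma K_add: "\<lbrakk>x \<in> K; y \<in> K\<rbrakk> \<Longrightarrow> x + y \<in> K"
  by (elim K_E) (auto simp: add_frac_eq intro!: K_frac R_add R_mult)

lemma K_mult: "\<lbrakk>x \<in> K; y \<in> K\<rbrakk> \<Longrightarrow> x * y \<in> K"
  by (elim K_E) (auto intro!: K_frac R_mult)

lemma K_uminus: "x \<in> K \<Longrightarrow> - x \<in> K"
  using K_mult[of "- 1" x] R_subset_K[OF R_uminus[OF R_one]] by simp

lemma K_divide: "\<lbrakk>x \<in> K; y \<in> K\<rbrakk> \<Longrightarrow> x / y \<in> K"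
proof (elim K_E)
  fix a b c d assume *: "a \<in> R" "b \<in> R" "b \<noteq> 0" "x = a / b" "c \<in> R" "d \<in> R" "d \<noteq> 0" "y = c / d"
  show "x / y \<in> K"
  proof (cases "c = 0")
    case True
    then show ?thesis using * R_subset_K[OF R_zero] by simp
  next
    case False
    then show ?thesis using * K_frac[of "a * d" "b * c"] R_mult by simp
  qed
qed

lemma K_zero: "0 \<in> K" and K_one: "1 \<in> K"
  using R_subset_K R_zero R_one by auto

text \<open>\<open>P\<close> is kept abstract because denominators are cleared towards
  \<open>R\<close> and later towards the integral closure of \<open>R\<close> in the whole
  field.\<close>

lemma common_denominator:
  assumes "finite Y" and "\<And>x. x \<in> Y \<Longrightarrow> \<exists>d. d \<in> R \<and> d \<noteq> 0 \<and> P (d * x)"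
    and "\<And>r x. \<lbrakk>r \<in> R; P x\<rbrakk> \<Longrightarrow> P (r * x)"
  shows "\<exists>d\<in>R. d \<noteq> 0 \<and> (\<forall>x\<in>Y. P (d * x))"
  using assms(1,2)
proof (induction Y rule: finite_induct)
  case empty
  then show ?case using R_one by (auto intro: bexI[of _ 1])
next
  case (insert x Y)
  obtain d where d: "d \<in> R" "d \<noteq> 0" "\<forall>x\<in>Y. P (d * x)" using insert by blast
  obtain e where e: "e \<in> R" "e \<noteq> 0" "P (e * x)" using insert.prems[of x] by blast
  have "P ((e * d) * y)" if "y \<in> Y" for y
    using assms(3)[of e "d * y"] d e that by (simp add: mult.assoc)
  moreover have "P ((e * d) * x)" using assms(3)[of d "e * x"] d e by (simp add: mult_ac)
  ultimately show ?case using d e R_mult by (intro bexI[of _ "e * d"]) auto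
qed

lemma K_common_denominator:
  assumes "finite Y" "Y \<subseteq> K"
  shows "\<exists>d\<in>R. d \<noteq> 0 \<and> (\<forall>x\<in>Y. d * x \<in> R)"
proof (rule common_denominator[OF assms(1)])
  fix x assume "x \<in> Y"
  then obtain a b where "a \<in> R" "b \<in> R" "b \<noteq> 0" "x = a / b" using assms(2) by (blast elim: K_E)
  then show "\<exists>d. d \<in> R \<and> d \<noteq> 0 \<and> d * x \<in> R" by (intro exI[of _ b]) auto
qed (rule R_mult)

text \<open>Homogeneity is asked for scalars in \<open>K\<close> only, although \<open>s\<close>
  accepts the whole field: trace functionals are not linear beyond \<open>K\<close>. The functional
  is total, so that it can be evaluated outside the lattice on which it is integral.\<close>

definition K_linear :: "('a \<Rightarrow> 'b \<Rightarrow> 'b) \<Rightarrow> ('b::ab_group_add \<Rightarrow> 'a) \<Rightarrow> bool" where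
  "K_linear s f \<longleftrightarrow> (\<forall>u v. f (u + v) = f u + f v) \<and> (\<forall>k\<in>K. \<forall>v. f (s k v) = k * f v)"

definition submodule :: "('a \<Rightarrow> 'b \<Rightarrow> 'b) \<Rightarrow> 'b::ab_group_add set \<Rightarrow> bool" where
  "submodule s M \<longleftrightarrow> 0 \<in> M \<and> (\<forall>u\<in>M. \<forall>v\<in>M. u + v \<in> M) \<and> (\<forall>r\<in>R. \<forall>v\<in>M. s r v \<in> M)"

text \<open>The basis comes with its dual family of coordinate functionals, so independence becomes
  a matter of evaluating \<open>g\<close>.\<close>

definition lattice_basis ::
  "('a \<Rightarrow> 'b \<Rightarrow> 'b) \<Rightarrow> 'b::ab_group_add set \<Rightarrow> 'b set \<Rightarrow> ('b \<Rightarrow> 'b \<Rightarrow> 'a) \<Rightarrow> bool" where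
  "lattice_basis s M B g \<longleftrightarrow> finite B \<and> B \<subseteq> M \<and> (\<forall>b\<in>B. K_linear s (g b)) \<and>
     (\<forall>b\<in>B. \<forall>c\<in>B. g b c = (if b = c then 1 else 0)) \<and> (\<forall>v\<in>M. \<forall>b\<in>B. g b v \<in> R) \<and>
     (\<forall>v\<in>M. v = (\<Sum>b\<in>B. s (g b v) b))"

lemma K_linearI:
  "\<lbrakk>\<And>u v. f (u + v) = f u + f v; \<And>k v. k \<in> K \<Longrightarrow> f (s k v) = k * f v\<rbrakk> \<Longrightarrow> K_linear s f"
  by (simp add: K_linear_def)

lemma K_linear_add: "K_linear s f \<Longrightarrow> f (u + v) = f u + f v"
  by (simp add: K_linear_def)

lemma K_linear_scale: "\<lbrakk>K_linear s f; k \<in> K\<rbrakk> \<Longrightarrow> f (s k v) = k * f v"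
  by (simp add: K_linear_def)

lemma K_linear_zero: "K_linear s f \<Longrightarrow> f 0 = 0"
  using K_linear_add[of s f 0 0] by (metis add_cancel_right_right add_0)

lemma K_linear_diff: "K_linear s f \<Longrightarrow> f (u - v) = f u - f v"
  using K_linear_add[of s f "u - v" v] by (simp add: algebra_simps)

lemma K_linear_sum: "K_linear s f \<Longrightarrow> f (sum h I) = (\<Sum>i\<in>I. f (h i))"
  by (induction I rule: infinite_finite_induct) (simp_all add: K_linear_zero K_linear_add)

lemma submodule_zero: "submodule s M \<Longrightarrow> 0 \<in> M"
  and submodule_add: "\<lbrakk>submodule s M; u \<in> M; v \<in> M\<rbrakk> \<Longrightarrow> u + v \<in> M"
  and submodule_scale: "\<lbrakk>submodule s M; r \<in> R; v \<in> M\<rbrakk> \<Longrightarrow> s r v \<in> M"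
  by (auto simp: submodule_def)

lemma submodule_sum: "\<lbrakk>submodule s M; \<And>i. i \<in> I \<Longrightarrow> h i \<in> M\<rbrakk> \<Longrightarrow> sum h I \<in> M"
  by (induction I rule: infinite_finite_induct) (auto intro: submodule_zero submodule_add)

lemma submodule_uminus:
  "\<lbrakk>Modules.module s; submodule s M; v \<in> M\<rbrakk> \<Longrightarrow> - v \<in> M"
  using submodule_scale[of s M "- 1" v] R_uminus[OF R_one]
  by (simp add: Modules.module.scale_minus_left Modules.module.scale_one)

lemma submodule_diff:
  "\<lbrakk>Modules.module s; submodule s M; u \<in> M; v \<in> M\<rbrakk> \<Longrightarrow> u - v \<in> M"
  using submodule_add[of s M u "- v"] submodule_uminus[of s M v] by simp

lemma lattice_basisD:
  assumes "lattice_basis s M B g"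
  shows "finite B" "B \<subseteq> M" "b \<in> B \<Longrightarrow> K_linear s (g b)"
    "\<lbrakk>b \<in> B; c \<in> B\<rbrakk> \<Longrightarrow> g b c = (if b = c then 1 else 0)"
    "\<lbrakk>v \<in> M; b \<in> B\<rbrakk> \<Longrightarrow> g b v \<in> R" "v \<in> M \<Longrightarrow> v = (\<Sum>b\<in>B. s (g b v) b)"
  using assms unfolding lattice_basis_def by blast+

text \<open>The functionals \<open>f i\<close> embed \<open>M\<close> into a power of
  \<open>R\<close>. Induction on their number: the values of one functional on \<open>M\<close> form
  a principal ideal, generated by its value at some \<open>m\<close>. If this value is nonzero,
  \<open>M\<close> is the direct sum of \<open>R m\<close> and the kernel, on which the remaining
  functionals are still jointly injective.\<close>

lemma ex_lattice_basis:
  assumes s: "Modules.module s" and "finite I" and "submodule s M"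
    and "\<And>i. i \<in> I \<Longrightarrow> K_linear s (f i)" and "\<And>i v. \<lbrakk>i \<in> I; v \<in> M\<rbrakk> \<Longrightarrow> f i v \<in> R"
    and "\<And>v. \<lbrakk>v \<in> M; \<And>i. i \<in> I \<Longrightarrow> f i v = 0\<rbrakk> \<Longrightarrow> v = 0"
  shows "\<exists>B g. lattice_basis s M B g"
  using assms(2-)
proof (induction I arbitrary: M rule: finite_induct)
  case empty
  then have "\<forall>v\<in>M. v = 0" by blast
  then have "lattice_basis s M {} (\<lambda>_ _. 0)" by (auto simp: lattice_basis_def)
  then show ?case by blast
next
  case (insert i I)
  note M = insert.prems(1)
  have lin: "K_linear s (f i)" using insert.prems(2) by simp
  have "\<exists>d\<in>f i ` M. \<forall>x\<in>f i ` M. \<exists>r\<in>R. x = r * d"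
  proof (rule principal)
    show "f i ` M \<subseteq> R" using insert.prems(3) by auto
    show "0 \<in> f i ` M" using K_linear_zero[OF lin] submodule_zero[OF M] by force
    show "x + y \<in> f i ` M" if "x \<in> f i ` M" "y \<in> f i ` M" for x y
      using that by (auto simp flip: K_linear_add[OF lin] intro: submodule_add[OF M])
    show "r * x \<in> f i ` M" if "r \<in> R" "x \<in> f i ` M" for r x
      using that by (auto simp flip: K_linear_scale[OF lin R_subset_K] intro: submodule_scale[OF M])
  qed
  then obtain m where m: "m \<in> M" "\<And>v. v \<in> M \<Longrightarrow> \<exists>r\<in>R. f i v = r * f i m" by auto
  define d where "d = f i m"
  show ?case
  proof (cases "d = 0")
    \<comment> \<open>A functional that vanishes on \<open>M\<close> can simply be dropped.\<close>
    case True
    then have "f i v = 0" if "v \<in> M" for v using m(2)[OF that] by (auto simp: d_def)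
    then show ?thesis using insert.IH[OF M] insert.prems(2,3,4) by (metis insert_iff)
  next
    case False
    have dR: "d \<in> R" using insert.prems(3) m by (simp add: d_def)
    have quot: "f i v / d \<in> R" if "v \<in> M" for v using m(2)[OF that] False by (auto simp: d_def)
    define M' where "M' = {v \<in> M. f i v = 0}"
    have "\<exists>B g. lattice_basis s M' B g"
    proof (rule insert.IH)
      show "submodule s M'"
        unfolding submodule_def M'_def
        using submodule_zero[OF M] submodule_add[OF M] submodule_scale[OF M] K_linear_zero[OF lin]
        by (auto simp: K_linear_add[OF lin] K_linear_scale[OF lin R_subset_K])
      show "v = 0" if "v \<in> M'" "\<And>i. i \<in> I \<Longrightarrow> f i v = 0" for v
        by (rule insert.prems(4)) (use that in \<open>auto simp: M'_def\<close>)
    qed (use insert.prems in \<open>auto simp: M'_def\<close>)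
    then obtain B g where B: "lattice_basis s M' B g" by blast
    note B' = lattice_basisD[OF B]
    \<comment> \<open>\<open>p\<close> projects onto the kernel along \<open>m\<close>; the
      coordinate at a member of \<open>B\<close> is its old coordinate after this
      projection.\<close>
    define p where "p = (\<lambda>v. v - s (f i v / d) m)"
    define h where "h = (\<lambda>b v. if b = m then f i v / d else g b (p v))"
    have fim: "f i (s (f i v / d) m) = f i v" if "v \<in> M" for v
      using K_linear_scale[OF lin R_subset_K[OF quot[OF that]]] False by (simp add: d_def)
    have pM: "p v \<in> M'" if "v \<in> M" for v
      unfolding M'_def p_def using that quot[OF that] m fim[OF that]
      by (auto intro!: submodule_diff[OF s M] submodule_scale[OF M] simp: K_linear_diff[OF lin])
    have pfix: "p v = v" if "f i v = 0" for v
      using that by (simp add: p_def Modules.module.scale_zero_left[OF s])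
    have pm: "p m = 0" using False by (simp add: p_def d_def Modules.module.scale_one[OF s])
    have mB: "m \<notin> B" using False B'(2) by (auto simp: M'_def d_def)
    have BM: "f i b = 0" if "b \<in> B" for b using B'(2) that by (auto simp: M'_def)
    have "lattice_basis s M (insert m B) h"
      unfolding lattice_basis_def
    proof (intro conjI ballI)
      show "finite (insert m B)" using B'(1) by simp
      show "insert m B \<subseteq> M" using B'(2) m by (auto simp: M'_def)
      show "K_linear s (h b)" if "b \<in> insert m B" for b
      proof (rule K_linearI)
        have padd: "p (u + v) = p u + p v" for u v
          by (simp add: p_def K_linear_add[OF lin] add_divide_distrib
              Modules.module.scale_left_distrib[OF s])
        have pscale: "p (s k v) = s k (p v)" if "k \<in> K" for k v
          using that by (simp add: p_def K_linear_scale[OF lin] Modules.module.scale_scale[OF s]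
              Modules.module.scale_right_diff_distrib[OF s])
        show "h b (u + v) = h b u + h b v" for u v
          using that by (auto simp: h_def K_linear_add[OF lin] add_divide_distrib padd
              K_linear_add[OF B'(3)])
        show "h b (s k v) = k * h b v" if "k \<in> K" for k v
          using that \<open>b \<in> insert m B\<close>
          by (auto simp: h_def K_linear_scale[OF lin] pscale K_linear_scale[OF B'(3)])
      qed
      show "h b c = (if b = c then 1 else 0)" if "b \<in> insert m B" "c \<in> insert m B" for b c
        using that mB False B'(4) BM pfix[OF BM] K_linear_zero[OF B'(3)]
        by (auto simp: h_def pm d_def)
      show "h b v \<in> R" if "v \<in> M" "b \<in> insert m B" for b v
        using that quot B'(5)[OF pM] by (auto simp: h_def)
      show "v = (\<Sum>b\<in>insert m B. s (h b v) b)" if v: "v \<in> M" for v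
      proof -
        have "(\<Sum>b\<in>B. s (h b v) b) = (\<Sum>b\<in>B. s (g b (p v)) b)"
          by (rule sum.cong) (use mB in \<open>auto simp: h_def\<close>)
        also have "\<dots> = p v" using B'(6)[OF pM[OF v]] by simp
        finally show ?thesis using mB B'(1) by (simp add: h_def p_def)
      qed
    qed
    then show ?thesis by blast
  qed
qed

text \<open>Multiplying by the denominator \<open>d\<close> and dividing again extends the expansion
  from the lattice to its span over \<open>K\<close>, with coordinates in \<open>K\<close> instead
  of \<open>R\<close>.\<close>

lemma lattice_basis_span:
  assumes s: "Modules.module s" and B: "lattice_basis s M B g"
    and d: "d \<in> R" "d \<noteq> 0" "s d v \<in> M"
  shows "v = (\<Sum>b\<in>B. s (g b v) b)" and "b \<in> B \<Longrightarrow> g b v \<in> K"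
proof -
  note B' = lattice_basisD[OF B]
  interpret Modules.module s by (rule s)
  have gd: "g b v = g b (s d v) / d" if "b \<in> B" for b
    using K_linear_scale[OF B'(3)[OF that] R_subset_K[OF d(1)]] d by simp
  then show "b \<in> B \<Longrightarrow> g b v \<in> K" using K_frac B'(5) d by auto
  have "v = s (1 / d) (s d v)" using d by simp
  also have "\<dots> = s (1 / d) (\<Sum>b\<in>B. s (g b (s d v)) b)" using B'(6)[OF d(3)] by simp
  also have "\<dots> = (\<Sum>b\<in>B. s (g b v) b)"
    unfolding scale_sum_right by (rule sum.cong) (auto simp: gd)
  finally show "v = (\<Sum>b\<in>B. s (g b v) b)" .
qed

lemma lattice_basis_coord:
  assumes "lattice_basis s M B g" and "\<And>b. b \<in> B \<Longrightarrow> k b \<in> K" and "c \<in> B"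
  shows "g c (\<Sum>b\<in>B. s (k b) b) = k c"
proof -
  note B' = lattice_basisD[OF assms(1)]
  have "g c (\<Sum>b\<in>B. s (k b) b) = (\<Sum>b\<in>B. k b * g c b)"
    using assms by (simp add: K_linear_sum[OF B'(3)] K_linear_scale[OF B'(3)])
  also have "\<dots> = (\<Sum>b\<in>B. if c = b then k b else 0)"
    by (rule sum.cong) (use assms B'(4) in auto)
  finally show ?thesis using B'(1) assms(3) by simp
qed

lemma module_times: "Modules.module ((*) :: 'a \<Rightarrow> 'a \<Rightarrow> 'a)"
  by unfold_locales (auto simp: algebra_simps)

end

subsection \<open>Dual systems and the trace\<close>

text \<open>
  The set of functions of the form \<open>g \<mapsto> \<Sum> l g(m)\<close> with \<open>m \<in> S\<close> is closed under multiplication by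
  \<open>g \<mapsto> g(m\<^sub>h) - h(m\<^sub>h)\<close>, so the product of these factors over all \<open>h \<noteq> id\<close> is of this form.
\<close>

lemma ex_dual_system:
  fixes \<Gamma> :: "('a::field \<Rightarrow> 'a) set"
  assumes "finite \<Gamma>" and S1: "1 \<in> S" and Smult: "\<And>x y. \<lbrakk>x \<in> S; y \<in> S\<rbrakk> \<Longrightarrow> x * y \<in> S"
    and one: "\<And>g. g \<in> \<Gamma> \<Longrightarrow> g 1 = 1" and mult: "\<And>g x y. g \<in> \<Gamma> \<Longrightarrow> g (x * y) = g x * g y"
    and sep: "\<And>g. \<lbrakk>g \<in> \<Gamma>; g \<noteq> id\<rbrakk> \<Longrightarrow> \<exists>m\<in>S. g m \<noteq> m"
  obtains n :: nat and l m :: "nat \<Rightarrow> 'a" where "\<And>i. i < n \<Longrightarrow> m i \<in> S"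
    and "\<And>g. g \<in> \<Gamma> \<Longrightarrow> (\<Sum>i<n. l i * g (m i)) = (if g = id then 1 else 0)"
proof -
  let ?phi = "\<lambda>ps g. \<Sum>(l, m)\<leftarrow>ps. l * g m"
  have "\<exists>ps. snd ` set ps \<subseteq> S \<and> ?phi ps id = 1 \<and> (\<forall>h\<in>\<Delta>. ?phi ps h = 0)"
    if "\<Delta> \<subseteq> \<Gamma> - {id}" for \<Delta>
    using finite_subset[OF that finite_Diff[OF assms(1)]] that
  proof (induction \<Delta> rule: finite_induct)
    case empty
    then show ?case using S1 one by (intro exI[of _ "[(1, 1)]"]) auto
  next
    case (insert h \<Delta>)
    then obtain ps where ps: "snd ` set ps \<subseteq> S" "?phi ps id = 1" "\<forall>h\<in>\<Delta>. ?phi ps h = 0"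
      by auto
    obtain a where a: "a \<in> S" "h a \<noteq> a" using sep[of h] insert.prems by blast
    define c where "c = a - h a"
    have c: "c \<noteq> 0" using a by (auto simp: c_def)
    \<comment> \<open>The first half contributes the factor \<open>g a / c\<close>, the second one
      \<open>- h a / c\<close>. Division by \<open>c = a - h a\<close> keeps the value at
      \<open>id\<close> equal to 1.\<close>
    define qs where "qs = map (\<lambda>(l, m). (l / c, m * a)) ps @ map (\<lambda>(l, m). (- (l * h a / c), m)) ps"
    have mul: "g (m * a) = g m * g a" if "g = id \<or> g \<in> insert h \<Delta>" for g m
      using that insert.prems mult by auto
    have eq: "?phi qs g = ?phi ps g * ((g a - h a) / c)" if "g = id \<or> g \<in> insert h \<Delta>" for g
    proof -
      have "?phi (map (\<lambda>(l, m). (l / c, m * a)) ps) g = ?phi ps g * (g a / c)" for ps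
        by (induction ps) (auto simp: mul[OF that] algebra_simps)
      moreover have "?phi (map (\<lambda>(l, m). (- (l * h a / c), m)) ps) g = - ?phi ps g * (h a / c)" for ps
        by (induction ps) (auto simp: algebra_simps)
      ultimately show ?thesis by (simp add: qs_def diff_divide_distrib algebra_simps)
    qed
    have "snd ` set qs \<subseteq> S"
    proof -
      have "m \<in> S" if "(l, m) \<in> set ps" for l m
        using ps(1) that by (metis image_subset_iff snd_conv)
      then show ?thesis using a Smult by (auto simp: qs_def)
    qed
    moreover have "?phi qs id = 1" using eq[of id] ps(2) c by (simp add: c_def)
    moreover have "\<forall>g\<in>insert h \<Delta>. ?phi qs g = 0" using eq ps(3) by auto
    ultimately show ?case by blast
  qed
  from this[OF subset_refl] obtain ps where ps: "snd ` set ps \<subseteq> S" "?phi ps id = 1"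
    "\<forall>h\<in>\<Gamma> - {id}. ?phi ps h = 0" by blast
  show thesis
  proof
    show "snd (ps ! i) \<in> S" if "i < length ps" for i using ps(1) that by auto
    show "(\<Sum>i<length ps. fst (ps ! i) * g (snd (ps ! i))) = (if g = id then 1 else 0)"
      if "g \<in> \<Gamma>" for g
    proof -
      have "(\<Sum>i<length ps. fst (ps ! i) * g (snd (ps ! i))) = ?phi ps g"
        by (simp add: sum_list_sum_nth atLeast0LessThan case_prod_unfold)
      then show ?thesis using ps that by auto
    qed
  qed
qed

text \<open>In Artin's manner, the Galois extension is represented by a finite group of
  automorphisms and the equality of its fixed field with \<open>K\<close>.\<close>

locale galois_pid = pid_subring R for R :: "'a::field set" +
  fixes G :: "('a \<Rightarrow> 'a) set"
  assumes finite_G: "finite G" and id_G: "id \<in> G"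
    and comp_G: "\<lbrakk>g \<in> G; h \<in> G\<rbrakk> \<Longrightarrow> g \<circ> h \<in> G"
    and bij_G: "g \<in> G \<Longrightarrow> bij g" and inv_G: "g \<in> G \<Longrightarrow> inv_into UNIV g \<in> G"
    and G_one: "g \<in> G \<Longrightarrow> g 1 = 1" and G_add: "g \<in> G \<Longrightarrow> g (x + y) = g x + g y"
    and G_mult: "g \<in> G \<Longrightarrow> g (x * y) = g x * g y"
    and fixed_G: "(\<forall>g\<in>G. g x = x) \<longleftrightarrow> x \<in> K"
begin

lemma G_zero: "g \<in> G \<Longrightarrow> g 0 = 0"
  using G_add[of g 0 0] by (metis add_cancel_right_right add_0)

lemma G_sum: "g \<in> G \<Longrightarrow> g (sum f I) = (\<Sum>i\<in>I. g (f i))"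
  by (induction I rule: infinite_finite_induct) (auto simp: G_zero G_add)

lemma G_K: "\<lbrakk>g \<in> G; k \<in> K\<rbrakk> \<Longrightarrow> g k = k"
  using fixed_G by blast

lemma G_inv: "g \<in> G \<Longrightarrow> g (inv_into UNIV g x) = x" "g \<in> G \<Longrightarrow> inv_into UNIV g (g x) = x"
  "g \<in> G \<Longrightarrow> g \<circ> inv_into UNIV g = id" "g \<in> G \<Longrightarrow> inv_into UNIV g \<circ> g = id"
  using bij_G[of g] by (auto simp: fun_eq_iff bij_is_surj surj_f_inv_f bij_is_inj)

lemma inv_inv_G: "g \<in> G \<Longrightarrow> inv_into UNIV (inv_into UNIV g) = g"
  using bij_G inv_inv_eq by blast

lemma bij_betw_comp_left: "g \<in> G \<Longrightarrow> bij_betw (\<lambda>h. g \<circ> h) G G"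
  by (rule bij_betwI[where g = "\<lambda>h. inv_into UNIV g \<circ> h"])
    (auto simp: G_inv comp_G inv_G simp flip: comp_assoc)

lemma sum_G_left: "g \<in> G \<Longrightarrow> (\<Sum>h\<in>G. f (g \<circ> h)) = (\<Sum>h\<in>G. f h)"
  using sum.reindex_bij_betw[OF bij_betw_comp_left] .

section \<open>The trace form and dual systems for the whole group\<close>

definition Tr :: "'a \<Rightarrow> 'a" where "Tr x = (\<Sum>g\<in>G. g x)"

lemma Tr_in_K: "Tr x \<in> K"
proof -
  have "g (Tr x) = Tr x" if "g \<in> G" for g
    using sum_G_left[OF that, of "\<lambda>h. h x"] by (simp add: Tr_def G_sum[OF that])
  then show ?thesis using fixed_G by blast
qed

lemma Tr_add: "Tr (x + y) = Tr x + Tr y"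
  by (simp add: Tr_def G_add sum.distrib)

lemma Tr_mult_K: "k \<in> K \<Longrightarrow> Tr (k * x) = k * Tr x"
  by (simp add: Tr_def G_mult G_K sum_distrib_left)

text \<open>Applying g to the one-sided relation for \<open>g^{-1} h\<close> gives orthogonality for
  all pairs. This is Dedekind's independence of automorphisms in explicit form.\<close>

lemma ex_dual_system_G:
  obtains n :: nat and l m :: "nat \<Rightarrow> 'a" where
    "\<And>g h. \<lbrakk>g \<in> G; h \<in> G\<rbrakk> \<Longrightarrow> (\<Sum>i<n. g (l i) * h (m i)) = (if g = h then 1 else 0)"
proof -
  obtain n l m where d: "\<And>g. g \<in> G \<Longrightarrow> (\<Sum>i<n::nat. l i * g (m i)) = (if g = id then 1 else 0)"
  proof (rule ex_dual_system[of G UNIV])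
    show "\<exists>m\<in>UNIV. g m \<noteq> m" if "g \<noteq> id" for g :: "'a \<Rightarrow> 'a"
      using that by (auto simp: fun_eq_iff)
  qed (use finite_G G_one G_mult in auto)
  have "(\<Sum>i<n. g (l i) * h (m i)) = (if g = h then 1 else 0)" if gh: "g \<in> G" "h \<in> G" for g h
  proof -
    have "(\<Sum>i<n. g (l i) * h (m i)) = g (\<Sum>i<n. l i * (inv_into UNIV g \<circ> h) (m i))"
      using gh by (simp add: G_sum G_mult G_inv)
    also have "\<dots> = (if inv_into UNIV g \<circ> h = id then 1 else 0)"
      using d[OF comp_G[OF inv_G[OF gh(1)] gh(2)]] gh by (simp add: G_one G_zero)
    also have "inv_into UNIV g \<circ> h = id \<longleftrightarrow> g = h"
      using gh by (metis G_inv(3,4) comp_assoc comp_id id_comp)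
    finally show ?thesis .
  qed
  then show thesis using that by blast
qed

text \<open>With the \<open>m i\<close> taken from \<open>S\<close>, applying g to the relation for
  its inverse moves the automorphism over to the \<open>l i\<close>. In the sum of the
  \<open>Tr (x * l i) * m i\<close>, everything but the term of \<open>id\<close> then cancels. So a
  multiplicatively closed set that separates \<open>id\<close> from the rest of \<open>G\<close>
  spans the field over \<open>K\<close>.\<close>

lemma separated_imp_span:
  assumes "1 \<in> S" and "\<And>x y. \<lbrakk>x \<in> S; y \<in> S\<rbrakk> \<Longrightarrow> x * y \<in> S"
    and sep: "\<And>g. \<lbrakk>g \<in> G; g \<noteq> id\<rbrakk> \<Longrightarrow> \<exists>m\<in>S. g m \<noteq> m"
  obtains n :: nat and l m :: "nat \<Rightarrow> 'a" where "\<And>i. i < n \<Longrightarrow> m i \<in> S"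
    "\<And>x. x = (\<Sum>i<n. Tr (x * l i) * m i)"
proof -
  obtain n l m where m: "\<And>i. i < n \<Longrightarrow> m i \<in> S"
    and d: "\<And>g. g \<in> G \<Longrightarrow> (\<Sum>i<n::nat. l i * g (m i)) = (if g = id then 1 else 0)"
    by (rule ex_dual_system[of G S]) (use finite_G G_one G_mult assms in blast)+
  have d': "(\<Sum>i<n. g (l i) * m i) = (if g = id then 1 else 0)" if g: "g \<in> G" for g
  proof -
    have "(\<Sum>i<n. g (l i) * m i) = g (\<Sum>i<n. l i * inv_into UNIV g (m i))"
      using g by (simp add: G_sum G_mult G_inv)
    also have "\<dots> = (if inv_into UNIV g = id then 1 else 0)"
      using d[OF inv_G[OF g]] g by (simp add: G_one G_zero)
    also have "inv_into UNIV g = id \<longleftrightarrow> g = id"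
      using inv_inv_G[OF g] by (metis inv_id)
    finally show ?thesis .
  qed
  have "x = (\<Sum>i<n. Tr (x * l i) * m i)" for x
  proof -
    have "(\<Sum>i<n. Tr (x * l i) * m i) = (\<Sum>i<n. \<Sum>g\<in>G. g x * (g (l i) * m i))"
      by (simp add: Tr_def G_mult sum_distrib_left sum_distrib_right mult_ac)
    also have "\<dots> = (\<Sum>g\<in>G. g x * (\<Sum>i<n. g (l i) * m i))"
      by (subst sum.swap) (simp add: sum_distrib_left)
    also have "\<dots> = (\<Sum>g\<in>G. if g = id then g x else 0)"
      by (rule sum.cong) (auto simp: d')
    also have "\<dots> = x" using finite_G id_G by simp
    finally show ?thesis by simp
  qed
  with m show thesis using that by blast
qed

lemma Tr_span:
  obtains n :: nat and l m :: "nat \<Rightarrow> 'a" where "\<And>x. x = (\<Sum>i<n. Tr (x * l i) * m i)"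
proof (rule separated_imp_span[of UNIV])
  show "\<exists>m\<in>UNIV. g m \<noteq> m" if "g \<noteq> id" for g :: "'a \<Rightarrow> 'a"
    using that by (auto simp: fun_eq_iff)
qed (use that in auto)

lemma Tr_nondegenerate:
  assumes "\<And>y. Tr (x * y) = 0"
  shows "x = 0"
proof -
  obtain n :: nat and l m where "\<And>x. x = (\<Sum>i<n. Tr (x * l i) * m i)" by (rule Tr_span) blast
  from this[of x] show ?thesis using assms by simp
qed

text \<open>Descent averages over \<open>G\<close>. As the order of \<open>G\<close> may vanish in
  the field, an element of trace 1 takes the place of its inverse.\<close>

lemma ex_Tr_eq_one: obtains l where "Tr l = 1"
proof -
  obtain y where y: "Tr y \<noteq> 0" using Tr_nondegenerate[of 1] by auto
  have "Tr ((1 / Tr y) * y) = 1"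
    using y by (subst Tr_mult_K) (auto intro: K_divide K_one Tr_in_K)
  then show thesis using that by blast
qed

end

subsection \<open>Integral elements\<close>

lemma integral_closure_iff:
  "x \<in> integral_closure R M \<longleftrightarrow> x \<in> M \<and> x \<in> integral_closure R UNIV"
  by (auto simp: integral_closure_def)

context pid_subring
begin

abbreviation R_poly :: "'a poly \<Rightarrow> bool" where
  "R_poly p \<equiv> \<forall>i. Polynomial.coeff p i \<in> R"

lemma integral_powers:
  assumes "x \<in> integral_closure R UNIV"
  obtains m where "\<And>n. \<exists>c. (\<forall>i. c i \<in> R) \<and> x ^ n = (\<Sum>i<m. c i * x ^ i)" and "m > (0::nat)"
proof -
  obtain p where p: "R_poly p" "lead_coeff p = 1" "poly p x = 0"
    using assms by (auto simp: integral_closure_def)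
  have "Polynomial.degree p \<noteq> 0"
  proof
    assume "Polynomial.degree p = 0"
    then have "p = [:1:]" using p(2) by (metis degree_eq_zeroE coeff_pCons_0)
    then show False using p(3) by simp
  qed
  then obtain m where m: "Polynomial.degree p = Suc m" by (cases "Polynomial.degree p") auto
  have xm: "x ^ Suc m = - (\<Sum>i<Suc m. Polynomial.coeff p i * x ^ i)"
    using p(2,3) m by (simp add: poly_altdef lessThan_Suc_atMost eq_neg_iff_add_eq_0 add.commute)
  have "\<exists>c. (\<forall>i. c i \<in> R) \<and> x ^ n = (\<Sum>i<Suc m. c i * x ^ i)" for n
  proof (induction n)
    case 0
    have "(\<Sum>i<Suc m. (if i = 0 then 1 else 0) * x ^ i) = 1"
      by (subst sum.lessThan_Suc_shift) simp
    then show ?case using R_zero R_one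
      by (intro exI[of _ "\<lambda>i. if i = 0 then 1 else 0"]) auto
  next
    case (Suc n)
    then obtain c where c: "\<And>i. c i \<in> R" "x ^ n = (\<Sum>i<Suc m. c i * x ^ i)" by blast
    \<comment> \<open>Multiplication by x shifts the coefficients by one place; the overflowing
      power is rewritten by the monic equation \<open>xm\<close>.\<close>
    define d where "d = (\<lambda>i. (if i = 0 then 0 else c (i - 1)) - c m * Polynomial.coeff p i)"
    have "x ^ Suc n = (\<Sum>i<m. c i * x ^ Suc i) + c m * x ^ Suc m"
      by (simp add: c(2) sum_distrib_left algebra_simps)
    also have "(\<Sum>i<m. c i * x ^ Suc i) = (\<Sum>i<Suc m. (if i = 0 then 0 else c (i - 1)) * x ^ i)"
      by (subst sum.lessThan_Suc_shift) simp
    also have "\<dots> + c m * x ^ Suc m = (\<Sum>i<Suc m. d i * x ^ i)"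
      unfolding xm d_def by (simp only: left_diff_distrib sum_subtractf sum_distrib_left mult.assoc
        mult_minus_right add_uminus_conv_diff)
    finally have "x ^ Suc n = (\<Sum>i<Suc m. d i * x ^ i)" .
    moreover have "d i \<in> R" for i
      unfolding d_def using c(1) p(1) R_zero R_diff R_mult R_uminus by (cases "i = 0") auto
    ultimately show ?case by blast
  qed
  then show thesis using that[of "Suc m"] by blast
qed

text \<open>A principal ideal domain is integrally closed: the powers of x have a common denominator
  \<open>d\<close>, so \<open>d R[x]\<close> is an ideal of \<open>R\<close>, generated by some
  nonzero \<open>t\<close>. It is stable under multiplication by x, whence \<open>x t = r t\<close>
  with r in \<open>R\<close>.\<close>

lemma integral_in_K:
  assumes "x \<in> integral_closure R UNIV" and "x \<in> K"
  shows "x \<in> R"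
proof -
  obtain m where m: "\<And>n. \<exists>c. (\<forall>i. c i \<in> R) \<and> x ^ n = (\<Sum>i<m. c i * x ^ i)"
    using integral_powers[OF assms(1)] by blast
  have xK: "x ^ i \<in> K" for i by (induction i) (auto intro: K_one K_mult assms(2))
  obtain d where d: "d \<in> R" "d \<noteq> 0" "\<And>i. i < m \<Longrightarrow> d * x ^ i \<in> R"
    using K_common_denominator[of "(\<lambda>i. x ^ i) ` {..<m}"] xK by auto
  have dx: "d * x ^ n \<in> R" for n
  proof -
    obtain c where c: "\<And>i. c i \<in> R" "x ^ n = (\<Sum>i<m. c i * x ^ i)" using m[of n] by blast
    have "d * x ^ n = (\<Sum>i<m. c i * (d * x ^ i))"
      unfolding c(2) sum_distrib_left by (simp add: mult_ac)
    then show ?thesis by (auto intro!: R_sum R_mult[OF c(1)] d(3))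
  qed
  define I where "I = {d * poly p x | p. R_poly p}"
  have "\<exists>t\<in>I. \<forall>y\<in>I. \<exists>r\<in>R. y = r * t"
  proof (rule principal)
    show "I \<subseteq> R"
    proof
      fix y assume "y \<in> I"
      then obtain p where p: "R_poly p" "y = d * poly p x" by (auto simp: I_def)
      have "y = (\<Sum>i\<le>Polynomial.degree p. Polynomial.coeff p i * (d * x ^ i))"
        unfolding p(2) poly_altdef sum_distrib_left by (simp add: mult_ac)
      then show "y \<in> R" using p(1) dx by (auto intro!: R_sum intro: R_mult[of _ "d * x ^ i" for i])
    qed
    show "0 \<in> I" unfolding I_def using R_zero by (auto intro!: exI[of _ 0])
    show "a + b \<in> I" if ab: "a \<in> I" "b \<in> I" for a b
    proof -
      obtain p q where "R_poly p" "R_poly q" "a = d * poly p x" "b = d * poly q x"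
        using ab unfolding I_def by blast
      then show ?thesis unfolding I_def
        by (auto intro!: exI[of _ "p + q"] R_add simp: algebra_simps)
    qed
    show "r * a \<in> I" if ab: "r \<in> R" "a \<in> I" for r a
    proof -
      obtain p where "R_poly p" "a = d * poly p x" using ab unfolding I_def by blast
      then show ?thesis unfolding I_def
        using ab by (auto intro!: exI[of _ "Polynomial.smult r p"] R_mult)
    qed
  qed
  then obtain t where t: "t \<in> I" "\<And>y. y \<in> I \<Longrightarrow> \<exists>r\<in>R. y = r * t" by blast
  have "d \<in> I" unfolding I_def using R_one R_zero
    by (auto intro!: exI[of _ 1] simp: Polynomial.coeff_1)
  then have "t \<noteq> 0" using t(2)[of d] d(2) by auto
  obtain p where p: "R_poly p" "t = d * poly p x" using t(1) by (auto simp: I_def)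
  have "x * t \<in> I"
    unfolding I_def using p R_zero
    by (auto intro!: exI[of _ "pCons 0 p"] simp: coeff_pCons split: nat.split)
  then obtain r where "r \<in> R" "x * t = r * t" using t(2) by blast
  then show ?thesis using \<open>t \<noteq> 0\<close> by simp
qed

lemma quotient_field_K: "quotient_field K = K"
proof
  show "quotient_field K \<subseteq> K" unfolding quotient_field_def[of K] by (auto intro: K_divide)
  show "K \<subseteq> quotient_field K"
  proof
    fix x assume "x \<in> K"
    then show "x \<in> quotient_field K"
      unfolding quotient_field_def[of K] mem_Collect_eq
      by (intro exI[of _ x] exI[of _ 1]) (use K_one in simp)
  qed
qed

text \<open>Taking \<open>K\<close> itself as the base ring turns results about integral elements
  into results about algebraic ones.\<close>

lemma pid_subring_K: "pid_subring K"
proof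
  fix I assume I: "I \<subseteq> K" "0 \<in> I" "\<And>r x. \<lbrakk>r \<in> K; x \<in> I\<rbrakk> \<Longrightarrow> r * x \<in> I"
  show "\<exists>d\<in>I. \<forall>x\<in>I. \<exists>r\<in>K. x = r * d"
  proof (cases "I = {0}")
    case True
    then show ?thesis using K_zero by auto
  next
    case False
    then obtain d where d: "d \<in> I" "d \<noteq> 0" using I(2) by blast
    have "\<exists>r\<in>K. x = r * d" if "x \<in> I" for x
      using that d I(1) by (intro bexI[of _ "x / d"] K_divide) auto
    then show ?thesis using d by blast
  qed
qed (auto intro: K_zero K_one K_add K_uminus K_mult)

end

context galois_pid
begin

lemma galois_pid_K: "galois_pid K G"
proof -
  interpret K: pid_subring K by (rule pid_subring_K)
  show ?thesis
    by unfold_locales (use finite_G id_G comp_G bij_G inv_G G_one G_add G_mult fixed_G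
        in \<open>auto simp: quotient_field_K\<close>)
qed

text \<open>
  All powers of \<open>z\<close> lie in a finitely generated module, so by \<open>ex_lattice_basis\<close> the ring
  \<open>R[z]\<close> is a finitely generated module, and a high power of \<open>z\<close> is a combination of its generators.
\<close>

lemma integralI:
  fixes v :: "'i \<Rightarrow> 'a"
  assumes "finite S" and pow: "\<And>n. \<exists>c. (\<forall>s\<in>S. c s \<in> R) \<and> z ^ n = (\<Sum>s\<in>S. c s * v s)"
  shows "z \<in> integral_closure R UNIV"
proof -
  obtain N :: nat and l m where span: "\<And>x. x = (\<Sum>i<N. Tr (x * l i) * m i)"
    by (rule Tr_span) blast
  have "\<exists>D\<in>R. D \<noteq> 0 \<and> (\<forall>x\<in>(\<lambda>(s, i). Tr (v s * l i)) ` (S \<times> {..<N}). D * x \<in> R)"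
    by (rule K_common_denominator) (use assms(1) Tr_in_K in auto)
  then obtain D where D: "D \<in> R" "D \<noteq> 0" "\<And>s i. s \<in> S \<Longrightarrow> i < N \<Longrightarrow> D * Tr (v s * l i) \<in> R"
    by auto
  \<comment> \<open>The factor \<open>D\<close> clears the denominators of the traces at the
    generators, so every \<open>f i\<close> takes values in \<open>R\<close> on all powers of z at
    once.\<close>
  define f where "f = (\<lambda>i x. D * Tr (x * l i))"
  have lin: "K_linear (*) (f i)" for i
    by (rule K_linearI) (auto simp: f_def Tr_add Tr_mult_K algebra_simps)
  have fpow: "f i (z ^ n) \<in> R" if "i < N" for i n
  proof -
    obtain c where c: "\<And>s. s \<in> S \<Longrightarrow> c s \<in> R" "z ^ n = (\<Sum>s\<in>S. c s * v s)" using pow[of n] by blast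
    have "f i (z ^ n) = (\<Sum>s\<in>S. c s * f i (v s))"
      unfolding c(2) K_linear_sum[OF lin]
      by (rule sum.cong) (auto simp: K_linear_scale[OF lin R_subset_K[OF c(1)]])
    then show ?thesis using that by (auto simp: f_def intro!: R_sum R_mult[OF c(1)] D(3))
  qed
  define M where "M = {poly p z | p. R_poly p}"
  have "\<exists>B g. lattice_basis (*) M B g"
  proof (rule ex_lattice_basis[OF module_times, where I = "{..<N}" and f = f])
    show "submodule (*) M"
      unfolding submodule_def
    proof (intro conjI ballI)
      show "0 \<in> M" unfolding M_def using R_zero by (auto intro!: exI[of _ 0])
      show "a + b \<in> M" if ab: "a \<in> M" "b \<in> M" for a b
      proof -
        obtain p q where "R_poly p" "R_poly q" "a = poly p z" "b = poly q z"
          using ab unfolding M_def by blast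
        then show ?thesis unfolding M_def by (auto intro!: exI[of _ "p + q"] R_add)
      qed
      show "r * a \<in> M" if ab: "r \<in> R" "a \<in> M" for r a
      proof -
        obtain p where "R_poly p" "a = poly p z" using ab unfolding M_def by blast
        then show ?thesis unfolding M_def
          using ab by (auto intro!: exI[of _ "Polynomial.smult r p"] R_mult)
      qed
    qed
    show "f i x \<in> R" if i: "i \<in> {..<N}" and x: "x \<in> M" for i x
    proof -
      obtain p where p: "R_poly p" "x = poly p z" using x by (auto simp: M_def)
      have "f i x = (\<Sum>j\<le>Polynomial.degree p. Polynomial.coeff p j * f i (z ^ j))"
        unfolding p(2) poly_altdef K_linear_sum[OF lin]
        by (rule sum.cong) (use p(1) in \<open>auto simp: K_linear_scale[OF lin R_subset_K]\<close>)
      then show ?thesis using p(1) fpow i by (auto intro!: R_sum R_mult)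
    qed
    show "x = 0" if "\<And>i. i \<in> {..<N} \<Longrightarrow> f i x = 0" for x
      using span[of x] that D(2) by (simp add: f_def)
  qed (use lin in auto)
  then obtain B g where B: "lattice_basis (*) M B g" by blast
  note B' = lattice_basisD[OF B]
  have "\<forall>b\<in>B. \<exists>p. R_poly p \<and> b = poly p z" using B'(2) by (auto simp: M_def)
  then obtain P where P: "\<And>b. b \<in> B \<Longrightarrow> R_poly (P b)" "\<And>b. b \<in> B \<Longrightarrow> b = poly (P b) z"
    by metis
  \<comment> \<open>\<open>k\<close> exceeds the degrees of all polynomials chosen for basis
    elements. Subtracting the expansion of \<open>z ^ k\<close> therefore leaves the leading term
    alone, and \<open>q\<close> is monic.\<close>
  define k where "k = Suc (\<Sum>b\<in>B. Polynomial.degree (P b))"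
  have deg: "Polynomial.degree (P b) < k" if "b \<in> B" for b
    using member_le_sum[OF that, of "\<lambda>b. Polynomial.degree (P b)"] B'(1) by (simp add: k_def)
  have zk: "z ^ k \<in> M"
    unfolding M_def using R_one R_zero
    by (auto intro!: exI[of _ "Polynomial.monom 1 k"] simp: poly_monom)
  define q where "q = Polynomial.monom 1 k - (\<Sum>b\<in>B. Polynomial.smult (g b (z ^ k)) (P b))"
  have "R_poly q"
    unfolding q_def using R_one R_zero B'(5)[OF zk] P(1)
    by (auto simp: coeff_sum intro!: R_diff R_uminus R_sum R_mult)
  moreover have high: "Polynomial.coeff q i = (if i = k then 1 else 0)" if "i \<ge> k" for i
  proof -
    have "Polynomial.coeff (P b) i = 0" if "b \<in> B" for b
      using deg[OF that] \<open>i \<ge> k\<close> by (intro coeff_eq_0) simp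
    then show ?thesis by (simp add: q_def coeff_sum)
  qed
  have "Polynomial.degree q = k"
  proof (rule antisym)
    show "Polynomial.degree q \<le> k" by (rule degree_le) (use high in auto)
    show "k \<le> Polynomial.degree q" by (rule le_degree) (use high in auto)
  qed
  moreover have "poly q z = 0"
  proof -
    have "poly q z = z ^ k - (\<Sum>b\<in>B. g b (z ^ k) * b)"
      using P(2) by (simp add: q_def poly_sum poly_monom)
    then show ?thesis using B'(6)[OF zk] by simp
  qed
  ultimately show ?thesis using high[of k] by (auto simp: integral_closure_def)
qed

section \<open>The ring of integers of the big field\<close>

abbreviation OL :: "'a set" where "OL \<equiv> integral_closure R UNIV"

lemma R_span_sum:
  fixes v :: "'i \<Rightarrow> 'a"
  assumes "\<And>j. j \<in> I \<Longrightarrow> \<exists>c. (\<forall>s\<in>S. c s \<in> R) \<and> w j = (\<Sum>s\<in>S. c s * v s)"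
    and "\<And>j. j \<in> I \<Longrightarrow> r j \<in> R"
  shows "\<exists>c. (\<forall>s\<in>S. c s \<in> R) \<and> (\<Sum>j\<in>I. r j * w j) = (\<Sum>s\<in>S. c s * v s)"
proof -
  obtain c where c: "\<And>j s. \<lbrakk>j \<in> I; s \<in> S\<rbrakk> \<Longrightarrow> c j s \<in> R" "\<And>j. j \<in> I \<Longrightarrow> w j = (\<Sum>s\<in>S. c j s * v s)"
    using assms(1) by metis
  have "(\<Sum>j\<in>I. r j * w j) = (\<Sum>j\<in>I. \<Sum>s\<in>S. r j * c j s * v s)"
    by (rule sum.cong) (auto simp: c(2) sum_distrib_left mult.assoc)
  also have "\<dots> = (\<Sum>s\<in>S. (\<Sum>j\<in>I. r j * c j s) * v s)"
    by (subst sum.swap) (simp add: sum_distrib_right)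
  finally show ?thesis
    using c(1) assms(2) by (intro exI[of _ "\<lambda>s. \<Sum>j\<in>I. r j * c j s"]) (auto intro!: R_sum R_mult)
qed

text \<open>Reducing the powers of x and of y separately leaves a finite box of monomials. Its span
  over \<open>R\<close> contains all powers of \<open>x * y\<close> and, by the binomial theorem,
  all powers of \<open>x + y\<close>.\<close>

lemma monomial_span:
  assumes "x \<in> OL" and "y \<in> OL"
  obtains m n :: nat where "\<And>i j. \<exists>c. (\<forall>s\<in>{..<m} \<times> {..<n}. c s \<in> R) \<and>
    x ^ i * y ^ j = (\<Sum>s\<in>{..<m} \<times> {..<n}. c s * (x ^ fst s * y ^ snd s))"
proof -
  obtain m where m: "\<And>i. \<exists>c. (\<forall>k. c k \<in> R) \<and> x ^ i = (\<Sum>k<m. c k * x ^ k)"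
    using integral_powers[OF assms(1)] by blast
  obtain n where n: "\<And>i. \<exists>c. (\<forall>k. c k \<in> R) \<and> y ^ i = (\<Sum>k<n. c k * y ^ k)"
    using integral_powers[OF assms(2)] by blast
  have "\<exists>c. (\<forall>s\<in>{..<m} \<times> {..<n}. c s \<in> R) \<and>
    x ^ i * y ^ j = (\<Sum>s\<in>{..<m} \<times> {..<n}. c s * (x ^ fst s * y ^ snd s))" for i j
  proof -
    obtain c where c: "\<And>k. c k \<in> R" "x ^ i = (\<Sum>k<m. c k * x ^ k)" using m[of i] by blast
    obtain d where d: "\<And>k. d k \<in> R" "y ^ j = (\<Sum>k<n. d k * y ^ k)" using n[of j] by blast
    have "x ^ i * y ^ j = (\<Sum>s\<in>{..<m} \<times> {..<n}. (c (fst s) * d (snd s)) * (x ^ fst s * y ^ snd s))"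
      unfolding c(2) d(2) sum_product by (simp add: sum.cartesian_product case_prod_unfold mult_ac)
    then show ?thesis using c(1) d(1) by (intro exI conjI) (auto intro: R_mult)
  qed
  then show thesis using that by blast
qed

lemma OL_mult:
  assumes "x \<in> OL" and "y \<in> OL"
  shows "x * y \<in> OL"
proof -
  obtain m n :: nat where mn: "\<And>i j. \<exists>c. (\<forall>s\<in>{..<m} \<times> {..<n}. c s \<in> R) \<and>
    x ^ i * y ^ j = (\<Sum>s\<in>{..<m} \<times> {..<n}. c s * (x ^ fst s * y ^ snd s))"
    using monomial_span[OF assms] by blast
  show ?thesis
    by (rule integralI[of "{..<m} \<times> {..<n}"]) (use mn in \<open>auto simp: power_mult_distrib\<close>)
qed

lemma of_nat_R: "of_nat n \<in> R"
  by (induction n) (auto intro: R_zero R_one R_add)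

lemma OL_add:
  assumes "x \<in> OL" and "y \<in> OL"
  shows "x + y \<in> OL"
proof -
  obtain m n :: nat where mn: "\<And>i j. \<exists>c. (\<forall>s\<in>{..<m} \<times> {..<n}. c s \<in> R) \<and>
    x ^ i * y ^ j = (\<Sum>s\<in>{..<m} \<times> {..<n}. c s * (x ^ fst s * y ^ snd s))"
    using monomial_span[OF assms] by blast
  show ?thesis
  proof (rule integralI[of "{..<m} \<times> {..<n}"])
    show "\<exists>c. (\<forall>s\<in>{..<m} \<times> {..<n}. c s \<in> R) \<and>
      (x + y) ^ k = (\<Sum>s\<in>{..<m} \<times> {..<n}. c s * (x ^ fst s * y ^ snd s))" for k
      unfolding binomial_ring mult.assoc by (rule R_span_sum) (use mn of_nat_R in auto)
  qed simp
qed

lemma R_subset_OL: "r \<in> R \<Longrightarrow> r \<in> OL"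
  unfolding integral_closure_def
  by (intro CollectI conjI exI[of _ "[:- r, 1:]"])
    (use R_one R_zero R_uminus in \<open>auto simp: coeff_pCons split: nat.split\<close>)

lemma OL_sum: "(\<And>i. i \<in> I \<Longrightarrow> f i \<in> OL) \<Longrightarrow> sum f I \<in> OL"
  by (induction I rule: infinite_finite_induct) (auto intro: R_subset_OL R_zero OL_add)

lemma OL_G:
  assumes "g \<in> G" "x \<in> OL"
  shows "g x \<in> OL"
proof -
  obtain p where p: "R_poly p" "lead_coeff p = 1" "poly p x = 0"
    using assms(2) by (auto simp: integral_closure_def)
  have pow: "g (x ^ n) = g x ^ n" for n
    by (induction n) (auto simp: G_one G_mult assms(1))
  have "poly p (g x) = g (poly p x)"
    unfolding poly_altdef
    using p(1) by (simp add: G_sum G_mult assms(1) pow G_K[OF assms(1) R_subset_K])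
  then show ?thesis using p G_zero[OF assms(1)] by (auto simp: integral_closure_def)
qed

text \<open>The trace is an integral element of \<open>K\<close>, and \<open>R\<close> is integrally
  closed.\<close>

lemma Tr_OL: "x \<in> OL \<Longrightarrow> Tr x \<in> R"
  using OL_sum[of G "\<lambda>g. g x"] OL_G Tr_in_K[of x] by (intro integral_in_K) (simp_all add: Tr_def)

text \<open>Every element is algebraic over \<open>K\<close>: its powers lie in the span of the
  \<open>m i\<close>, so \<open>integralI\<close> applies with \<open>K\<close> as base ring.
  Rescaling turns a monic equation over \<open>K\<close> for x into one over \<open>R\<close> for
  \<open>d * x\<close>.\<close>

lemma ex_OL_multiple: "\<exists>d. d \<in> R \<and> d \<noteq> 0 \<and> d * x \<in> OL"
proof -
  interpret K: galois_pid K G by (rule galois_pid_K)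
  obtain N :: nat and l m where span: "\<And>x. x = (\<Sum>i<N. Tr (x * l i) * m i)"
    by (rule Tr_span) blast
  have "x \<in> integral_closure K UNIV"
  proof (rule K.integralI[of "{..<N}" _ m])
    show "\<exists>c. (\<forall>s\<in>{..<N}. c s \<in> K) \<and> x ^ n = (\<Sum>s<N. c s * m s)" for n
      using span[of "x ^ n"] Tr_in_K by (intro exI conjI) auto
  qed simp
  then obtain p where p: "\<And>i. Polynomial.coeff p i \<in> K" "lead_coeff p = 1" "poly p x = 0"
    by (auto simp: integral_closure_def)
  define n where "n = Polynomial.degree p"
  obtain d where d: "d \<in> R" "d \<noteq> 0" "\<And>i. i \<le> n \<Longrightarrow> d * Polynomial.coeff p i \<in> R"
    using K_common_denominator[of "Polynomial.coeff p ` {..n}"] p(1) by auto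
  \<comment> \<open>Weighting the coefficient at i by \<open>d ^ (n - i)\<close> keeps the leading
    one equal to 1 and multiplies the value by \<open>d ^ n\<close> when x is replaced by
    \<open>d * x\<close>. Every lower coefficient receives at least one factor
    \<open>d\<close>.\<close>
  define q where "q = (\<Sum>i\<le>n. Polynomial.monom (d ^ (n - i) * Polynomial.coeff p i) i)"
  have coeff: "Polynomial.coeff q i = (if i \<le> n then d ^ (n - i) * Polynomial.coeff p i else 0)" for i
    by (simp add: q_def coeff_sum)
  have "R_poly q"
  proof
    fix i
    show "Polynomial.coeff q i \<in> R"
    proof (cases "i < n")
      case True
      then have "n - i = Suc (n - Suc i)" by simp
      then have "Polynomial.coeff q i = d ^ (n - Suc i) * (d * Polynomial.coeff p i)"
        using True by (simp add: coeff)
      then show ?thesis using R_mult[OF R_power[OF d(1)] d(3)] True by simp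
    next
      case False
      then show ?thesis using p(2) R_zero R_one by (auto simp: coeff n_def)
    qed
  qed
  moreover have "Polynomial.degree q = n"
  proof (rule antisym)
    show "Polynomial.degree q \<le> n" by (rule degree_le) (auto simp: coeff)
    show "n \<le> Polynomial.degree q" by (rule le_degree) (use p(2) in \<open>auto simp: coeff n_def\<close>)
  qed
  moreover have "poly q (d * x) = d ^ n * poly p x"
    unfolding q_def poly_sum poly_altdef[of p] n_def[symmetric] sum_distrib_left
    by (rule sum.cong) (auto simp: poly_monom power_mult_distrib simp flip: power_add)
  ultimately have "d * x \<in> OL" using p(2,3) coeff[of n] by (auto simp: integral_closure_def n_def)
  then show ?thesis using d by blast
qed

lemma OL_common_denominator: "finite Y \<Longrightarrow> \<exists>d\<in>R. d \<noteq> 0 \<and> (\<forall>x\<in>Y. d * x \<in> OL)"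
  by (rule common_denominator[where P = "\<lambda>x. x \<in> OL"]) (auto intro: ex_OL_multiple OL_mult R_subset_OL)

text \<open>Multiplying the \<open>l i\<close> by a common denominator makes the trace functionals
  integral on \<open>OL\<close> without losing their joint injectivity.\<close>

lemma OL_functionals:
  obtains n :: nat and l where "\<And>i. i < n \<Longrightarrow> l i \<in> OL"
    and "\<And>x. (\<And>i. i < n \<Longrightarrow> Tr (x * l i) = 0) \<Longrightarrow> x = 0"
proof -
  obtain n :: nat and l m where span: "\<And>x. x = (\<Sum>i<n. Tr (x * l i) * m i)"
    by (rule Tr_span) blast
  obtain d where d: "d \<in> R" "d \<noteq> 0" "\<And>i. i < n \<Longrightarrow> d * l i \<in> OL"
    using OL_common_denominator[of "l ` {..<n}"] by auto
  show thesis
  proof (rule that[of n "\<lambda>i. d * l i"])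
    show "x = 0" if "\<And>i. i < n \<Longrightarrow> Tr (x * (d * l i)) = 0" for x
    proof -
    have "Tr (x * (d * l i)) = d * Tr (x * l i)" for i
      using Tr_mult_K[OF R_subset_K[OF d(1)], of "x * l i"] by (simp add: mult_ac)
    then show ?thesis using that d(2) span[of x] by simp
  qed
  qed (use d(3) in auto)
qed

lemma ex_lattice_basis_OL:
  assumes "submodule (*) M" and "M \<subseteq> OL"
  shows "\<exists>B g. lattice_basis (*) M B g"
proof -
  obtain n :: nat and l where l: "\<And>i. i < n \<Longrightarrow> l i \<in> OL"
    "\<And>x. (\<And>i. i < n \<Longrightarrow> Tr (x * l i) = 0) \<Longrightarrow> x = 0" using OL_functionals by blast
  show ?thesis
  proof (rule ex_lattice_basis[OF module_times, where I = "{..<n}" and f = "\<lambda>i x. Tr (x * l i)"])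
    show "K_linear (*) (\<lambda>x. Tr (x * l i))" for i
      by (rule K_linearI) (auto simp: Tr_add Tr_mult_K algebra_simps)
    show "Tr (x * l i) \<in> R" if "i \<in> {..<n}" "x \<in> M" for i x
      using that assms(2) l(1) by (intro Tr_OL OL_mult) auto
    show "x = 0" if "\<And>i. i \<in> {..<n} \<Longrightarrow> Tr (x * l i) = 0" for x
      using l(2) that by auto
  qed (use assms in auto)
qed

end

subsection \<open>Semidirect products\<close>

locale semidirect_galois = galois_pid R G for R :: "'a::field set" and G +
  fixes J G' :: "('a \<Rightarrow> 'a) set"
  assumes J_subset: "J \<subseteq> G" and id_J: "id \<in> J" and comp_J: "\<lbrakk>g \<in> J; h \<in> J\<rbrakk> \<Longrightarrow> g \<circ> h \<in> J"
    and inv_J: "g \<in> J \<Longrightarrow> inv_into UNIV g \<in> J"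
    and normal_J: "\<lbrakk>g \<in> G; h \<in> J\<rbrakk> \<Longrightarrow> g \<circ> h \<circ> inv_into UNIV g \<in> J"
    and G'_subset: "G' \<subseteq> G" and id_G': "id \<in> G'"
    and comp_G': "\<lbrakk>g \<in> G'; h \<in> G'\<rbrakk> \<Longrightarrow> g \<circ> h \<in> G'"
    and inv_G': "g \<in> G' \<Longrightarrow> inv_into UNIV g \<in> G'"
    and J_Int_G': "J \<inter> G' = {id}"
    and decomposition: "g \<in> G \<Longrightarrow> \<exists>\<sigma>\<in>J. \<exists>\<tau>\<in>G'. g = \<sigma> \<circ> \<tau>"
begin

abbreviation E :: "'a set" where "E \<equiv> fixed_field G'"
abbreviation F :: "'a set" where "F \<equiv> fixed_field J"
abbreviation OE :: "'a set" where "OE \<equiv> integral_closure R E"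
abbreviation OF :: "'a set" where "OF \<equiv> integral_closure R F"

lemma J_G: "\<sigma> \<in> J \<Longrightarrow> \<sigma> \<in> G" and G'_G: "\<tau> \<in> G' \<Longrightarrow> \<tau> \<in> G"
  using J_subset G'_subset by auto

text \<open>Comparing the two factorizations puts the quotient of the \<open>J\<close>-parts, which
  is also a quotient of the \<open>G'\<close>-parts, into \<open>J\<close> and \<open>G'\<close> at
  once.\<close>

lemma decomposition_unique:
  assumes "\<sigma> \<in> J" "\<tau> \<in> G'" "\<sigma>' \<in> J" "\<tau>' \<in> G'" and eq: "\<sigma> \<circ> \<tau> = \<sigma>' \<circ> \<tau>'"
  shows "\<sigma> = \<sigma>'" and "\<tau> = \<tau>'"
proof -
  note \<tau> = G_inv[OF G'_G[OF assms(2)]] and \<sigma>' = G_inv[OF J_G[OF assms(3)]]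
  have "inv_into UNIV \<sigma>' \<circ> \<sigma> = inv_into UNIV \<sigma>' \<circ> (\<sigma> \<circ> \<tau>) \<circ> inv_into UNIV \<tau>"
    by (auto simp: fun_eq_iff \<tau>)
  also have "\<dots> = \<tau>' \<circ> inv_into UNIV \<tau>" unfolding eq by (auto simp: fun_eq_iff \<sigma>')
  finally have *: "inv_into UNIV \<sigma>' \<circ> \<sigma> = \<tau>' \<circ> inv_into UNIV \<tau>" .
  then have "inv_into UNIV \<sigma>' \<circ> \<sigma> \<in> J \<inter> G'"
    using comp_J[OF inv_J[OF assms(3)] assms(1)] comp_G'[OF assms(4) inv_G'[OF assms(2)]] by auto
  then have "inv_into UNIV \<sigma>' \<circ> \<sigma> = id" using J_Int_G' by blast
  then have "inv_into UNIV \<sigma>' (\<sigma> x) = x" for x by (metis comp_apply id_apply)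
  then have "\<sigma> x = \<sigma>' x" for x using \<sigma>'(1) by metis
  then show "\<sigma> = \<sigma>'" by blast
  have "\<tau>' (inv_into UNIV \<tau> x) = x" for x
    using * \<open>inv_into UNIV \<sigma>' \<circ> \<sigma> = id\<close> by (metis comp_apply id_apply)
  then have "\<tau> x = \<tau>' x" for x using \<tau>(2) by metis
  then show "\<tau> = \<tau>'" by blast
qed

lemma part_comp:
  assumes "\<sigma> \<in> J" "\<tau> \<in> G'"
  shows "J_part J G' (\<sigma> \<circ> \<tau>) = \<sigma>" and "G'_part J G' (\<sigma> \<circ> \<tau>) = \<tau>"
  unfolding J_part_def G'_part_def using assms decomposition_unique by blast+

lemma parts:
  assumes "g \<in> G"
  shows "J_part J G' g \<in> J" "G'_part J G' g \<in> G'" "J_part J G' g \<circ> G'_part J G' g = g"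
proof -
  obtain \<sigma> \<tau> where "\<sigma> \<in> J" "\<tau> \<in> G'" "g = \<sigma> \<circ> \<tau>" using decomposition[OF assms] by blast
  then show "J_part J G' g \<in> J" "G'_part J G' g \<in> G'" "J_part J G' g \<circ> G'_part J G' g = g"
    by (simp_all add: part_comp)
qed

lemma part_J: "\<sigma> \<in> J \<Longrightarrow> J_part J G' \<sigma> = \<sigma>" "\<sigma> \<in> J \<Longrightarrow> G'_part J G' \<sigma> = id"
  using part_comp[of \<sigma> id] id_G' by simp_all

lemma part_G': "\<tau> \<in> G' \<Longrightarrow> G'_part J G' \<tau> = \<tau>" "\<tau> \<in> G' \<Longrightarrow> J_part J G' \<tau> = id"
  using part_comp[of id \<tau>] id_J by simp_all

lemma product_decomposition:
  assumes "\<sigma> \<in> J" "\<tau> \<in> G'" "\<sigma>' \<in> J" "\<tau>' \<in> G'"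
  shows "(\<sigma> \<circ> \<tau>) \<circ> (\<sigma>' \<circ> \<tau>') = (\<sigma> \<circ> (\<tau> \<circ> \<sigma>' \<circ> inv_into UNIV \<tau>)) \<circ> (\<tau> \<circ> \<tau>')"
  using G_inv[OF G'_G[OF assms(2)]] by (auto simp: fun_eq_iff)

text \<open>The \<open>G'\<close>-part is the projection of \<open>G\<close> onto
  \<open>G/J\<close>. The \<open>J\<close>-part of a product is given in the form in which
  \<open>lambda_c\<close> acts on \<open>J\<close>.\<close>

lemma part_mult:
  assumes "g \<in> G" "h \<in> G"
  shows "G'_part J G' (g \<circ> h) = G'_part J G' g \<circ> G'_part J G' h"
    and "J_part J G' (g \<circ> h) =
      g \<circ> J_part J G' h \<circ> inv_into UNIV (G'_part J G' g)"
proof -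
  note g = parts[OF assms(1)] and h = parts[OF assms(2)]
  let ?\<sigma> = "J_part J G' g \<circ> (G'_part J G' g \<circ> J_part J G' h \<circ> inv_into UNIV (G'_part J G' g))"
  let ?\<tau> = "G'_part J G' g \<circ> G'_part J G' h"
  have "g \<circ> h = ?\<sigma> \<circ> ?\<tau>" using product_decomposition[OF g(1,2) h(1,2)] g(3) h(3) by simp
  moreover have "?\<sigma> \<in> J" using g h by (intro comp_J normal_J G'_G)
  moreover have "?\<tau> \<in> G'" using g h by (intro comp_G')
  ultimately have "J_part J G' (g \<circ> h) = ?\<sigma>" "G'_part J G' (g \<circ> h) = ?\<tau>"
    by (simp_all add: part_comp)
  then show "G'_part J G' (g \<circ> h) = ?\<tau>"
    and "J_part J G' (g \<circ> h) = g \<circ> J_part J G' h \<circ> inv_into UNIV (G'_part J G' g)"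
    using g(3) by (simp_all flip: comp_assoc)
qed

lemma E_D: "\<lbrakk>x \<in> E; \<tau> \<in> G'\<rbrakk> \<Longrightarrow> \<tau> x = x" and F_D: "\<lbrakk>x \<in> F; \<sigma> \<in> J\<rbrakk> \<Longrightarrow> \<sigma> x = x"
  by (auto simp: fixed_field_def)

lemma E_I: "(\<And>\<tau>. \<tau> \<in> G' \<Longrightarrow> \<tau> x = x) \<Longrightarrow> x \<in> E" and F_I: "(\<And>\<sigma>. \<sigma> \<in> J \<Longrightarrow> \<sigma> x = x) \<Longrightarrow> x \<in> F"
  by (auto simp: fixed_field_def)

section \<open>Fixed fields and the Galois correspondence\<close>

lemma fixed_field_closed:
  assumes "U \<subseteq> G"
  shows "k \<in> K \<Longrightarrow> k \<in> fixed_field U"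
    and "\<lbrakk>x \<in> fixed_field U; y \<in> fixed_field U\<rbrakk> \<Longrightarrow> x + y \<in> fixed_field U"
    and "\<lbrakk>x \<in> fixed_field U; y \<in> fixed_field U\<rbrakk> \<Longrightarrow> x * y \<in> fixed_field U"
    and "(\<And>i. i \<in> I \<Longrightarrow> f i \<in> fixed_field U) \<Longrightarrow> sum f I \<in> fixed_field U"
  using assms by (auto simp: fixed_field_def G_K G_add G_mult G_sum subset_iff intro: sum.cong)

lemmas E_closed = fixed_field_closed[OF G'_subset]
lemmas F_closed = fixed_field_closed[OF J_subset]

text \<open>Normality of \<open>J\<close>: an element of \<open>J\<close> conjugated by the inverse
  of g stays in \<open>J\<close> and so fixes x.\<close>

lemma F_stable:
  assumes "g \<in> G" "x \<in> F"
  shows "g x \<in> F"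
proof (rule F_I)
  fix \<sigma> assume "\<sigma> \<in> J"
  then have "(inv_into UNIV g \<circ> \<sigma> \<circ> inv_into UNIV (inv_into UNIV g)) x = x"
    by (intro F_D[OF assms(2)] normal_J inv_G assms)
  then have "inv_into UNIV g (\<sigma> (g x)) = x" by (simp add: inv_inv_G assms(1))
  then show "\<sigma> (g x) = g x" using G_inv(1)[OF assms(1)] by metis
qed

text \<open>The sums \<open>y i\<close> of the images of \<open>m i\<close> under \<open>U\<close>
  are fixed by \<open>U\<close>. Pairing the \<open>h (y i)\<close> with the \<open>l i\<close>
  counts the u in \<open>U\<close> that are inverse to h: one for \<open>h = id\<close>, none for h
  outside \<open>U\<close>. But an element that fixes all \<open>y i\<close> gives the same count as
  \<open>id\<close>.\<close>

lemma fixing_group: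
  assumes U: "U \<subseteq> G" "id \<in> U" "\<And>g h. \<lbrakk>g \<in> U; h \<in> U\<rbrakk> \<Longrightarrow> g \<circ> h \<in> U"
    "\<And>g. g \<in> U \<Longrightarrow> inv_into UNIV g \<in> U"
    and g: "g \<in> G" "\<And>x. x \<in> fixed_field U \<Longrightarrow> g x = x"
  shows "g \<in> U"
proof (rule ccontr)
  assume gU: "g \<notin> U"
  obtain n :: nat and l m where
    d: "\<And>g h. \<lbrakk>g \<in> G; h \<in> G\<rbrakk> \<Longrightarrow> (\<Sum>i<n. g (l i) * h (m i)) = (if g = h then 1 else 0)"
    by (rule ex_dual_system_G) blast
  have finU: "finite U" using U(1) finite_G finite_subset by blast
  define y where "y = (\<lambda>i. \<Sum>u\<in>U. u (m i))"
  have y: "y i \<in> fixed_field U" for i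
    unfolding fixed_field_def
  proof (intro CollectI ballI)
    fix u assume u: "u \<in> U"
    then have uG: "u \<in> G" using U(1) by auto
    have "bij_betw (\<lambda>h. u \<circ> h) U U"
      by (rule bij_betwI[where g = "\<lambda>h. inv_into UNIV u \<circ> h"])
        (use u U(3,4) in \<open>auto simp: G_inv[OF uG] simp flip: comp_assoc\<close>)
    from sum.reindex_bij_betw[OF this, of "\<lambda>h. h (m i)"]
    show "u (y i) = y i" by (simp add: y_def G_sum[OF uG])
  qed
  have expand: "(\<Sum>i<n. l i * h (y i)) = (\<Sum>u\<in>U. if id = h \<circ> u then 1 else 0)" if h: "h \<in> G" for h
  proof -
    have "(\<Sum>i<n. l i * h (y i)) = (\<Sum>i<n. \<Sum>u\<in>U. id (l i) * (h \<circ> u) (m i))"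
      by (simp add: y_def G_sum[OF h] sum_distrib_left)
    also have "\<dots> = (\<Sum>u\<in>U. \<Sum>i<n. id (l i) * (h \<circ> u) (m i))" by (rule sum.swap)
    also have "\<dots> = (\<Sum>u\<in>U. if id = h \<circ> u then 1 else 0)"
      by (rule sum.cong) (use U(1) h d[OF id_G comp_G[OF h]] in auto)
    finally show ?thesis .
  qed
  have "id \<noteq> g \<circ> u" if u: "u \<in> U" for u
  proof
    assume *: "id = g \<circ> u"
    have "u \<in> G" using U(1) u by auto
    then have "g \<circ> (u \<circ> inv_into UNIV u) = inv_into UNIV u" using * by (metis comp_assoc id_comp)
    then have "g = inv_into UNIV u" using \<open>u \<in> G\<close> by (simp add: G_inv(3))
    then show False using gU U(4)[OF u] by simp
  qed
  then have "(\<Sum>i<n. l i * g (y i)) = 0" using expand[OF g(1)] by simp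
  moreover have "(\<Sum>i<n. l i * g (y i)) = (\<Sum>i<n. l i * id (y i))" using g(2)[OF y] by simp
  moreover have "(\<Sum>i<n. l i * id (y i)) = (\<Sum>u\<in>U. if id = u then 1 else 0)"
    using expand[OF id_G] by simp
  moreover have "\<dots> = 1" using finU U(2) by simp
  ultimately show False by simp
qed

lemma J_separated: "\<lbrakk>\<sigma> \<in> J; \<sigma> \<noteq> id\<rbrakk> \<Longrightarrow> \<exists>x\<in>E. \<sigma> x \<noteq> x"
  using fixing_group[OF G'_subset id_G' comp_G' inv_G'] J_G J_Int_G' by blast

lemma G'_separated: "\<lbrakk>\<tau> \<in> G'; \<tau> \<noteq> id\<rbrakk> \<Longrightarrow> \<exists>x\<in>F. \<tau> x \<noteq> x"
  using fixing_group[OF J_subset id_J comp_J inv_J] G'_G J_Int_G' by blast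

text \<open>An automorphism that fixes both \<open>E\<close> and \<open>F\<close> lies in
  \<open>G'\<close> and in \<open>J\<close>.\<close>

lemma G_separated: "\<lbrakk>g \<in> G; g \<noteq> id\<rbrakk> \<Longrightarrow> \<exists>x\<in>E \<union> F. g x \<noteq> x"
  using fixing_group[OF G'_subset id_G' comp_G' inv_G'] fixing_group[OF J_subset id_J comp_J inv_J]
    J_Int_G' by blast

text \<open>The compositum is multiplicatively closed and separates \<open>id\<close> from the other
  automorphisms, so it spans the field over \<open>K\<close>, which it contains.\<close>

lemma compositum_eq_UNIV: "compositum E F = UNIV"
proof -
  let ?C = "compositum E F"
  have add: "x + y \<in> ?C" if "x \<in> ?C" "y \<in> ?C" for x y
    using generate_field.eng_add[of x ring_of_type_algebra "E \<union> F" y] that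
    by (simp add: compositum_def ring_of_type_algebra_def)
  have mult: "x * y \<in> ?C" if "x \<in> ?C" "y \<in> ?C" for x y
    using generate_field.eng_mult[of x ring_of_type_algebra "E \<union> F" y] that
    by (simp add: compositum_def ring_of_type_algebra_def)
  have EF: "x \<in> ?C" if "x \<in> E \<union> F" for x
    using generate_field.incl[OF that] by (simp add: compositum_def)
  have KC: "k \<in> ?C" if "k \<in> K" for k using EF E_closed(1)[OF that] by blast
  have sep: "\<exists>m\<in>?C. g m \<noteq> m" if "g \<in> G" "g \<noteq> id" for g
    using G_separated[OF that] EF by blast
  obtain n :: nat and l m where m: "\<And>i. i < n \<Longrightarrow> m i \<in> ?C" "\<And>x. x = (\<Sum>i<n. Tr (x * l i) * m i)"
    by (rule separated_imp_span[of ?C, OF KC[OF K_one] mult sep]) blast+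
  have sum: "sum f I \<in> ?C" if "\<And>i. i \<in> I \<Longrightarrow> f i \<in> ?C" for f :: "nat \<Rightarrow> 'a" and I
    using that by (induction I rule: infinite_finite_induct) (auto intro: add KC K_zero)
  have "x \<in> ?C" for x
    by (subst m(2)[of x]) (auto intro!: sum mult KC[OF Tr_in_K] m(1))
  then show ?thesis by blast
qed

lemma submodule_integral_closure:
  assumes "U \<subseteq> G"
  shows "submodule (*) (integral_closure R (fixed_field U))"
  unfolding submodule_def
  using fixed_field_closed[OF assms] OL_add OL_mult R_subset_OL R_subset_K R_zero
  by (auto simp: integral_closure_iff[of _ _ "fixed_field U"])

lemma OE_submodule: "submodule (*) OE" and OF_submodule: "submodule (*) OF"
  using submodule_integral_closure G'_subset J_subset by auto

lemma OE_iff: "x \<in> OE \<longleftrightarrow> x \<in> E \<and> x \<in> OL" and OF_iff: "x \<in> OF \<longleftrightarrow> x \<in> F \<and> x \<in> OL"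
  by (rule integral_closure_iff)+

text \<open>
  Reduction to linear independence over \<open>K\<close>: if \<open>\<Sum> e\<^sub>v v = 0\<close>, then also
  \<open>\<Sum> g(e\<^sub>v) v = 0\<close> for all \<open>g \<in> G\<close>, because \<open>J\<close> fixes the \<open>v\<close> and \<open>G'\<close> fixes the \<open>e\<^sub>v\<close>.
\<close>

lemma E_independent:
  assumes B: "lattice_basis (*) OF V f" and e: "\<And>v. v \<in> V \<Longrightarrow> e v \<in> E"
    and zero: "(\<Sum>v\<in>V. e v * v) = 0" and v: "v \<in> V"
  shows "e v = 0"
proof (rule Tr_nondegenerate)
  fix y
  note B' = lattice_basisD[OF B]
  have g0: "(\<Sum>v\<in>V. g (e v) * v) = 0" if g: "g \<in> G" for g
  proof -
    have VF: "v \<in> F" if "v \<in> V" for v using B'(2) that OF_iff by blast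
    have "(\<Sum>v\<in>V. g (e v) * v) = (\<Sum>v\<in>V. J_part J G' g (e v * v))"
    proof (rule sum.cong)
      fix v assume v: "v \<in> V"
      have "g (e v) = J_part J G' g (e v)"
        using parts[OF g] E_D[OF e[OF v]] by (metis comp_apply)
      then show "g (e v) * v = J_part J G' g (e v * v)"
        using F_D[OF VF[OF v] parts(1)[OF g]] by (simp add: G_mult J_G[OF parts(1)[OF g]])
    qed simp
    also have "\<dots> = J_part J G' g (\<Sum>v\<in>V. e v * v)" by (simp add: G_sum J_G[OF parts(1)[OF g]])
    also have "\<dots> = 0" unfolding zero by (rule G_zero[OF J_G[OF parts(1)[OF g]]])
    finally show ?thesis .
  qed
  \<comment> \<open>Weighting the relation for g by \<open>g y\<close> and summing over
    \<open>G\<close> replaces the coefficients by traces. These lie in \<open>K\<close>, where the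
    coordinate functionals recover them.\<close>
  have "(\<Sum>v\<in>V. Tr (e v * y) * v) = (\<Sum>v\<in>V. \<Sum>g\<in>G. g y * (g (e v) * v))"
    by (simp add: Tr_def G_mult sum_distrib_left sum_distrib_right mult_ac)
  also have "\<dots> = (\<Sum>g\<in>G. g y * (\<Sum>v\<in>V. g (e v) * v))"
    by (subst sum.swap) (simp add: sum_distrib_left)
  also have "\<dots> = 0" using g0 by simp
  finally have "(\<Sum>v\<in>V. Tr (e v * y) * v) = 0" .
  then have "Tr (e v * y) = f v 0" using lattice_basis_coord[OF B, of "\<lambda>v. Tr (e v * y)" v] v Tr_in_K by simp
  then show "Tr (e v * y) = 0" using K_linear_zero[OF B'(3)[OF v]] by simp
qed

end

subsection \<open>Tensor products of lattices\<close>

lemma lookup_scalar_mult: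
  "Poly_Mapping.lookup (scalar_mult r u) i = r * Poly_Mapping.lookup u i"
  by (simp add: scalar_mult_def Poly_Mapping.map.rep_eq when_def)

lemma keys_scalar_mult: "Poly_Mapping.keys (scalar_mult r u) \<subseteq> Poly_Mapping.keys u"
  by (auto simp: Poly_Mapping.in_keys_iff lookup_scalar_mult)

lemma module_scalar_mult: "Modules.module (scalar_mult :: 'r::comm_ring_1 \<Rightarrow> ('i \<Rightarrow>\<^sub>0 'r) \<Rightarrow> _)"
  by unfold_locales
    (auto intro!: poly_mapping_eqI simp: lookup_scalar_mult Poly_Mapping.lookup_add algebra_simps)

lemma scalar_mult_single:
  "scalar_mult r (Poly_Mapping.single i a) = Poly_Mapping.single i (r * a)"
  by (rule poly_mapping_eqI) (simp add: lookup_scalar_mult Poly_Mapping.lookup_single when_def)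

lemma poly_mapping_expand:
  fixes u :: "'i \<Rightarrow>\<^sub>0 'r::comm_monoid_add"
  shows "u = (\<Sum>i\<in>Poly_Mapping.keys u. Poly_Mapping.single i (Poly_Mapping.lookup u i))"
proof (rule poly_mapping_eqI)
  fix k
  have "Poly_Mapping.lookup (\<Sum>i\<in>Poly_Mapping.keys u. Poly_Mapping.single i (Poly_Mapping.lookup u i)) k
    = (\<Sum>i\<in>Poly_Mapping.keys u. if i = k then Poly_Mapping.lookup u i else 0)"
    by (simp add: Poly_Mapping.lookup_sum Poly_Mapping.lookup_single when_def)
  also have "\<dots> = Poly_Mapping.lookup u k" by (simp add: Poly_Mapping.in_keys_iff)
  finally show "Poly_Mapping.lookup u k =
    Poly_Mapping.lookup (\<Sum>i\<in>Poly_Mapping.keys u. Poly_Mapping.single i (Poly_Mapping.lookup u i)) k" ..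
qed

context
  fixes s :: "'r::comm_ring_1 \<Rightarrow> 'p \<Rightarrow> 'p::ab_group_add"
  assumes s: "Modules.module s"
begin

interpretation Modules.module s by (rule s)

lemma linear_extension_superset:
  assumes "finite A" "Poly_Mapping.keys u \<subseteq> A"
  shows "linear_extension s b u = (\<Sum>p\<in>A. s (Poly_Mapping.lookup u p) (b (fst p) (snd p)))"
  unfolding linear_extension_def case_prod_unfold prod.collapse
  by (rule sum.mono_neutral_left) (use assms in \<open>auto simp: Poly_Mapping.in_keys_iff\<close>)

lemma linear_extension_single: "linear_extension s b (Poly_Mapping.single p r) = s r (b (fst p) (snd p))"
  by (subst linear_extension_superset[of "{p}"]) auto

lemma linear_extension_zero: "linear_extension s b 0 = 0"
  by (simp add: linear_extension_def)

lemma linear_extension_add: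
  "linear_extension s b (u + v) = linear_extension s b u + linear_extension s b v"
proof -
  let ?A = "Poly_Mapping.keys u \<union> Poly_Mapping.keys v"
  have "Poly_Mapping.keys (u + v) \<subseteq> ?A" by (rule Poly_Mapping.keys_add)
  then show ?thesis
    by (simp add: linear_extension_superset[of ?A] Poly_Mapping.lookup_add scale_left_distrib sum.distrib)
qed

lemma linear_extension_scalar_mult:
  "linear_extension s b (scalar_mult r u) = s r (linear_extension s b u)"
  using keys_scalar_mult[of r u]
  by (simp add: linear_extension_superset[of "Poly_Mapping.keys u"] lookup_scalar_mult scale_sum_right)

lemma linear_extension_diff:
  "linear_extension s b (u - v) = linear_extension s b u - linear_extension s b v"
  using linear_extension_add[of b "u - v" v] by (simp add: algebra_simps)

lemma linear_extension_sum: "linear_extension s b (sum h I) = (\<Sum>i\<in>I. linear_extension s b (h i))"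
  by (induction I rule: infinite_finite_induct) (auto simp: linear_extension_zero linear_extension_add)

definition bilinear_on where
  "bilinear_on R b t M t' N \<longleftrightarrow>
     (\<forall>x\<in>M. \<forall>x'\<in>M. \<forall>y\<in>N. b (x + x') y = b x y + b x' y) \<and>
     (\<forall>x\<in>M. \<forall>y\<in>N. \<forall>y'\<in>N. b x (y + y') = b x y + b x y') \<and>
     (\<forall>r\<in>R. \<forall>x\<in>M. \<forall>y\<in>N. b (t r x) y = s r (b x y) \<and> b x (t' r y) = s r (b x y))"

lemma linear_extension_relations:
  assumes "bilinear_on R b t M t' N" and "w \<in> tensor_relations R t M t' N"
  shows "linear_extension s b w = 0"
  using assms(2)
proof (induction rule: tensor_relations.induct)
qed (use assms(1) in \<open>auto simp: bilinear_on_def linear_extension_zero linear_extension_add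
    linear_extension_diff linear_extension_scalar_mult linear_extension_single\<close>)

end

context pid_subring
begin

context
  fixes t :: "'a \<Rightarrow> 'm \<Rightarrow> 'm::ab_group_add" and M :: "'m set"
    and t' :: "'a \<Rightarrow> 'n \<Rightarrow> 'n::ab_group_add" and N :: "'n set"
  assumes t: "Modules.module t" and t': "Modules.module t'"
    and M: "submodule t M" and N: "submodule t' N"
begin

interpretation t: Modules.module t by (rule t)
interpretation t': Modules.module t' by (rule t')

abbreviation "relations \<equiv> tensor_relations R t M t' N"
abbreviation "free \<equiv> free_module R (M \<times> N)"
text \<open>Written as the image of u under the very relation that defines the quotient, so that it
  matches the members of \<open>tensor_product\<close> literally.\<close>

abbreviation "tensor_class u \<equiv>
  {(u, v). u \<in> free \<and> v \<in> free \<and> u - v \<in> relations} `` {u}"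

lemma relations_uminus: "w \<in> relations \<Longrightarrow> - w \<in> relations"
  using tensor_relations.scalar_mult[OF R_uminus[OF R_one], of w t M t' N]
  by (simp add: Modules.module.scale_minus_left[OF module_scalar_mult]
      Modules.module.scale_one[OF module_scalar_mult])

lemma relations_diff: "\<lbrakk>u \<in> relations; v \<in> relations\<rbrakk> \<Longrightarrow> u - v \<in> relations"
  using tensor_relations.add[of u R t M t' N "- v"] relations_uminus[of v] by simp

lemma relations_sum: "(\<And>i. i \<in> I \<Longrightarrow> h i \<in> relations) \<Longrightarrow> sum h I \<in> relations"
  by (induction I rule: infinite_finite_induct)
    (auto intro: tensor_relations.zero tensor_relations.add)

lemma relations_trans: "\<lbrakk>u - v \<in> relations; v - w \<in> relations\<rbrakk> \<Longrightarrow> u - w \<in> relations"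
  using tensor_relations.add[of "u - v" R t M t' N "v - w"] by simp

lemma free_diff:
  assumes "u \<in> free" "v \<in> free"
  shows "u - v \<in> free"
proof -
  have "Poly_Mapping.keys (u - v) \<subseteq> Poly_Mapping.keys u \<union> Poly_Mapping.keys v"
    by (auto simp: Poly_Mapping.in_keys_iff Poly_Mapping.lookup_minus)
  then show ?thesis using assms
    by (auto simp: free_module_def Poly_Mapping.lookup_minus intro: R_diff)
qed

lemma tensor_map_class:
  assumes s: "Modules.module (s :: 'a \<Rightarrow> 'p \<Rightarrow> 'p::ab_group_add)"
    and b: "bilinear_on s R b t M t' N" and u: "u \<in> free"
  shows "tensor_map s b (tensor_class u) = linear_extension s b u"
proof -
  have the_elem: "the_elem (f ` C) = f u" if "u \<in> C" "\<And>v. v \<in> C \<Longrightarrow> f v = f u"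
    for f :: "_ \<Rightarrow> 'p" and C
  proof -
    have "f ` C = {f u}" using that(1) by (intro equalityI subsetI) (auto dest: that(2))
    then show ?thesis by simp
  qed
  have "linear_extension s b v = linear_extension s b u" if "u - v \<in> relations" for v
    using linear_extension_relations[OF s b that] by (simp add: linear_extension_diff[OF s])
  then show ?thesis
    unfolding tensor_map_def
  proof (intro the_elem)
    show "u \<in> tensor_class u" using u by (simp add: tensor_relations.zero)
  qed blast
qed

lemma tensor_product_eq: "tensor_product R t M t' N = (\<lambda>u. tensor_class u) ` free"
  by (auto simp: tensor_product_def quotient_def)

lemma tensor_map_image:
  assumes "Modules.module s" and "bilinear_on s R b t M t' N"
  shows "tensor_map s b ` tensor_product R t M t' N = linear_extension s b ` free"
  unfolding tensor_product_eq image_image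
  by (rule image_cong[OF refl]) (rule tensor_map_class[OF assms])

lemma inj_on_tensor_map:
  assumes s: "Modules.module s" and b: "bilinear_on s R b t M t' N"
    and ker: "\<And>w. \<lbrakk>w \<in> free; linear_extension s b w = 0\<rbrakk> \<Longrightarrow> w \<in> relations"
  shows "inj_on (tensor_map s b) (tensor_product R t M t' N)"
proof (rule inj_onI)
  fix C D
  assume "C \<in> tensor_product R t M t' N" "D \<in> tensor_product R t M t' N"
    and eq: "tensor_map s b C = tensor_map s b D"
  then obtain u v where u: "u \<in> free" "C = tensor_class u" and v: "v \<in> free" "D = tensor_class v"
    by (auto simp: tensor_product_eq)
  have "linear_extension s b u = linear_extension s b v"
    using eq unfolding u(2) v(2) tensor_map_class[OF s b u(1)] tensor_map_class[OF s b v(1)] .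
  then have "linear_extension s b (u - v) = 0" by (simp add: linear_extension_diff[OF s])
  then have uv: "u - v \<in> relations" using ker free_diff u v by blast
  then have vu: "v - u \<in> relations" using relations_uminus[OF uv] by simp
  have "u - w \<in> relations \<longleftrightarrow> v - w \<in> relations" for w
    using relations_trans[OF vu, of w] relations_trans[OF uv, of w] by blast
  then show "C = D" using u v by auto
qed

lemma single_sum_left:
  assumes "\<And>i. i \<in> I \<Longrightarrow> f i \<in> M" and "y \<in> N"
  shows "Poly_Mapping.single (sum f I, y) 1 - (\<Sum>i\<in>I. Poly_Mapping.single (f i, y) 1) \<in> relations"
  using assms(1)
proof (induction I rule: infinite_finite_induct)
  case (insert i I)
  have "Poly_Mapping.single (f i + sum f I, y) 1 - Poly_Mapping.single (f i, y) 1 -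
      Poly_Mapping.single (sum f I, y) 1 \<in> relations"
    using insert.prems assms(2) by (intro tensor_relations.add_left submodule_sum[OF M]) auto
  from tensor_relations.add[OF this insert.IH] insert.prems insert.hyps show ?case
    by (simp add: algebra_simps)
\<comment> \<open>Empty and infinite sums are 0, and \<open>(0, y)\<close> is a relation because 0
  is its own multiple by the scalar 0.\<close>
qed (use tensor_relations.scale_left[OF R_zero submodule_zero[OF M] assms(2), where s = t and t = t'] in simp_all)

lemma single_sum_right:
  assumes "\<And>i. i \<in> I \<Longrightarrow> f i \<in> N" and "x \<in> M"
  shows "Poly_Mapping.single (x, sum f I) 1 - (\<Sum>i\<in>I. Poly_Mapping.single (x, f i) 1) \<in> relations"
  using assms(1)
proof (induction I rule: infinite_finite_induct)
  case (insert i I)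
  have "Poly_Mapping.single (x, f i + sum f I) 1 - Poly_Mapping.single (x, f i) 1 -
      Poly_Mapping.single (x, sum f I) 1 \<in> relations"
    using insert.prems assms(2) by (intro tensor_relations.add_right submodule_sum[OF N]) auto
  from tensor_relations.add[OF this insert.IH] insert.prems insert.hyps show ?case
    by (simp add: algebra_simps)
qed (use tensor_relations.scale_right[OF R_zero assms(2) submodule_zero[OF N], where s = t and t = t'] in simp_all)

context
  fixes B :: "'m set" and g :: "'m \<Rightarrow> 'm \<Rightarrow> 'a"
  assumes B: "lattice_basis t M B g"
begin

lemmas basis_M = lattice_basisD[OF B]

text \<open>Expanding x in the basis and carrying all scalars over to the right factor leaves only
  basis elements on the left.\<close>

lemma reduce_single:
  assumes x: "x \<in> M" and y: "y \<in> N" and r: "r \<in> R"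
  shows "Poly_Mapping.single (x, y) r - (\<Sum>b\<in>B. Poly_Mapping.single (b, t' (g b x) (t' r y)) 1)
    \<in> relations"
proof -
  let ?y = "t' r y"
  have ry: "?y \<in> N" using submodule_scale[OF N r y] .
  have BM: "b \<in> M" if "b \<in> B" for b using basis_M(2) that by blast
  have gb: "g b x \<in> R" if "b \<in> B" for b using basis_M(5)[OF x that] .
  have 1: "Poly_Mapping.single (x, y) r - Poly_Mapping.single (x, ?y) 1 \<in> relations"
    using relations_uminus[OF tensor_relations.scale_right[OF r x y, where s = t and t = t']] by simp
  have 2: "Poly_Mapping.single (x, ?y) 1 - (\<Sum>b\<in>B. Poly_Mapping.single (t (g b x) b, ?y) 1) \<in> relations"
    using single_sum_left[of B "\<lambda>b. t (g b x) b" ?y] submodule_scale[OF M gb BM] ry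
    by (simp flip: basis_M(6)[OF x])
  have 3: "(\<Sum>b\<in>B. Poly_Mapping.single (t (g b x) b, ?y) 1) - (\<Sum>b\<in>B. Poly_Mapping.single (b, ?y) (g b x))
    \<in> relations"
    unfolding sum_subtractf[symmetric]
    by (rule relations_sum) (use gb BM ry in \<open>auto intro: tensor_relations.scale_left\<close>)
  have 4: "(\<Sum>b\<in>B. Poly_Mapping.single (b, ?y) (g b x)) - (\<Sum>b\<in>B. Poly_Mapping.single (b, t' (g b x) ?y) 1)
    \<in> relations"
    unfolding sum_subtractf[symmetric]
  proof (rule relations_sum)
    fix b assume b: "b \<in> B"
    show "Poly_Mapping.single (b, ?y) (g b x) - Poly_Mapping.single (b, t' (g b x) ?y) 1 \<in> relations"
      using relations_uminus[OF tensor_relations.scale_right[OF gb[OF b] BM[OF b] ry, where s = t and t = t']] by simp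
  qed
  show ?thesis by (rule relations_trans[OF relations_trans[OF relations_trans[OF 1 2] 3] 4])
qed

text \<open>Since \<open>M\<close> is free on \<open>B\<close>, the tensor product consists of
  copies of \<open>N\<close> indexed by \<open>B\<close>; this is the surjective half of that
  identification.\<close>

lemma reduce_tensor:
  assumes w: "w \<in> free"
  obtains y where "\<And>b. b \<in> B \<Longrightarrow> y b \<in> N"
    and "w - (\<Sum>b\<in>B. Poly_Mapping.single (b, y b) 1) \<in> relations"
proof -
  define z where "z = (\<lambda>p b. t' (g b (fst p)) (t' (Poly_Mapping.lookup w p) (snd p)))"
  have wp: "fst p \<in> M" "snd p \<in> N" "Poly_Mapping.lookup w p \<in> R" if "p \<in> Poly_Mapping.keys w" for p
    using w that by (auto simp: free_module_def)
  have zN: "z p b \<in> N" if "p \<in> Poly_Mapping.keys w" "b \<in> B" for p b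
    unfolding z_def using wp[OF that(1)] basis_M(5) that by (intro submodule_scale[OF N]) auto
  define y where "y = (\<lambda>b. \<Sum>p\<in>Poly_Mapping.keys w. z p b)"
  have "(\<Sum>p\<in>Poly_Mapping.keys w. Poly_Mapping.single p (Poly_Mapping.lookup w p))
      - (\<Sum>p\<in>Poly_Mapping.keys w. \<Sum>b\<in>B. Poly_Mapping.single (b, z p b) 1) \<in> relations"
    unfolding sum_subtractf[symmetric] z_def
  proof (rule relations_sum)
    fix p assume "p \<in> Poly_Mapping.keys w"
    from reduce_single[OF wp[OF this]]
    show "Poly_Mapping.single p (Poly_Mapping.lookup w p) - (\<Sum>b\<in>B. Poly_Mapping.single
        (b, t' (g b (fst p)) (t' (Poly_Mapping.lookup w p) (snd p))) 1) \<in> relations" by simp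
  qed
  then have 1: "w - (\<Sum>b\<in>B. \<Sum>p\<in>Poly_Mapping.keys w. Poly_Mapping.single (b, z p b) 1) \<in> relations"
    using poly_mapping_expand[of w] by (simp add: sum.swap[of _ B])
  have 2: "(\<Sum>b\<in>B. Poly_Mapping.single (b, y b) 1)
      - (\<Sum>b\<in>B. \<Sum>p\<in>Poly_Mapping.keys w. Poly_Mapping.single (b, z p b) 1) \<in> relations"
    unfolding sum_subtractf[symmetric] y_def
    by (rule relations_sum, rule single_sum_right) (use zN basis_M(2) in auto)
  show thesis
  proof (rule that)
    show "y b \<in> N" if "b \<in> B" for b unfolding y_def by (rule submodule_sum[OF N]) (use zN that in auto)
    show "w - (\<Sum>b\<in>B. Poly_Mapping.single (b, y b) 1) \<in> relations"
      using relations_diff[OF 1 2] by simp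
  qed
qed

text \<open>As every tensor is a sum of classes of pairs \<open>(b, y b)\<close>, bijectivity
  becomes a question of unique expansions in \<open>T\<close>.\<close>

theorem bij_betw_tensor_map:
  assumes s: "Modules.module s" and b: "bilinear_on s R \<beta> t M t' N"
    and into: "\<And>y. (\<And>b. b \<in> B \<Longrightarrow> y b \<in> N) \<Longrightarrow> (\<Sum>b\<in>B. \<beta> b (y b)) \<in> T"
    and onto: "\<And>z. z \<in> T \<Longrightarrow> \<exists>y. (\<forall>b\<in>B. y b \<in> N) \<and> z = (\<Sum>b\<in>B. \<beta> b (y b))"
    and inj: "\<And>y b. \<lbrakk>\<And>b. b \<in> B \<Longrightarrow> y b \<in> N; (\<Sum>b\<in>B. \<beta> b (y b)) = 0; b \<in> B\<rbrakk> \<Longrightarrow> y b = 0"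
  shows "bij_betw (tensor_map s \<beta>) (tensor_product R t M t' N) T"
  unfolding bij_betw_def tensor_map_image[OF s b]
proof
  interpret s: Modules.module s by (rule s)
  have ext: "linear_extension s \<beta> (\<Sum>b\<in>B. Poly_Mapping.single (b, y b) 1) = (\<Sum>b\<in>B. \<beta> b (y b))" for y
    by (simp add: linear_extension_sum[OF s] linear_extension_single[OF s])
  have red: "\<exists>y. (\<forall>b\<in>B. y b \<in> N) \<and> linear_extension s \<beta> w = (\<Sum>b\<in>B. \<beta> b (y b)) \<and>
    w - (\<Sum>b\<in>B. Poly_Mapping.single (b, y b) 1) \<in> relations" if w: "w \<in> free" for w
  proof -
    obtain y where y: "\<And>b. b \<in> B \<Longrightarrow> y b \<in> N" "w - (\<Sum>b\<in>B. Poly_Mapping.single (b, y b) 1) \<in> relations"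
      by (rule reduce_tensor[OF w]) blast
    have "linear_extension s \<beta> w = (\<Sum>b\<in>B. \<beta> b (y b))"
      using linear_extension_relations[OF s b y(2)] by (simp add: linear_extension_diff[OF s] ext)
    then show ?thesis using y by blast
  qed
  show "inj_on (tensor_map s \<beta>) (tensor_product R t M t' N)"
  proof (rule inj_on_tensor_map[OF s b])
    fix w assume w: "w \<in> free" "linear_extension s \<beta> w = 0"
    obtain y where y': "(\<forall>b\<in>B. y b \<in> N) \<and> linear_extension s \<beta> w = (\<Sum>b\<in>B. \<beta> b (y b)) \<and>
      w - (\<Sum>b\<in>B. Poly_Mapping.single (b, y b) 1) \<in> relations" using red[OF w(1)] by (rule exE)
    then have y: "\<And>b. b \<in> B \<Longrightarrow> y b \<in> N" "linear_extension s \<beta> w = (\<Sum>b\<in>B. \<beta> b (y b))"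
      "w - (\<Sum>b\<in>B. Poly_Mapping.single (b, y b) 1) \<in> relations" by simp_all
    have "y b = 0" if "b \<in> B" for b using inj[OF y(1) _ that] y(2) w(2) by simp
    \<comment> \<open>The zero in the second slot is written as an empty sum, so that
      \<open>single_sum_right\<close> shows \<open>(b, 0)\<close> to be a relation.\<close>
    then have "(\<Sum>b\<in>B. Poly_Mapping.single (b, y b) 1) = (\<Sum>b\<in>B. Poly_Mapping.single (b, \<Sum>i\<in>({}::nat set). 0) (1::'a))"
      by simp
    also have "\<dots> \<in> relations"
      by (rule relations_sum) (use single_sum_right[of "{}::nat set" "\<lambda>_. 0"] basis_M(2) in auto)
    finally show "w \<in> relations" using tensor_relations.add[OF y(3)] by fastforce
  qed
  show "linear_extension s \<beta> ` free = T"
  proof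
    show "linear_extension s \<beta> ` free \<subseteq> T"
    proof
      fix z assume "z \<in> linear_extension s \<beta> ` free"
      then obtain w where w: "w \<in> free" "z = linear_extension s \<beta> w" by blast
      obtain y where "(\<forall>b\<in>B. y b \<in> N) \<and> linear_extension s \<beta> w = (\<Sum>b\<in>B. \<beta> b (y b)) \<and>
        w - (\<Sum>b\<in>B. Poly_Mapping.single (b, y b) 1) \<in> relations" using red[OF w(1)] by (rule exE)
      then show "z \<in> T" using into[of y] w(2) by simp
    qed
    show "T \<subseteq> linear_extension s \<beta> ` free"
    proof
      fix z assume "z \<in> T"
      then obtain y where y: "\<forall>b\<in>B. y b \<in> N" "z = (\<Sum>b\<in>B. \<beta> b (y b))" using onto by blast
      let ?w = "\<Sum>b\<in>B. Poly_Mapping.single (b, y b) (1::'a)"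
      have "Poly_Mapping.keys ?w \<subseteq> M \<times> N"
        using y(1) basis_M(2) Poly_Mapping.keys_sum[of "\<lambda>b. Poly_Mapping.single (b, y b) (1::'a)" B]
        by fastforce
      moreover have "Poly_Mapping.lookup ?w i \<in> R" for i
        by (auto simp: Poly_Mapping.lookup_sum Poly_Mapping.lookup_single when_def
            intro!: R_sum R_zero R_one)
      ultimately have "?w \<in> free" by (simp add: free_module_def)
      then show "z \<in> linear_extension s \<beta> ` free" 
        by (intro image_eqI[of _ _ ?w]) (simp_all add: ext y(2))
    qed
  qed
qed

end

end

end

subsection \<open>Group algebras and their actions\<close>

lemma conj_perm_comp: "bij p \<Longrightarrow> conj_perm p n \<circ> p = p \<circ> n"
  by (auto simp: conj_perm_def fun_eq_iff bij_is_inj)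

lemma conj_perm_eqI:
  assumes "bij p" "q \<circ> p = p \<circ> n"
  shows "conj_perm p n = q"
proof -
  have "q \<circ> p \<circ> inv_into UNIV p = q"
    using assms(1) by (auto simp: fun_eq_iff bij_is_surj surj_f_inv_f)
  then show ?thesis by (simp add: conj_perm_def assms(2))
qed

lemma conj_perm_conj_perm: "\<lbrakk>bij p; bij q\<rbrakk> \<Longrightarrow> conj_perm p (conj_perm q n) = conj_perm (p \<circ> q) n"
  by (simp add: conj_perm_def o_inv_distrib comp_assoc)

lemma conj_perm_id: "conj_perm id n = n"
  by (simp add: conj_perm_def)

lemma conj_perm_inv:
  assumes "bij p"
  shows "conj_perm (inv_into UNIV p) (conj_perm p n) = n" "conj_perm p (conj_perm (inv_into UNIV p) n) = n"
proof -
  have "inv_into UNIV p \<circ> p = id" "p \<circ> inv_into UNIV p = id"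
    using assms by (auto simp: fun_eq_iff bij_is_inj bij_is_surj surj_f_inv_f)
  then show "conj_perm (inv_into UNIV p) (conj_perm p n) = n"
    "conj_perm p (conj_perm (inv_into UNIV p) n) = n"
    using assms by (simp_all add: conj_perm_conj_perm bij_imp_bij_inv conj_perm_id)
qed

lemma inj_conj_perm: "bij p \<Longrightarrow> inj (conj_perm p)"
  by (metis conj_perm_inv(1) injI)

lemma lookup_galois_act:
  assumes p: "bij p" and "\<sigma> 0 = 0"
  shows "Poly_Mapping.lookup (galois_act \<sigma> p c) (conj_perm p n) = \<sigma> (Poly_Mapping.lookup c n)"
proof -
  have "Poly_Mapping.lookup (galois_act \<sigma> p c) (conj_perm p n)
    = (\<Sum>k\<in>Poly_Mapping.keys c. if k = n then \<sigma> (Poly_Mapping.lookup c k) else 0)"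
    unfolding galois_act_def Poly_Mapping.lookup_sum Poly_Mapping.lookup_single when_def
    by (rule sum.cong) (auto simp: inj_eq[OF inj_conj_perm[OF p]])
  then show ?thesis using assms(2) by (simp add: Poly_Mapping.in_keys_iff)
qed

text \<open>Being fixed by the semilinear action becomes equivariance of the coefficient function,
  the form in which all three Hopf algebras are handled.\<close>

lemma galois_act_fixed_iff:
  assumes p: "bij p" and 0: "\<sigma> 0 = 0" and N: "conj_perm p ` N = N" and c: "Poly_Mapping.keys c \<subseteq> N"
  shows "galois_act \<sigma> p c = c \<longleftrightarrow>
    (\<forall>n\<in>N. Poly_Mapping.lookup c (conj_perm p n) = \<sigma> (Poly_Mapping.lookup c n))"
proof
  assume "galois_act \<sigma> p c = c"
  then show "\<forall>n\<in>N. Poly_Mapping.lookup c (conj_perm p n) = \<sigma> (Poly_Mapping.lookup c n)"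
    using lookup_galois_act[of p \<sigma>, OF p 0, of c] by simp
next
  assume *: "\<forall>n\<in>N. Poly_Mapping.lookup c (conj_perm p n) = \<sigma> (Poly_Mapping.lookup c n)"
  show "galois_act \<sigma> p c = c"
  proof (rule poly_mapping_eqI)
    fix k
    define n where "n = conj_perm (inv_into UNIV p) k"
    have k: "k = conj_perm p n" by (simp add: n_def conj_perm_inv(2)[OF p])
    have "Poly_Mapping.lookup c (conj_perm p n) = \<sigma> (Poly_Mapping.lookup c n)"
    proof (cases "n \<in> N")
      case False
      then have "conj_perm p n \<notin> N" using N inj_conj_perm[OF p] by (metis inj_image_mem_iff)
      then show ?thesis using False c 0 by (metis Poly_Mapping.in_keys_iff subsetD)
    qed (use * in blast)
    then show "Poly_Mapping.lookup (galois_act \<sigma> p c) k = Poly_Mapping.lookup c k"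
      by (simp add: k lookup_galois_act[of p \<sigma>, OF p 0])
  qed
qed

lemma lookup_sum_single:
  assumes "finite N"
  shows "Poly_Mapping.lookup (\<Sum>n\<in>N. Poly_Mapping.single n (f n)) k = (if k \<in> N then f k else 0)"
  using assms by (simp add: Poly_Mapping.lookup_sum Poly_Mapping.lookup_single when_def)

lemma keys_sum_single:
  assumes "finite N"
  shows "Poly_Mapping.keys (\<Sum>n\<in>N. Poly_Mapping.single n (f n)) \<subseteq> N"
proof
  fix k assume "k \<in> Poly_Mapping.keys (\<Sum>n\<in>N. Poly_Mapping.single n (f n))"
  then show "k \<in> N" using lookup_sum_single[OF assms, of f k]
    by (auto simp: Poly_Mapping.in_keys_iff split: if_splits)
qed

lemma hopf_act_superset:
  assumes "finite A" "Poly_Mapping.keys c \<subseteq> A"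
  shows "hopf_act c x = (\<Sum>n\<in>A. Poly_Mapping.lookup c n * inv_into UNIV n id x)"
  unfolding hopf_act_def
  by (rule sum.mono_neutral_left) (use assms in \<open>auto simp: Poly_Mapping.in_keys_iff\<close>)

lemma hopf_act_zero_left: "hopf_act 0 x = 0"
  by (simp add: hopf_act_def)

lemma hopf_act_add_left: "hopf_act (c + d) x = hopf_act c x + hopf_act d x"
proof -
  let ?A = "Poly_Mapping.keys c \<union> Poly_Mapping.keys d"
  have "Poly_Mapping.keys (c + d) \<subseteq> ?A" by (rule Poly_Mapping.keys_add)
  then show ?thesis
    by (simp add: hopf_act_superset[of ?A] Poly_Mapping.lookup_add algebra_simps sum.distrib)
qed

lemma hopf_act_scalar_mult: "hopf_act (scalar_mult r c) x = r * hopf_act c x"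
  using keys_scalar_mult[of r c]
  by (simp add: hopf_act_superset[of "Poly_Mapping.keys c"] lookup_scalar_mult sum_distrib_left mult.assoc)

lemma hopf_act_diff_left: "hopf_act (c - d) x = hopf_act c x - hopf_act d x"
  using hopf_act_add_left[of "c - d" d x] by (simp add: algebra_simps)

lemma hopf_act_sum_left: "hopf_act (sum f I) x = (\<Sum>i\<in>I. hopf_act (f i) x)"
  by (induction I rule: infinite_finite_induct) (auto simp: hopf_act_zero_left hopf_act_add_left)

lemma hopf_act_single: "hopf_act (Poly_Mapping.single n r) x = r * inv_into UNIV n id x"
  by (subst hopf_act_superset[of "{n}"]) auto

lemma group_algebra_product_superset:
  assumes "finite A" "Poly_Mapping.keys c \<subseteq> A" "finite B" "Poly_Mapping.keys d \<subseteq> B"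
  shows "group_algebra_product \<iota> c d = (\<Sum>n\<in>A. \<Sum>m\<in>B.
    Poly_Mapping.single (\<iota> n m) (Poly_Mapping.lookup c n * Poly_Mapping.lookup d m))"
proof -
  have "group_algebra_product \<iota> c d = (\<Sum>n\<in>Poly_Mapping.keys c. \<Sum>m\<in>B.
    Poly_Mapping.single (\<iota> n m) (Poly_Mapping.lookup c n * Poly_Mapping.lookup d m))"
    unfolding group_algebra_product_def
    by (intro sum.cong[OF refl] sum.mono_neutral_left)
      (use assms in \<open>auto simp: Poly_Mapping.in_keys_iff\<close>)
  also have "\<dots> = (\<Sum>n\<in>A. \<Sum>m\<in>B.
    Poly_Mapping.single (\<iota> n m) (Poly_Mapping.lookup c n * Poly_Mapping.lookup d m))"
    by (rule sum.mono_neutral_left) (use assms in \<open>auto simp: Poly_Mapping.in_keys_iff\<close>)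
  finally show ?thesis .
qed

lemma group_algebra_product_add_left:
  "group_algebra_product \<iota> (c + c') d = group_algebra_product \<iota> c d + group_algebra_product \<iota> c' d"
proof -
  let ?A = "Poly_Mapping.keys c \<union> Poly_Mapping.keys c'"
  have "Poly_Mapping.keys (c + c') \<subseteq> ?A" by (rule Poly_Mapping.keys_add)
  then show ?thesis
    by (simp add: group_algebra_product_superset[of ?A _ "Poly_Mapping.keys d"] Poly_Mapping.lookup_add
        algebra_simps Poly_Mapping.single_add sum.distrib)
qed

lemma group_algebra_product_add_right:
  "group_algebra_product \<iota> c (d + d') = group_algebra_product \<iota> c d + group_algebra_product \<iota> c d'"
proof -
  let ?B = "Poly_Mapping.keys d \<union> Poly_Mapping.keys d'"
  have "Poly_Mapping.keys (d + d') \<subseteq> ?B" by (rule Poly_Mapping.keys_add)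
  then show ?thesis
    by (simp add: group_algebra_product_superset[of "Poly_Mapping.keys c" _ ?B] Poly_Mapping.lookup_add
        algebra_simps Poly_Mapping.single_add sum.distrib)
qed

lemma group_algebra_product_scalar_mult:
  "group_algebra_product \<iota> (scalar_mult r c) d = scalar_mult r (group_algebra_product \<iota> c d)"
  "group_algebra_product \<iota> c (scalar_mult r d) = scalar_mult r (group_algebra_product \<iota> c d)"
proof -
  note sup = group_algebra_product_superset[of "Poly_Mapping.keys c" _ "Poly_Mapping.keys d"]
  note simps = lookup_scalar_mult Modules.module.scale_sum_right[OF module_scalar_mult]
    scalar_mult_single mult_ac
  show "group_algebra_product \<iota> (scalar_mult r c) d = scalar_mult r (group_algebra_product \<iota> c d)"
    using keys_scalar_mult[of r c] by (simp add: sup simps)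
  show "group_algebra_product \<iota> c (scalar_mult r d) = scalar_mult r (group_algebra_product \<iota> c d)"
    using keys_scalar_mult[of r d] by (simp add: sup simps)
qed

lemma group_algebra_product_zero:
  "group_algebra_product \<iota> 0 d = 0" "group_algebra_product \<iota> c 0 = 0"
  by (simp_all add: group_algebra_product_def)

lemma group_algebra_product_sum:
  "group_algebra_product \<iota> (sum f I) d = (\<Sum>i\<in>I. group_algebra_product \<iota> (f i) d)"
  "group_algebra_product \<iota> c (sum f' I) = (\<Sum>i\<in>I. group_algebra_product \<iota> c (f' i))"
  by (induction I rule: infinite_finite_induct)
    (auto simp: group_algebra_product_zero group_algebra_product_add_left group_algebra_product_add_right)

text \<open>Regularity is recorded by the unique permutation that carries a given point to
  \<open>id\<close>, because the actions on the fields use exactly the preimage of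
  \<open>id\<close>.\<close>

locale hopf_galois = semidirect_galois R G J G' for R :: "'a::field set" and G J G' +
  fixes N1 N2 :: "(('a \<Rightarrow> 'a) \<Rightarrow> ('a \<Rightarrow> 'a)) set"
  assumes N1_permutes: "n \<in> N1 \<Longrightarrow> n permutes J"
    and N1_regular: "\<sigma> \<in> J \<Longrightarrow> \<exists>!n. n \<in> N1 \<and> n \<sigma> = id"
    and N1_conj: "g \<in> G \<Longrightarrow> conj_perm (lambda_c J G' g) ` N1 = N1"
    and N2_permutes: "n \<in> N2 \<Longrightarrow> n permutes G'"
    and N2_regular: "\<tau> \<in> G' \<Longrightarrow> \<exists>!n. n \<in> N2 \<and> n \<tau> = id"
    and N2_conj: "\<tau> \<in> G' \<Longrightarrow> conj_perm (left_regular G' \<tau>) ` N2 = N2"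
begin

text \<open>The automorphism through which \<open>n\<close> acts. By regularity it determines
  \<open>n\<close> within \<open>N1\<close> or \<open>N2\<close>, so coefficients can be recovered
  from an action.\<close>

abbreviation unit_image :: "(('a \<Rightarrow> 'a) \<Rightarrow> ('a \<Rightarrow> 'a)) \<Rightarrow> ('a \<Rightarrow> 'a)" where
  "unit_image n \<equiv> inv_into UNIV n id"

abbreviation io where "io \<equiv> iota G J G'"
abbreviation "lc \<equiv> lambda_c J G'"
abbreviation "N \<equiv> (\<lambda>(\<phi>, \<psi>). io \<phi> \<psi>) ` (N1 \<times> N2)"
abbreviation "H1 \<equiv> fixed_group_algebra UNIV N1 G lc"
abbreviation "H2 \<equiv> fixed_group_algebra F N2 G' (left_regular G')"
abbreviation "H \<equiv> fixed_group_algebra UNIV N G (left_regular G)"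
abbreviation "A1 \<equiv> associated_order H1 OE"
abbreviation "A2 \<equiv> associated_order H2 OF"
abbreviation "A \<equiv> associated_order H OL"
abbreviation "product \<equiv> group_algebra_product io"

lemma unit_image_props:
  assumes "n permutes Y" "id \<in> Y"
  shows "unit_image n \<in> Y" "n (unit_image n) = id"
proof -
  show "n (unit_image n) = id" using assms by (simp add: permutes_surj surj_f_inv_f)
  then show "unit_image n \<in> Y" using assms permutes_in_image by metis
qed

lemma unit_image_N1: "n \<in> N1 \<Longrightarrow> unit_image n \<in> J" "n \<in> N1 \<Longrightarrow> n (unit_image n) = id"
  using unit_image_props[OF N1_permutes id_J] by auto

lemma unit_image_N2: "n \<in> N2 \<Longrightarrow> unit_image n \<in> G'" "n \<in> N2 \<Longrightarrow> n (unit_image n) = id"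
  using unit_image_props[OF N2_permutes id_G'] by auto

lemma inj_unit_image: "inj_on unit_image N1" "inj_on unit_image N2"
proof -
  show "inj_on unit_image N1"
  proof (rule inj_onI)
    fix n m assume *: "n \<in> N1" "m \<in> N1" "unit_image n = unit_image m"
    then have "m (unit_image n) = id" using unit_image_N1(2)[of m] by simp
    then show "n = m" using N1_regular[of "unit_image n"] unit_image_N1[of n] * by blast
  qed
  show "inj_on unit_image N2"
  proof (rule inj_onI)
    fix n m assume *: "n \<in> N2" "m \<in> N2" "unit_image n = unit_image m"
    then have "m (unit_image n) = id" using unit_image_N2(2)[of m] by simp
    then show "n = m" using N2_regular[of "unit_image n"] unit_image_N2[of n] * by blast
  qed
qed

lemma finite_J: "finite J" and finite_G': "finite G'"
  using finite_G J_subset G'_subset finite_subset by auto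

lemma finite_N1: "finite N1" and finite_N2: "finite N2"
  using inj_on_finite[OF inj_unit_image(1) _ finite_J] inj_on_finite[OF inj_unit_image(2) _ finite_G']
    unit_image_N1 unit_image_N2 by auto

lemma finite_N: "finite N"
  using finite_N1 finite_N2 by auto

text \<open>In this form \<open>lambda_c\<close> is seen to be the translation of the cosets of
  \<open>G'\<close> in \<open>G\<close>, with \<open>J\<close> as system of representatives.\<close>

lemma lambda_c_eq: "\<lbrakk>g \<in> G; h \<in> J\<rbrakk> \<Longrightarrow> lc g h = g \<circ> h \<circ> inv_into UNIV (G'_part J G' g)"
  using parts(3)[of g] by (simp add: lambda_c_def)

lemma lambda_c_J:
  assumes "g \<in> G" "h \<in> J"
  shows "lc g h \<in> J"
proof -
  have "lc g h = J_part J G' g \<circ> (G'_part J G' g \<circ> h \<circ> inv_into UNIV (G'_part J G' g))"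
    using assms(2) by (simp add: lambda_c_def comp_assoc)
  then show ?thesis using parts[OF assms(1)] assms(2) by (simp add: comp_J normal_J G'_G)
qed

lemma lambda_c_comp:
  assumes "g \<in> G" "h \<in> G"
  shows "lc (g \<circ> h) = lc g \<circ> lc h"
proof
  fix x
  show "lc (g \<circ> h) x = (lc g \<circ> lc h) x"
  proof (cases "x \<in> J")
    case True
    have "inv_into UNIV (G'_part J G' g \<circ> G'_part J G' h) =
      inv_into UNIV (G'_part J G' h) \<circ> inv_into UNIV (G'_part J G' g)"
      using parts assms by (intro o_inv_distrib bij_G G'_G) auto
    then show ?thesis
      using True assms lambda_c_eq[OF assms(1) lambda_c_J[OF assms(2) True]]
      by (simp add: lambda_c_eq[OF _ True] comp_G part_mult comp_assoc)
  qed (simp add: lambda_c_def)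
qed

lemma lambda_c_id: "lc id = id"
  by (auto simp: fun_eq_iff lambda_c_def part_J id_J)

lemma bij_lambda_c: "g \<in> G \<Longrightarrow> bij (lc g)"
  using lambda_c_comp[of g "inv_into UNIV g"] lambda_c_comp[of "inv_into UNIV g" g]
  by (intro o_bij[of "lc (inv_into UNIV g)"]) (simp_all add: inv_G G_inv lambda_c_id)

lemma left_regular_comp:
  assumes "\<And>x. x \<in> Y \<Longrightarrow> h \<circ> x \<in> Y"
  shows "left_regular Y (g \<circ> h) = left_regular Y g \<circ> left_regular Y h"
  using assms by (auto simp: fun_eq_iff left_regular_def)

lemma left_regular_id: "left_regular Y id = id"
  by (auto simp: fun_eq_iff left_regular_def)

lemma bij_left_regular_G: "g \<in> G \<Longrightarrow> bij (left_regular G g)"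
  using left_regular_comp[of G "inv_into UNIV g" g] left_regular_comp[of G g "inv_into UNIV g"]
  by (intro o_bij[of "left_regular G (inv_into UNIV g)"])
    (simp_all add: inv_G G_inv left_regular_id comp_G)

lemma bij_left_regular_G': "g \<in> G' \<Longrightarrow> bij (left_regular G' g)"
  using left_regular_comp[of G' "inv_into UNIV g" g] left_regular_comp[of G' g "inv_into UNIV g"]
  by (intro o_bij[of "left_regular G' (inv_into UNIV g)"])
    (simp_all add: inv_G' G_inv G'_G left_regular_id comp_G')

lemma iota_apply: "g \<in> G \<Longrightarrow> io \<phi> \<psi> g = \<phi> (J_part J G' g) \<circ> \<psi> (G'_part J G' g)"
  by (simp add: iota_def)

lemma iota_comp:
  assumes "\<And>x. x \<in> J \<Longrightarrow> n x \<in> J" "\<And>x. x \<in> G' \<Longrightarrow> m x \<in> G'"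
  shows "io p q \<circ> io n m = io (p \<circ> n) (q \<circ> m)"
proof
  fix g
  show "(io p q \<circ> io n m) g = io (p \<circ> n) (q \<circ> m) g"
  proof (cases "g \<in> G")
    case True
    have *: "n (J_part J G' g) \<in> J" "m (G'_part J G' g) \<in> G'" using assms parts[OF True] by auto
    then have "n (J_part J G' g) \<circ> m (G'_part J G' g) \<in> G" by (simp add: comp_G J_G G'_G)
    then show ?thesis using True part_comp[OF *] by (simp add: iota_apply)
  qed (simp add: iota_def)
qed

text \<open>By \<open>part_mult\<close>, left translation on \<open>G\<close> acts separately on the
  two parts of its argument. This links the structure on the big field to those on \<open>E\<close>
  and \<open>F\<close>.\<close>

lemma left_regular_eq_iota:
  assumes g: "g \<in> G"
  shows "left_regular G g = io (lc g) (left_regular G' (G'_part J G' g))"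
proof
  fix h
  show "left_regular G g h = io (lc g) (left_regular G' (G'_part J G' g)) h"
  proof (cases "h \<in> G")
    case True
    have "io (lc g) (left_regular G' (G'_part J G' g)) h = J_part J G' (g \<circ> h) \<circ> G'_part J G' (g \<circ> h)"
      using True g parts[OF True] by (simp add: iota_apply lambda_c_eq left_regular_def part_mult)
    then show ?thesis using True parts(3)[OF comp_G[OF g True]] by (simp add: left_regular_def)
  qed (simp add: left_regular_def iota_def)
qed

text \<open>Left translation is itself a value of \<open>iota\<close>, so conjugation by it works in
  each component. Checking an intertwining relation avoids inverting \<open>iota\<close>.\<close>

lemma conj_perm_iota:
  assumes g: "g \<in> G" and n: "n1 \<in> N1" "n2 \<in> N2"
  shows "conj_perm (left_regular G g) (io n1 n2) =
    io (conj_perm (lc g) n1) (conj_perm (left_regular G' (G'_part J G' g)) n2)"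
proof (rule conj_perm_eqI[OF bij_left_regular_G[OF g]])
  let ?t = "G'_part J G' g"
  note p = parts[OF g]
  have "io (conj_perm (lc g) n1) (conj_perm (left_regular G' ?t) n2) \<circ> left_regular G g =
    io (conj_perm (lc g) n1 \<circ> lc g) (conj_perm (left_regular G' ?t) n2 \<circ> left_regular G' ?t)"
    unfolding left_regular_eq_iota[OF g]
    by (rule iota_comp) (use g p in \<open>auto simp: lambda_c_J left_regular_def comp_G'\<close>)
  also have "\<dots> = io (lc g \<circ> n1) (left_regular G' ?t \<circ> n2)"
    by (simp add: conj_perm_comp bij_lambda_c g bij_left_regular_G' p)
  also have "\<dots> = left_regular G g \<circ> io n1 n2"
    unfolding left_regular_eq_iota[OF g]
    by (rule iota_comp[symmetric])
      (use permutes_in_image[OF N1_permutes[OF n(1)]] permutes_in_image[OF N2_permutes[OF n(2)]] in auto)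
  finally show "io (conj_perm (lc g) n1) (conj_perm (left_regular G' ?t) n2) \<circ> left_regular G g =
    left_regular G g \<circ> io n1 n2" .
qed

lemma conj_N1: "\<lbrakk>g \<in> G; n \<in> N1\<rbrakk> \<Longrightarrow> conj_perm (lc g) n \<in> N1"
  using N1_conj by blast

lemma conj_N2: "\<lbrakk>\<tau> \<in> G'; n \<in> N2\<rbrakk> \<Longrightarrow> conj_perm (left_regular G' \<tau>) n \<in> N2"
  using N2_conj by blast

lemma iota_in_N: "\<lbrakk>n1 \<in> N1; n2 \<in> N2\<rbrakk> \<Longrightarrow> io n1 n2 \<in> N"
  by force

lemma N_conj:
  assumes "g \<in> G"
  shows "conj_perm (left_regular G g) ` N = N"
proof (rule endo_inj_surj[OF finite_N])
  show "conj_perm (left_regular G g) ` N \<subseteq> N"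
    using conj_N1 conj_N2 parts(2) assms by (auto simp: conj_perm_iota intro!: iota_in_N)
  show "inj_on (conj_perm (left_regular G g)) N"
    using inj_conj_perm[OF bij_left_regular_G[OF assms]] by (rule inj_on_subset) simp
qed

lemma iota_inj:
  assumes "n1 \<in> N1" "n2 \<in> N2" "m1 \<in> N1" "m2 \<in> N2" and eq: "io n1 n2 = io m1 m2"
  shows "n1 = m1" and "n2 = m2"
proof -
  have *: "n1 \<sigma> = m1 \<sigma> \<and> n2 \<tau> = m2 \<tau>" if st: "\<sigma> \<in> J" "\<tau> \<in> G'" for \<sigma> \<tau>
  proof -
    have st': "\<sigma> \<circ> \<tau> \<in> G" using st by (simp add: comp_G J_G G'_G)
    have "n1 \<sigma> \<circ> n2 \<tau> = m1 \<sigma> \<circ> m2 \<tau>"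
      using iota_apply[OF st', of n1 n2] iota_apply[OF st', of m1 m2] eq by (simp add: part_comp st)
    moreover have "n1 \<sigma> \<in> J" "m1 \<sigma> \<in> J" "n2 \<tau> \<in> G'" "m2 \<tau> \<in> G'"
      using st assms permutes_in_image N1_permutes N2_permutes by metis+
    ultimately show ?thesis using decomposition_unique by blast
  qed
  show "n1 = m1"
  proof
    fix x show "n1 x = m1 x"
      using *[OF _ id_G', of x] permutes_not_in[OF N1_permutes[OF assms(1)], of x]
        permutes_not_in[OF N1_permutes[OF assms(3)], of x] by (cases "x \<in> J") auto
  qed
  show "n2 = m2"
  proof
    fix x show "n2 x = m2 x"
      using *[OF id_J, of x] permutes_not_in[OF N2_permutes[OF assms(2)], of x]
        permutes_not_in[OF N2_permutes[OF assms(4)], of x] by (cases "x \<in> G'") auto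
  qed
qed

text \<open>\<open>inv_into\<close> chooses some preimage of \<open>id\<close>; uniqueness of the
  factorization into \<open>J\<close> and \<open>G'\<close> shows that there is only one.\<close>

lemma unit_image_iota:
  assumes n: "n1 \<in> N1" "n2 \<in> N2"
  shows "unit_image (io n1 n2) = unit_image n1 \<circ> unit_image n2"
proof -
  note u1 = unit_image_N1[OF n(1)] and u2 = unit_image_N2[OF n(2)]
  have mem: "unit_image n1 \<circ> unit_image n2 \<in> G" using u1 u2 by (simp add: comp_G J_G G'_G)
  have val: "io n1 n2 (unit_image n1 \<circ> unit_image n2) = id"
    using u1 u2 iota_apply[OF mem] by (simp add: part_comp)
  have "h = unit_image n1 \<circ> unit_image n2" if h: "io n1 n2 h = id" for h
  proof -
    have hG: "h \<in> G" using h id_G by (auto simp: iota_def split: if_splits)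
    note p = parts[OF hG]
    have im: "n1 (J_part J G' h) \<in> J" "n2 (G'_part J G' h) \<in> G'"
      using p permutes_in_image N1_permutes N2_permutes n by metis+
    have "n1 (J_part J G' h) \<circ> n2 (G'_part J G' h) = id \<circ> id" using h iota_apply[OF hG] by simp
    then have "n1 (J_part J G' h) = id" "n2 (G'_part J G' h) = id"
      using decomposition_unique[OF im id_J id_G'] by blast+
    then have "J_part J G' h = unit_image n1" "G'_part J G' h = unit_image n2"
      using permutes_inj[OF N1_permutes[OF n(1)]] permutes_inj[OF N2_permutes[OF n(2)]]
      by (metis inv_f_f)+
    then show ?thesis using p(3) by simp
  qed
  moreover have "id \<in> range (io n1 n2)" using val by (metis rangeI)
  then have "io n1 n2 (unit_image (io n1 n2)) = id" by (rule f_inv_into_f)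
  ultimately show ?thesis by blast
qed

end

subsection \<open>Galois descent\<close>

context hopf_galois
begin

lemma H1_iff: "c \<in> H1 \<longleftrightarrow> Poly_Mapping.keys c \<subseteq> N1 \<and>
  (\<forall>g\<in>G. \<forall>n\<in>N1. Poly_Mapping.lookup c (conj_perm (lc g) n) = g (Poly_Mapping.lookup c n))"
proof -
  have "galois_act g (lc g) c = c \<longleftrightarrow>
      (\<forall>n\<in>N1. Poly_Mapping.lookup c (conj_perm (lc g) n) = g (Poly_Mapping.lookup c n))"
    if "g \<in> G" "Poly_Mapping.keys c \<subseteq> N1" for g
    using galois_act_fixed_iff[of "lc g" g "N1" c] bij_lambda_c G_zero N1_conj that by simp
  then show ?thesis by (auto simp: fixed_group_algebra_def free_module_def)
qed

lemma H2_iff: "c \<in> H2 \<longleftrightarrow> Poly_Mapping.keys c \<subseteq> N2 \<and> (\<forall>n. Poly_Mapping.lookup c n \<in> F) \<and>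
  (\<forall>\<tau>\<in>G'. \<forall>n\<in>N2. Poly_Mapping.lookup c (conj_perm (left_regular G' \<tau>) n) = \<tau> (Poly_Mapping.lookup c n))"
proof -
  have "galois_act g (left_regular G' g) c = c \<longleftrightarrow>
      (\<forall>n\<in>N2. Poly_Mapping.lookup c (conj_perm (left_regular G' g) n) = g (Poly_Mapping.lookup c n))"
    if "g \<in> G'" "Poly_Mapping.keys c \<subseteq> N2" for g
    using galois_act_fixed_iff[of "left_regular G' g" g "N2" c] bij_left_regular_G' G_zero[OF G'_G] N2_conj that by simp
  then show ?thesis by (auto simp: fixed_group_algebra_def free_module_def)
qed

lemma H_iff: "c \<in> H \<longleftrightarrow> Poly_Mapping.keys c \<subseteq> N \<and>
  (\<forall>g\<in>G. \<forall>n\<in>N. Poly_Mapping.lookup c (conj_perm (left_regular G g) n) = g (Poly_Mapping.lookup c n))"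
proof -
  have "galois_act g (left_regular G g) c = c \<longleftrightarrow>
      (\<forall>n\<in>N. Poly_Mapping.lookup c (conj_perm (left_regular G g) n) = g (Poly_Mapping.lookup c n))"
    if "g \<in> G" "Poly_Mapping.keys c \<subseteq> N" for g
    using galois_act_fixed_iff[of "left_regular G g" g "N" c] bij_left_regular_G G_zero N_conj that by simp
  then show ?thesis by (auto simp: fixed_group_algebra_def free_module_def)
qed

lemma H1_keys: "c \<in> H1 \<Longrightarrow> Poly_Mapping.keys c \<subseteq> N1"
  and H2_keys: "c \<in> H2 \<Longrightarrow> Poly_Mapping.keys c \<subseteq> N2"
  and H_keys: "c \<in> H \<Longrightarrow> Poly_Mapping.keys c \<subseteq> N"
  by (simp_all add: H1_iff H2_iff H_iff)

lemma keys_add_subset: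
  "\<lbrakk>Poly_Mapping.keys c \<subseteq> M; Poly_Mapping.keys d \<subseteq> M\<rbrakk> \<Longrightarrow> Poly_Mapping.keys (c + d) \<subseteq> M"
  using Poly_Mapping.keys_add[of c d] by blast

lemma H_zero: "0 \<in> H1" "0 \<in> H2" "0 \<in> H"
  using F_closed(1)[OF K_zero] by (auto simp: H1_iff H2_iff H_iff G_zero G'_G)

lemma H_add: "\<lbrakk>c \<in> H1; d \<in> H1\<rbrakk> \<Longrightarrow> c + d \<in> H1" "\<lbrakk>c' \<in> H2; d' \<in> H2\<rbrakk> \<Longrightarrow> c' + d' \<in> H2"
  "\<lbrakk>c'' \<in> H; d'' \<in> H\<rbrakk> \<Longrightarrow> c'' + d'' \<in> H"
proof -
  show "c + d \<in> H1" if "c \<in> H1" "d \<in> H1"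
    using that keys_add_subset[of c N1 d] unfolding H1_iff
    by (simp add: Poly_Mapping.lookup_add G_add)
  show "c' + d' \<in> H2" if "c' \<in> H2" "d' \<in> H2"
    using that keys_add_subset[of c' N2 d'] unfolding H2_iff
    by (simp add: Poly_Mapping.lookup_add G_add G'_G F_closed(2))
  show "c'' + d'' \<in> H" if "c'' \<in> H" "d'' \<in> H"
    using that keys_add_subset[of c'' N d''] unfolding H_iff
    by (simp add: Poly_Mapping.lookup_add G_add)
qed

lemma H_scale:
  assumes "k \<in> K"
  shows "c \<in> H1 \<Longrightarrow> scalar_mult k c \<in> H1" "c' \<in> H2 \<Longrightarrow> scalar_mult k c' \<in> H2"
    "c'' \<in> H \<Longrightarrow> scalar_mult k c'' \<in> H"
proof -
  show "scalar_mult k c \<in> H1" if "c \<in> H1"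
    using that keys_scalar_mult[of k c] assms unfolding H1_iff
    by (auto simp: lookup_scalar_mult G_mult G_K)
  show "scalar_mult k c' \<in> H2" if "c' \<in> H2"
    using that keys_scalar_mult[of k c'] assms unfolding H2_iff
    by (auto simp: lookup_scalar_mult G_mult G_K G'_G F_closed(1,3))
  show "scalar_mult k c'' \<in> H" if "c'' \<in> H"
    using that keys_scalar_mult[of k c''] assms unfolding H_iff
    by (auto simp: lookup_scalar_mult G_mult G_K)
qed

lemma H_sum: "(\<And>i. i \<in> I \<Longrightarrow> f i \<in> H1) \<Longrightarrow> sum f I \<in> H1"
  "(\<And>i. i \<in> I \<Longrightarrow> f' i \<in> H2) \<Longrightarrow> sum f' I \<in> H2"
  "(\<And>i. i \<in> I \<Longrightarrow> f'' i \<in> H) \<Longrightarrow> sum f'' I \<in> H"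
  by (induction I rule: infinite_finite_induct) (auto intro: H_zero H_add)

section \<open>The actions on the two subfields and on products\<close>

lemma hopf_act_H1: "c \<in> H1 \<Longrightarrow> hopf_act c x = (\<Sum>n\<in>N1. Poly_Mapping.lookup c n * unit_image n x)"
  and hopf_act_H2: "d \<in> H2 \<Longrightarrow> hopf_act d x = (\<Sum>n\<in>N2. Poly_Mapping.lookup d n * unit_image n x)"
  by (rule hopf_act_superset[OF finite_N1 H1_keys], assumption)
    (rule hopf_act_superset[OF finite_N2 H2_keys], assumption)

lemma unit_image_G: "n \<in> N1 \<Longrightarrow> unit_image n \<in> G" "n \<in> N2 \<Longrightarrow> unit_image n \<in> G" "n \<in> N \<Longrightarrow> unit_image n \<in> G"
  using unit_image_N1 unit_image_N2 J_G G'_G by (auto simp: unit_image_iota comp_G)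

lemma hopf_act_right:
  assumes c: "c \<in> H1 \<or> c \<in> H2 \<or> c \<in> H"
  shows "hopf_act c (x + y) = hopf_act c x + hopf_act c y"
    and "k \<in> K \<Longrightarrow> hopf_act c (k * x) = k * hopf_act c x"
    and "hopf_act c 0 = 0"
proof -
  have n: "unit_image n \<in> G" if "n \<in> Poly_Mapping.keys c" for n
    using c that unit_image_G subsetD[OF H1_keys[of c], of n] subsetD[OF H2_keys[of c], of n]
      subsetD[OF H_keys[of c], of n] by blast
  show "hopf_act c (x + y) = hopf_act c x + hopf_act c y"
    unfolding hopf_act_def sum.distrib[symmetric]
    by (rule sum.cong) (use n in \<open>auto simp: G_add distrib_left\<close>)
  show "hopf_act c (k * x) = k * hopf_act c x" if "k \<in> K"
    unfolding hopf_act_def sum_distrib_left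
    by (rule sum.cong) (use n that in \<open>auto simp: G_mult G_K\<close>)
  show "hopf_act c 0 = 0"
    unfolding hopf_act_def by (rule sum.neutral) (use n in \<open>auto simp: G_zero\<close>)
qed

lemma hopf_act_right_sum:
  assumes "c \<in> H1 \<or> c \<in> H2 \<or> c \<in> H"
  shows "hopf_act c (sum f I) = (\<Sum>i\<in>I. hopf_act c (f i))"
  by (induction I rule: infinite_finite_induct) (auto simp: hopf_act_right[OF assms])

text \<open>Conjugating n through \<open>lambda_c\<close> by an element of \<open>G'\<close>
  conjugates \<open>unit_image n\<close> by that element, which fixes x. So applying it to the value
  only permutes the summands.\<close>

lemma hopf_act_E:
  assumes c: "c \<in> H1" and x: "x \<in> E"
  shows "hopf_act c x \<in> E"
proof (rule E_I)
  fix \<tau> assume \<tau>: "\<tau> \<in> G'"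
  note \<tau>G = G'_G[OF \<tau>]
  let ?p = "conj_perm (lc \<tau>)"
  have conj: "\<tau> (unit_image n x) = unit_image (?p n) x" if n: "n \<in> N1" for n
  proof -
    have "?p n (lc \<tau> (unit_image n)) = lc \<tau> (n (unit_image n))"
      using conj_perm_comp[OF bij_lambda_c[OF \<tau>G], of n] by (metis comp_apply)
    \<comment> \<open>On elements of \<open>G'\<close>, \<open>lambda_c\<close> is conjugation and
      therefore fixes \<open>id\<close>.\<close>
    also have "\<dots> = id" using unit_image_N1(2)[OF n] \<tau>G by (simp add: lambda_c_eq id_J part_G' \<tau> G_inv)
    finally have "?p n (lc \<tau> (unit_image n)) = id" .
    then have "lc \<tau> (unit_image n) = unit_image (?p n)"
      using permutes_inj[OF N1_permutes[OF conj_N1[OF \<tau>G n]]] by (metis inv_f_f)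
    then have "unit_image (?p n) x = \<tau> (unit_image n (inv_into UNIV \<tau> x))"
      using unit_image_N1(1)[OF n] \<tau>G by (metis comp_apply lambda_c_eq part_G'(1) \<tau>)
    then show ?thesis using E_D[OF x inv_G'[OF \<tau>]] by simp
  qed
  have bij: "bij_betw ?p N1 N1"
    unfolding bij_betw_def using N1_conj[OF \<tau>G] inj_conj_perm[OF bij_lambda_c[OF \<tau>G]]
    by (auto intro: inj_on_subset)
  have "\<tau> (hopf_act c x) = (\<Sum>n\<in>N1. Poly_Mapping.lookup c (?p n) * unit_image (?p n) x)"
    unfolding hopf_act_H1[OF c] G_sum[OF \<tau>G]
    by (rule sum.cong) (use c \<tau>G conj in \<open>auto simp: G_mult H1_iff\<close>)
  also have "\<dots> = hopf_act c x"
    unfolding hopf_act_H1[OF c]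
    by (rule sum.reindex_bij_betw[OF bij, of "\<lambda>n. Poly_Mapping.lookup c n * unit_image n x"])
  finally show "\<tau> (hopf_act c x) = hopf_act c x" .
qed

lemma hopf_act_F:
  assumes c: "c \<in> H2" and x: "x \<in> F"
  shows "hopf_act c x \<in> F"
  unfolding hopf_act_H2[OF c]
proof (rule F_closed(4))
  fix n assume "n \<in> N2"
  then show "Poly_Mapping.lookup c n * unit_image n x \<in> F"
    using c x F_closed(3) F_stable unit_image_G(2) by (simp add: H2_iff)
qed

lemma product_superset:
  assumes "Poly_Mapping.keys c \<subseteq> N1" "Poly_Mapping.keys d \<subseteq> N2"
  shows "product c d = (\<Sum>n\<in>N1. \<Sum>m\<in>N2.
    Poly_Mapping.single (io n m) (Poly_Mapping.lookup c n * Poly_Mapping.lookup d m))"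
  by (rule group_algebra_product_superset[OF finite_N1 assms(1) finite_N2 assms(2)])

lemma lookup_product:
  assumes "Poly_Mapping.keys c \<subseteq> N1" "Poly_Mapping.keys d \<subseteq> N2" and n: "n1 \<in> N1" "n2 \<in> N2"
  shows "Poly_Mapping.lookup (product c d) (io n1 n2) = Poly_Mapping.lookup c n1 * Poly_Mapping.lookup d n2"
proof -
  have "Poly_Mapping.lookup (product c d) (io n1 n2) = (\<Sum>n\<in>N1. \<Sum>m\<in>N2.
    if n = n1 then if m = n2 then Poly_Mapping.lookup c n * Poly_Mapping.lookup d m else 0 else 0)"
    unfolding product_superset[OF assms(1,2)] Poly_Mapping.lookup_sum Poly_Mapping.lookup_single when_def
    by (intro sum.cong refl) (use n iota_inj in auto)
  also have "\<dots> = (\<Sum>n\<in>N1. if n = n1 then Poly_Mapping.lookup c n * Poly_Mapping.lookup d n2 else 0)"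
    by (rule sum.cong) (use n finite_N2 in auto)
  also have "\<dots> = Poly_Mapping.lookup c n1 * Poly_Mapping.lookup d n2" using n finite_N1 by simp
  finally show ?thesis .
qed

lemma keys_product:
  assumes "Poly_Mapping.keys c \<subseteq> N1" "Poly_Mapping.keys d \<subseteq> N2"
  shows "Poly_Mapping.keys (product c d) \<subseteq> N"
proof
  fix k assume k: "k \<in> Poly_Mapping.keys (product c d)"
  show "k \<in> N"
  proof (rule ccontr)
    assume "k \<notin> N"
    then have "k \<noteq> io n m" if "n \<in> N1" "m \<in> N2" for n m using iota_in_N[OF that] by auto
    then have "Poly_Mapping.lookup (product c d) k = 0"
      unfolding product_superset[OF assms] Poly_Mapping.lookup_sum Poly_Mapping.lookup_single when_def
      by (intro sum.neutral ballI) auto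
    then show False using k by (simp add: Poly_Mapping.in_keys_iff)
  qed
qed

lemma product_in_H:
  assumes c: "c \<in> H1" and d: "d \<in> H2"
  shows "product c d \<in> H"
  unfolding H_iff
proof (intro conjI ballI)
  show "Poly_Mapping.keys (product c d) \<subseteq> N" using keys_product H1_keys[OF c] H2_keys[OF d] by blast
  fix g k assume g: "g \<in> G" and "k \<in> N"
  then obtain n m where k: "k = io n m" "n \<in> N1" "m \<in> N2" by auto
  note look = lookup_product[OF H1_keys[OF c] H2_keys[OF d]]
  let ?t = "G'_part J G' g"
  \<comment> \<open>The coefficients of d lie in \<open>F\<close>, where \<open>J\<close> acts
    trivially, so g acts on them as its \<open>G'\<close>-part does.\<close>
  have "Poly_Mapping.lookup d m \<in> F" using d by (simp add: H2_iff)
  then have "?t (Poly_Mapping.lookup d m) \<in> F" using F_stable G'_G parts(2)[OF g] by blast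
  then have "J_part J G' g (?t (Poly_Mapping.lookup d m)) = ?t (Poly_Mapping.lookup d m)"
    using F_D parts(1)[OF g] by blast
  then have "?t (Poly_Mapping.lookup d m) = g (Poly_Mapping.lookup d m)"
    using parts(3)[OF g] by (metis comp_apply)
  then show "Poly_Mapping.lookup (product c d) (conj_perm (left_regular G g) k) =
    g (Poly_Mapping.lookup (product c d) k)"
    using c d g k parts(2)[OF g]
    by (simp add: conj_perm_iota look conj_N1 conj_N2 G_mult H1_iff H2_iff)
qed

text \<open>The automorphism of \<open>io n m\<close> is that of m followed by that of n. The former
  lies in \<open>G'\<close> and fixes x; the latter lies in \<open>J\<close> and fixes the image of
  y, as \<open>F\<close> is stable under \<open>G\<close>.\<close>

lemma hopf_act_product:
  assumes c: "c \<in> H1" and d: "d \<in> H2" and x: "x \<in> E" and y: "y \<in> F"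
  shows "hopf_act (product c d) (x * y) = hopf_act c x * hopf_act d y"
proof -
  have "hopf_act (product c d) (x * y) = (\<Sum>n\<in>N1. \<Sum>m\<in>N2.
    (Poly_Mapping.lookup c n * unit_image n x) * (Poly_Mapping.lookup d m * unit_image m y))"
    unfolding product_superset[OF H1_keys[OF c] H2_keys[OF d]] hopf_act_sum_left hopf_act_single
  proof (intro sum.cong refl)
    fix n m assume n: "n \<in> N1" and m: "m \<in> N2"
    note u = unit_image_N1(1)[OF n] and v = unit_image_N2(1)[OF m]
    have "unit_image m x = x" using E_D[OF x v] .
    moreover have "unit_image n (unit_image m y) = unit_image m y"
      using F_D[OF F_stable[OF unit_image_G(2)[OF m] y] u] .
    ultimately have "unit_image (io n m) (x * y) = unit_image n x * unit_image m y"
      by (simp add: unit_image_iota n m G_mult unit_image_G)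
    then show "Poly_Mapping.lookup c n * Poly_Mapping.lookup d m * unit_image (io n m) (x * y) =
      (Poly_Mapping.lookup c n * unit_image n x) * (Poly_Mapping.lookup d m * unit_image m y)"
      by (simp add: mult_ac)
  qed
  then show ?thesis by (simp add: hopf_act_H1[OF c] hopf_act_H2[OF d] sum_product)
qed

text \<open>Serves both factors, with \<open>Y\<close> and \<open>U\<close> being \<open>J\<close>
  and \<open>G'\<close> in either order. A dual system with \<open>m i\<close> in the fixed field of
  \<open>U\<close>, transported by \<open>unit_image n0\<close>, isolates the coefficient at
  \<open>n0\<close>.\<close>

lemma hopf_faithful:
  assumes Y: "Y \<subseteq> G" "\<And>g h. \<lbrakk>g \<in> Y; h \<in> Y\<rbrakk> \<Longrightarrow> g \<circ> h \<in> Y" "\<And>g. g \<in> Y \<Longrightarrow> inv_into UNIV g \<in> Y"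
    and U: "U \<subseteq> G" and sep: "\<And>g. \<lbrakk>g \<in> Y; g \<noteq> id\<rbrakk> \<Longrightarrow> \<exists>x\<in>fixed_field U. g x \<noteq> x"
    and M: "finite M" "\<And>n. n \<in> M \<Longrightarrow> unit_image n \<in> Y" "inj_on unit_image M"
    and c: "Poly_Mapping.keys c \<subseteq> M"
    and zero: "\<And>x. x \<in> integral_closure R (fixed_field U) \<Longrightarrow> hopf_act c x = 0"
  shows "c = 0"
proof (rule poly_mapping_eqI)
  fix n0
  have YG: "g \<in> G" if "g \<in> Y" for g using Y(1) that by auto
  have finY: "finite Y" using Y(1) finite_G finite_subset by blast
  have one: "1 \<in> fixed_field U" using fixed_field_closed(1)[OF U K_one] .
  obtain r :: nat and l m where m: "\<And>i. i < r \<Longrightarrow> m i \<in> fixed_field U"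
    and d: "\<And>g. g \<in> Y \<Longrightarrow> (\<Sum>i<r. l i * g (m i)) = (if g = id then 1 else 0)"
  proof (rule ex_dual_system[OF finY one])
    show "x * y \<in> fixed_field U" if "x \<in> fixed_field U" "y \<in> fixed_field U" for x y
      using fixed_field_closed(3)[OF U that] .
    show "g 1 = 1" "g (x * y) = g x * g y" if "g \<in> Y" for g x y
      using YG[OF that] G_one G_mult by blast+
    show "\<exists>x\<in>fixed_field U. g x \<noteq> x" if "g \<in> Y" "g \<noteq> id" for g using sep[OF that] .
  qed blast
  \<comment> \<open>The hypothesis \<open>zero\<close> speaks of integers only, hence the scaling of
    the \<open>m i\<close>.\<close>
  obtain D where D: "D \<in> R" "D \<noteq> 0" "\<And>i. i < r \<Longrightarrow> D * m i \<in> OL"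
    using OL_common_denominator[of "m ` {..<r}"] by auto
  have act: "hopf_act c x = (\<Sum>n\<in>M. Poly_Mapping.lookup c n * unit_image n x)" for x
    by (rule hopf_act_superset[OF M(1) c])
  have zero_m: "hopf_act c (m i) = 0" if i: "i < r" for i
  proof -
    have "D * m i \<in> integral_closure R (fixed_field U)"
      using D(3)[OF i] m[OF i] fixed_field_closed(1,3)[OF U] R_subset_K[OF D(1)]
      by (simp add: integral_closure_iff[of _ _ "fixed_field U"])
    then have "hopf_act c (D * m i) = 0" by (rule zero)
    moreover have "hopf_act c (D * m i) = D * hopf_act c (m i)"
      unfolding act sum_distrib_left
      by (rule sum.cong) (use M(2) YG in \<open>auto simp: G_mult G_K R_subset_K[OF D(1)]\<close>)
    ultimately show ?thesis using D(2) by simp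
  qed
  show "Poly_Mapping.lookup c n0 = Poly_Mapping.lookup 0 n0"
  proof (cases "n0 \<in> M")
    case True
    define s where "s = unit_image n0"
    have s: "s \<in> Y" using M(2)[OF True] by (simp add: s_def)
    note sG = YG[OF s]
    have delta: "(\<Sum>i<r. s (l i) * unit_image n (m i)) = (if n = n0 then 1 else 0)" if n: "n \<in> M" for n
    proof -
      have "(\<Sum>i<r. s (l i) * unit_image n (m i)) = s (\<Sum>i<r. l i * (inv_into UNIV s \<circ> unit_image n) (m i))"
        by (simp add: G_sum G_mult sG G_inv)
      also have "\<dots> = (if inv_into UNIV s \<circ> unit_image n = id then 1 else 0)"
        using d[OF Y(2)[OF Y(3)[OF s] M(2)[OF n]]] sG by (simp add: G_one G_zero)
      also have "inv_into UNIV s \<circ> unit_image n = id \<longleftrightarrow> n = n0"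
      proof
        assume *: "inv_into UNIV s \<circ> unit_image n = id"
        have "unit_image n = s \<circ> (inv_into UNIV s \<circ> unit_image n)"
          using G_inv(3)[OF sG] by (simp flip: comp_assoc)
        then have "unit_image n = unit_image n0" using * by (simp add: s_def)
        then show "n = n0" using M(3) n True by (auto dest: inj_onD)
      qed (use G_inv(4)[OF sG] s_def in simp)
      finally show ?thesis .
    qed
    have "0 = (\<Sum>i<r. s (l i) * hopf_act c (m i))" using zero_m by simp
    also have "\<dots> = (\<Sum>i<r. \<Sum>n\<in>M. Poly_Mapping.lookup c n * (s (l i) * unit_image n (m i)))"
      by (simp add: act sum_distrib_left mult_ac)
    also have "\<dots> = (\<Sum>n\<in>M. Poly_Mapping.lookup c n * (\<Sum>i<r. s (l i) * unit_image n (m i)))"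
      by (subst sum.swap) (simp add: sum_distrib_left)
    also have "\<dots> = (\<Sum>n\<in>M. if n = n0 then Poly_Mapping.lookup c n else 0)"
      by (rule sum.cong) (auto simp: delta)
    also have "\<dots> = Poly_Mapping.lookup c n0" using True M(1) by simp
    finally show ?thesis by simp
  next
    case False
    then show ?thesis using c by (auto simp: Poly_Mapping.in_keys_iff)
  qed
qed

lemma H1_faithful: "\<lbrakk>c \<in> H1; \<And>x. x \<in> OE \<Longrightarrow> hopf_act c x = 0\<rbrakk> \<Longrightarrow> c = 0"
  by (rule hopf_faithful[OF J_subset comp_J inv_J G'_subset J_separated finite_N1 _ inj_unit_image(1)])
    (auto simp: unit_image_N1 dest: H1_keys)

lemma H2_faithful: "\<lbrakk>c \<in> H2; \<And>x. x \<in> OF \<Longrightarrow> hopf_act c x = 0\<rbrakk> \<Longrightarrow> c = 0"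
  by (rule hopf_faithful[OF G'_subset comp_G' inv_G' J_subset G'_separated finite_N2 _ inj_unit_image(2)])
    (auto simp: unit_image_N2 dest: H2_keys)

text \<open>
  Galois descent: with \<open>\<Sum>\<^sub>i g(l\<^sub>i) k(m\<^sub>i) = \<delta>\<^bsub>g,k\<^esub>\<close> and \<open>Tr t = 1\<close>, the coefficients \<open>a(n\<^sub>1, n\<^sub>2)\<close> of
  \<open>\<alpha>\<close> are \<open>\<Sum>\<^sub>i\<^sub>,\<^sub>p h\<^sub>i\<^sub>p(n\<^sub>1) c\<^sub>i\<^sub>p(n\<^sub>2)\<close>, where \<open>h\<^sub>i\<^sub>p = \<Sum>\<^sub>g g(l\<^sub>i) (g \<cdot> p)\<close> and
  \<open>c\<^sub>i\<^sub>p(n\<^sub>2) = \<Sum>\<^sub>k k(t m\<^sub>i) a(k \<cdot> p, n\<^sub>2)\<close>.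
\<close>

lemma H_descent:
  assumes \<alpha>: "\<alpha> \<in> H"
  obtains n :: nat and h c where "\<And>i p. h i p \<in> H1" "\<And>i p. p \<in> N1 \<Longrightarrow> c i p \<in> H2"
    and "\<alpha> = (\<Sum>i<n. \<Sum>p\<in>N1. product (h i p) (c i p))"
proof -
  obtain n :: nat and l m where
    dual: "\<And>g h. \<lbrakk>g \<in> G; h \<in> G\<rbrakk> \<Longrightarrow> (\<Sum>i<n. g (l i) * h (m i)) = (if g = h then 1 else 0)"
    by (rule ex_dual_system_G) blast
  obtain t where t: "Tr t = 1" by (rule ex_Tr_eq_one)
  define a where "a = (\<lambda>p q. Poly_Mapping.lookup \<alpha> (io p q))"
  let ?c = "\<lambda>g. conj_perm (lc g)"
  have conj_comp: "?c (g \<circ> h) p = ?c g (?c h p)" if "g \<in> G" "h \<in> G" for g h p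
    using that by (simp add: conj_perm_conj_perm bij_lambda_c lambda_c_comp)
  have conj_eq_iff: "?c g p = ?c g q \<longleftrightarrow> p = q" if "g \<in> G" for g p q
    using inj_conj_perm[OF bij_lambda_c[OF that]] by (auto dest: injD)
  have a_conj: "a (?c g p) (conj_perm (left_regular G' (G'_part J G' g)) q) = g (a p q)"
    if "g \<in> G" "p \<in> N1" "q \<in> N2" for g p q
  proof -
    have "Poly_Mapping.lookup \<alpha> (conj_perm (left_regular G g) (io p q)) = g (Poly_Mapping.lookup \<alpha> (io p q))"
      using \<alpha> iota_in_N[OF that(2,3)] that(1) by (simp only: H_iff)
    then show ?thesis by (simp add: a_def conj_perm_iota that)
  qed
  define h1 where "h1 = (\<lambda>i p q. \<Sum>g\<in>G. if ?c g p = q then g (l i) else 0)"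
  define c1 where "c1 = (\<lambda>i p q. \<Sum>k\<in>G. k (t * m i) * a (?c k p) q)"
  define h where "h = (\<lambda>i p. \<Sum>q\<in>N1. Poly_Mapping.single q (h1 i p q))"
  define c where "c = (\<lambda>i p. \<Sum>q\<in>N2. Poly_Mapping.single q (c1 i p q))"
  have lookup_h: "Poly_Mapping.lookup (h i p) q = (if q \<in> N1 then h1 i p q else 0)"
    and keys_h: "Poly_Mapping.keys (h i p) \<subseteq> N1" for i p q
    by (simp_all only: h_def lookup_sum_single[OF finite_N1] keys_sum_single[OF finite_N1])
  have lookup_c: "Poly_Mapping.lookup (c i p) q = (if q \<in> N2 then c1 i p q else 0)"
    and keys_c: "Poly_Mapping.keys (c i p) \<subseteq> N2" for i p q
    by (simp_all only: c_def lookup_sum_single[OF finite_N2] keys_sum_single[OF finite_N2])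
  have h1_conj: "h1 i p (?c g q) = g (h1 i p q)" if g: "g \<in> G" for i p q g
  proof -
    have "h1 i p (?c g q) = (\<Sum>k\<in>G. if ?c (g \<circ> k) p = ?c g q then (g \<circ> k) (l i) else 0)"
      unfolding h1_def by (rule sum_G_left[OF g, symmetric])
    also have "\<dots> = g (h1 i p q)"
      unfolding h1_def G_sum[OF g]
      by (rule sum.cong) (use g in \<open>auto simp: conj_comp conj_eq_iff G_zero\<close>)
    finally show ?thesis .
  qed
  have hH: "h i p \<in> H1" for i p
    unfolding H1_iff using keys_h by (auto simp: lookup_h h1_conj conj_N1)
  have c1_conj: "c1 i p (conj_perm (left_regular G' (G'_part J G' g)) q) = g (c1 i p q)"
    if g: "g \<in> G" and p: "p \<in> N1" and q: "q \<in> N2" for i p q g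
  proof -
    let ?q = "conj_perm (left_regular G' (G'_part J G' g)) q"
    have "c1 i p ?q = (\<Sum>k\<in>G. (g \<circ> k) (t * m i) * a (?c (g \<circ> k) p) ?q)"
      unfolding c1_def by (rule sum_G_left[OF g, symmetric])
    also have "\<dots> = g (c1 i p q)"
      unfolding c1_def G_sum[OF g]
    proof (rule sum.cong)
      fix k assume k: "k \<in> G"
      show "(g \<circ> k) (t * m i) * a (?c (g \<circ> k) p) ?q = g (k (t * m i) * a (?c k p) q)"
        using a_conj[OF g conj_N1[OF k p] q] by (simp add: conj_comp g k G_mult)
    qed simp
    finally show ?thesis .
  qed
  have cH: "c i p \<in> H2" if p: "p \<in> N1" for i p
    unfolding H2_iff
  proof (intro conjI allI ballI)
    show "Poly_Mapping.lookup (c i p) q \<in> F" for q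
    proof (cases "q \<in> N2")
      case True
      \<comment> \<open>Elements of \<open>J\<close> have trivial \<open>G'\<close>-part, so for
        them equivariance is invariance of the coefficient.\<close>
      have "c1 i p q \<in> F"
      proof (rule F_I)
        fix \<sigma> assume \<sigma>: "\<sigma> \<in> J"
        show "\<sigma> (c1 i p q) = c1 i p q"
          using c1_conj[OF J_G[OF \<sigma>] p True, of i] by (simp add: part_J \<sigma> left_regular_id conj_perm_id)
      qed
      then show ?thesis using True by (simp add: lookup_c)
    qed (simp add: lookup_c F_closed(1)[OF K_zero])
    show "Poly_Mapping.lookup (c i p) (conj_perm (left_regular G' \<tau>) q) = \<tau> (Poly_Mapping.lookup (c i p) q)"
      if "\<tau> \<in> G'" "q \<in> N2" for \<tau> q
      using c1_conj[OF G'_G[OF that(1)] p that(2), of i] that by (simp add: lookup_c conj_N2 part_G')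
  qed (use keys_c in auto)
  \<comment> \<open>Duality removes one of the two sums over \<open>G\<close>. For each remaining k
    exactly one p contributes, and the factors \<open>k t\<close> add up to
    \<open>Tr t = 1\<close>.\<close>
  have coeff: "(\<Sum>i<n. \<Sum>p\<in>N1. h1 i p q * c1 i p r) = a q r" if q: "q \<in> N1" for q r
  proof -
    have "(\<Sum>i<n. h1 i p q * c1 i p r) = (\<Sum>k\<in>G. if ?c k p = q then k t * a q r else 0)" for p
    proof -
      have "(\<Sum>i<n. h1 i p q * c1 i p r) = (\<Sum>i<n. \<Sum>g\<in>G. \<Sum>k\<in>G.
        (g (l i) * k (m i)) * (if ?c g p = q then k t * a (?c k p) r else 0))"
        unfolding h1_def c1_def sum_product
        by (intro sum.cong refl) (auto simp: G_mult mult_ac)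
      also have "\<dots> = (\<Sum>g\<in>G. \<Sum>k\<in>G. (\<Sum>i<n. g (l i) * k (m i)) *
        (if ?c g p = q then k t * a (?c k p) r else 0))"
        unfolding sum_distrib_right by (subst sum.swap, intro sum.cong refl, rule sum.swap)
      also have "\<dots> = (\<Sum>g\<in>G. \<Sum>k\<in>G. if g = k then if ?c g p = q then k t * a (?c k p) r else 0 else 0)"
        by (intro sum.cong refl) (auto simp: dual)
      also have "\<dots> = (\<Sum>g\<in>G. if ?c g p = q then g t * a q r else 0)"
        by (rule sum.cong) (auto simp: finite_G)
      finally show ?thesis .
    qed
    then have "(\<Sum>i<n. \<Sum>p\<in>N1. h1 i p q * c1 i p r) =
      (\<Sum>p\<in>N1. \<Sum>k\<in>G. if ?c k p = q then k t * a q r else 0)"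
      by (subst sum.swap) simp
    also have "\<dots> = (\<Sum>k\<in>G. \<Sum>p\<in>N1. if ?c k p = q then k t * a q r else 0)"
      by (rule sum.swap)
    also have "\<dots> = (\<Sum>k\<in>G. k t * a q r)"
    proof (rule sum.cong)
      fix k assume k: "k \<in> G"
      obtain p0 where p0: "p0 \<in> N1" "q = ?c k p0" using N1_conj[OF k] q by blast
      have "(\<Sum>p\<in>N1. if ?c k p = q then k t * a q r else 0) = (\<Sum>p\<in>N1. if p = p0 then k t * a q r else 0)"
        by (rule sum.cong) (simp_all add: p0(2) conj_eq_iff[OF k])
      then show "(\<Sum>p\<in>N1. if ?c k p = q then k t * a q r else 0) = k t * a q r"
        using p0(1) finite_N1 by simp
    qed simp
    also have "\<dots> = a q r" using t by (simp add: Tr_def flip: sum_distrib_right)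
    finally show ?thesis .
  qed
  have "\<alpha> = (\<Sum>i<n. \<Sum>p\<in>N1. product (h i p) (c i p))"
  proof (rule poly_mapping_eqI)
    fix k
    show "Poly_Mapping.lookup \<alpha> k = Poly_Mapping.lookup (\<Sum>i<n. \<Sum>p\<in>N1. product (h i p) (c i p)) k"
    proof (cases "k \<in> N")
      case True
      then obtain q r where k: "k = io q r" "q \<in> N1" "r \<in> N2" by auto
      have "Poly_Mapping.lookup (\<Sum>i<n. \<Sum>p\<in>N1. product (h i p) (c i p)) k = (\<Sum>i<n. \<Sum>p\<in>N1. h1 i p q * c1 i p r)"
        using k by (simp add: Poly_Mapping.lookup_sum lookup_product keys_h keys_c lookup_h lookup_c)
      then show ?thesis using coeff[OF k(2)] by (simp add: k a_def)
    next
      case False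
      then have "Poly_Mapping.lookup (product (h i p) (c i p)) k = 0" for i p
        using subsetD[OF keys_product[OF keys_h keys_c], of k i p i p]
        by (auto simp only: Poly_Mapping.in_keys_iff)
      moreover have "Poly_Mapping.lookup \<alpha> k = 0"
        using subsetD[OF H_keys[OF \<alpha>], of k] False by (auto simp only: Poly_Mapping.in_keys_iff)
      ultimately show ?thesis by (simp add: Poly_Mapping.lookup_sum)
    qed
  qed
  with hH cH show thesis by (rule that)
qed

end

subsection \<open>Associated orders\<close>

context hopf_galois
begin

lemma OE_D: "x \<in> OE \<Longrightarrow> x \<in> E" "x \<in> OE \<Longrightarrow> x \<in> OL" and OF_D: "x \<in> OF \<Longrightarrow> x \<in> F" "x \<in> OF \<Longrightarrow> x \<in> OL"
  by (simp_all add: OE_iff OF_iff)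

lemma ex_OE_basis: "\<exists>U e. lattice_basis (*) OE U e" and ex_OF_basis: "\<exists>V f. lattice_basis (*) OF V f"
  using OE_submodule OF_submodule OE_D OF_D by (auto intro!: ex_lattice_basis_OL)

text \<open>Values on \<open>OE\<close> stay in \<open>E\<close> by \<open>hopf_act_E\<close>, so
  only their integrality has to be tested.\<close>

lemma A1_iff: "a \<in> A1 \<longleftrightarrow> a \<in> H1 \<and> (\<forall>x\<in>OE. hopf_act a x \<in> OL)"
  using hopf_act_E by (auto simp: associated_order_def OE_iff)

lemma A2_iff: "a \<in> A2 \<longleftrightarrow> a \<in> H2 \<and> (\<forall>x\<in>OF. hopf_act a x \<in> OL)"
  using hopf_act_F by (auto simp: associated_order_def OF_iff)

lemma A1_D: "a \<in> A1 \<Longrightarrow> a \<in> H1" "\<lbrakk>a \<in> A1; x \<in> OE\<rbrakk> \<Longrightarrow> hopf_act a x \<in> OE"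
  and A2_D: "c \<in> A2 \<Longrightarrow> c \<in> H2" "\<lbrakk>c \<in> A2; y \<in> OF\<rbrakk> \<Longrightarrow> hopf_act c y \<in> OF"
  and A_D: "\<alpha> \<in> A \<Longrightarrow> \<alpha> \<in> H" "\<lbrakk>\<alpha> \<in> A; z \<in> OL\<rbrakk> \<Longrightarrow> hopf_act \<alpha> z \<in> OL"
  by (simp_all add: associated_order_def)

lemma A1_submodule: "submodule scalar_mult A1"
  unfolding submodule_def Ball_def A1_iff
  using H_zero(1) H_add(1) H_scale(1)[OF R_subset_K] R_subset_OL R_zero OL_add OL_mult
  by (simp add: hopf_act_zero_left hopf_act_add_left hopf_act_scalar_mult)

lemma A2_submodule: "submodule scalar_mult A2"
  unfolding submodule_def Ball_def A2_iff
  using H_zero(2) H_add(2) H_scale(2)[OF R_subset_K] R_subset_OL R_zero OL_add OL_mult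
  by (simp add: hopf_act_zero_left hopf_act_add_left hopf_act_scalar_mult)

lemma A_submodule: "submodule scalar_mult A"
  unfolding submodule_def associated_order_def
  using H_zero(3) H_add(3) H_scale(3)[OF R_subset_K] R_subset_OL R_zero OL_add OL_mult
  by (simp add: hopf_act_zero_left hopf_act_add_left hopf_act_scalar_mult)

text \<open>By faithfulness an element of \<open>A1\<close> is determined by its values on a basis
  of \<open>OE\<close>, and each value by finitely many traces in \<open>R\<close>.\<close>

lemma ex_A1_basis: "\<exists>B g. lattice_basis scalar_mult A1 B g"
proof -
  obtain U e where U: "lattice_basis (*) OE U e" using ex_OE_basis by blast
  note U' = lattice_basisD[OF U]
  obtain n :: nat and l where l: "\<And>i. i < n \<Longrightarrow> l i \<in> OL"
    "\<And>x. (\<And>i. i < n \<Longrightarrow> Tr (x * l i) = 0) \<Longrightarrow> x = 0" by (rule OL_functionals) blast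
  let ?f = "\<lambda>(u, i) a. Tr (hopf_act a u * l i)"
  show ?thesis
  proof (rule ex_lattice_basis[OF module_scalar_mult, where I = "U \<times> {..<n}" and f = ?f])
    show "finite (U \<times> {..<n})" using U'(1) by simp
    show "submodule scalar_mult A1" by (rule A1_submodule)
    show "K_linear scalar_mult (?f i)" for i
      by (rule K_linearI)
        (auto simp: case_prod_unfold hopf_act_add_left hopf_act_scalar_mult distrib_right Tr_add
          Tr_mult_K mult.assoc)
    show "?f i a \<in> R" if i: "i \<in> U \<times> {..<n}" and a: "a \<in> A1" for i a
    proof -
      have "fst i \<in> OE" "snd i < n" using i U'(2) by auto
      then have "Tr (hopf_act a (fst i) * l (snd i)) \<in> R"
        using OE_D(2)[OF A1_D(2)[OF a]] l(1) by (intro Tr_OL OL_mult) auto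
      then show ?thesis by (simp add: case_prod_unfold)
    qed
    show "a = 0" if a: "a \<in> A1" and 0: "\<And>i. i \<in> U \<times> {..<n} \<Longrightarrow> ?f i a = 0" for a
    proof (rule H1_faithful[OF A1_D(1)[OF a]])
      have u: "hopf_act a u = 0" if "u \<in> U" for u
        by (rule l(2)) (use 0[of "(u, _)"] that in auto)
      fix x assume x: "x \<in> OE"
      have "hopf_act a x = hopf_act a (\<Sum>u\<in>U. e u x * u)" using U'(6)[OF x] by simp
      also have "\<dots> = 0"
        using a u R_subset_K[OF U'(5)[OF x]] by (simp add: hopf_act_right_sum A1_D(1) hopf_act_right(2))
      finally show "hopf_act a x = 0" .
    qed
  qed
qed

text \<open>By linearity over \<open>K\<close> it suffices to clear the denominators of the values
  at a finite basis of \<open>OE\<close>. Hence \<open>A1\<close> spans \<open>H1\<close> over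
  \<open>K\<close>.\<close>

lemma A1_multiple:
  assumes h: "h \<in> H1"
  shows "\<exists>d. d \<in> R \<and> d \<noteq> 0 \<and> scalar_mult d h \<in> A1"
proof -
  obtain U e where U: "lattice_basis (*) OE U e" using ex_OE_basis by blast
  note U' = lattice_basisD[OF U]
  obtain d where d: "d \<in> R" "d \<noteq> 0" "\<And>u. u \<in> U \<Longrightarrow> d * hopf_act h u \<in> OL"
    using OL_common_denominator[of "hopf_act h ` U"] U'(1) by auto
  have "hopf_act (scalar_mult d h) x \<in> OL" if x: "x \<in> OE" for x
  proof -
    have "hopf_act h x = hopf_act h (\<Sum>u\<in>U. e u x * u)" using U'(6)[OF x] by simp
    also have "\<dots> = (\<Sum>u\<in>U. e u x * hopf_act h u)"
      using h R_subset_K[OF U'(5)[OF x]] by (simp add: hopf_act_right_sum hopf_act_right(2))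
    finally have "hopf_act (scalar_mult d h) x = (\<Sum>u\<in>U. e u x * (d * hopf_act h u))"
      by (simp add: hopf_act_scalar_mult sum_distrib_left mult_ac)
    also have "\<dots> \<in> OL"
      by (intro OL_sum OL_mult[OF R_subset_OL[OF U'(5)[OF x]] d(3)])
    finally show ?thesis .
  qed
  then show ?thesis using d H_scale(1)[OF R_subset_K[OF d(1)] h] by (auto simp: A1_iff)
qed

context
  fixes B :: "((('a \<Rightarrow> 'a) \<Rightarrow> ('a \<Rightarrow> 'a)) \<Rightarrow>\<^sub>0 'a) set" and g and V :: "'a set" and f
  assumes B: "lattice_basis scalar_mult A1 B g" and V: "lattice_basis (*) OF V f"
begin

lemmas basis = lattice_basisD[OF B]
lemmas OF_basis = lattice_basisD[OF V]

lemma basis_A1: "b \<in> B \<Longrightarrow> b \<in> A1" and basis_H1: "b \<in> B \<Longrightarrow> b \<in> H1"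
  using basis(2) A1_D(1) by auto

lemma H1_expand:
  assumes "h \<in> H1"
  shows "h = (\<Sum>b\<in>B. scalar_mult (g b h) b)" and "b \<in> B \<Longrightarrow> g b h \<in> K"
proof -
  obtain d where d: "d \<in> R" "d \<noteq> 0" "scalar_mult d h \<in> A1" using A1_multiple[OF assms] by blast
  show "h = (\<Sum>b\<in>B. scalar_mult (g b h) b)" and "b \<in> B \<Longrightarrow> g b h \<in> K"
    by (rule lattice_basis_span[OF module_scalar_mult B d]; assumption)+
qed

lemma F_expand:
  assumes "y \<in> F"
  shows "y = (\<Sum>v\<in>V. f v y * v)" and "v \<in> V \<Longrightarrow> f v y \<in> K"
proof -
  obtain d where d: "d \<in> R" "d \<noteq> 0" "d * y \<in> OL" using ex_OL_multiple by blast
  then have dy: "d * y \<in> OF" using assms F_closed(1,3) R_subset_K by (simp add: OF_iff)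
  show "y = (\<Sum>v\<in>V. f v y * v)" and "v \<in> V \<Longrightarrow> f v y \<in> K"
    by (rule lattice_basis_span[OF module_times V d(1,2) dy]; assumption)+
qed

text \<open>In each term of the descent formula the left factor is expanded in the basis, and its
  coordinates, lying in \<open>K\<close>, pass to the right factor.\<close>

lemma H_expand:
  assumes "\<alpha> \<in> H"
  shows "\<exists>c. (\<forall>b\<in>B. c b \<in> H2) \<and> \<alpha> = (\<Sum>b\<in>B. product b (c b))"
proof -
  obtain n :: nat and h c where h: "\<And>i p. h i p \<in> H1" and c: "\<And>i p. p \<in> N1 \<Longrightarrow> c i p \<in> H2"
    and \<alpha>: "\<alpha> = (\<Sum>i<n. \<Sum>p\<in>N1. product (h i p) (c i p))"
    by (rule H_descent[OF assms]) blast
  define c' where "c' = (\<lambda>b. \<Sum>i<n. \<Sum>p\<in>N1. scalar_mult (g b (h i p)) (c i p))"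
  have prod: "product (h i p) (c i p) = (\<Sum>b\<in>B. product b (scalar_mult (g b (h i p)) (c i p)))" for i p
    using arg_cong[OF H1_expand(1)[OF h[of i p]], of "\<lambda>h. product h (c i p)"]
    by (simp add: group_algebra_product_sum group_algebra_product_scalar_mult)
  have "\<alpha> = (\<Sum>i<n. \<Sum>b\<in>B. \<Sum>p\<in>N1. product b (scalar_mult (g b (h i p)) (c i p)))"
    unfolding \<alpha> prod by (intro sum.cong refl sum.swap)
  also have "\<dots> = (\<Sum>b\<in>B. product b (c' b))"
    by (subst sum.swap) (simp add: c'_def group_algebra_product_sum)
  finally have "\<alpha> = (\<Sum>b\<in>B. product b (c' b))" .
  moreover have "c' b \<in> H2" if "b \<in> B" for b
    unfolding c'_def using H1_expand(2)[OF h that] c by (intro H_sum H_scale) auto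
  ultimately show ?thesis by blast
qed

lemma hopf_act_sum_product:
  assumes "\<And>b. b \<in> B \<Longrightarrow> c b \<in> H2" "x \<in> E" "y \<in> F"
  shows "hopf_act (\<Sum>b\<in>B. product b (c b)) (x * y) = (\<Sum>b\<in>B. hopf_act b x * hopf_act (c b) y)"
    and "(\<Sum>b\<in>B. hopf_act b x * hopf_act (c b) y) =
      (\<Sum>v\<in>V. hopf_act (\<Sum>b\<in>B. scalar_mult (f v (hopf_act (c b) y)) b) x * v)"
proof -
  show "hopf_act (\<Sum>b\<in>B. product b (c b)) (x * y) = (\<Sum>b\<in>B. hopf_act b x * hopf_act (c b) y)"
    unfolding hopf_act_sum_left
    by (rule sum.cong) (use assms basis_H1 in \<open>auto simp: hopf_act_product\<close>)
  have "(\<Sum>b\<in>B. hopf_act b x * hopf_act (c b) y) =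
    (\<Sum>b\<in>B. \<Sum>v\<in>V. hopf_act b x * (f v (hopf_act (c b) y) * v))"
    unfolding sum_distrib_left[symmetric]
    by (rule sum.cong) (use F_expand(1)[OF hopf_act_F] assms in auto)
  also have "\<dots> = (\<Sum>v\<in>V. hopf_act (\<Sum>b\<in>B. scalar_mult (f v (hopf_act (c b) y)) b) x * v)"
    by (subst sum.swap)
      (simp add: hopf_act_sum_left hopf_act_scalar_mult sum_distrib_left sum_distrib_right mult_ac)
  finally show "(\<Sum>b\<in>B. hopf_act b x * hopf_act (c b) y) =
      (\<Sum>v\<in>V. hopf_act (\<Sum>b\<in>B. scalar_mult (f v (hopf_act (c b) y)) b) x * v)" .
qed

text \<open>The test set \<open>Y\<close> is left open: it is \<open>OE\<close> for the tensor
  decomposition and the single point \<open>\<gamma>\<close> for freeness. Independence of the v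
  over \<open>E\<close> makes each \<open>a v\<close> vanish on \<open>Y\<close>, hence be zero; its
  coordinates in \<open>B\<close> are the v-coordinates of the values
  \<open>hopf_act (c b) y\<close>.\<close>

lemma sum_product_zero:
  assumes c: "\<And>b. b \<in> B \<Longrightarrow> c b \<in> A2" and Y: "Y \<subseteq> OE" and y: "y \<in> OF"
    and sep: "\<And>a. \<lbrakk>a \<in> A1; \<And>x. x \<in> Y \<Longrightarrow> hopf_act a x = 0\<rbrakk> \<Longrightarrow> a = 0"
    and zero: "\<And>x. x \<in> Y \<Longrightarrow> hopf_act (\<Sum>b\<in>B. product b (c b)) (x * y) = 0"
    and b: "b \<in> B"
  shows "hopf_act (c b) y = 0"
proof -
  note cH = A2_D(1)[OF c] and yF = OF_D(1)[OF y]
  have cy: "hopf_act (c b) y \<in> OF" if "b \<in> B" for b using A2_D(2)[OF c[OF that] y] .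
  define a where "a = (\<lambda>v. \<Sum>b\<in>B. scalar_mult (f v (hopf_act (c b) y)) b)"
  have aA: "a v \<in> A1" if v: "v \<in> V" for v
    unfolding a_def using OF_basis(5)[OF cy v] basis_A1
    by (intro submodule_sum[OF A1_submodule] submodule_scale[OF A1_submodule]) auto
  have "a v = 0" if v: "v \<in> V" for v
  proof (rule sep[OF aA[OF v]])
    fix x assume x: "x \<in> Y"
    then have xE: "x \<in> OE" using Y by blast
    show "hopf_act (a v) x = 0"
    proof (rule E_independent[OF V _ _ v])
      show "hopf_act (a v) x \<in> E" if "v \<in> V" for v using OE_D(1)[OF A1_D(2)[OF aA[OF that] xE]] .
      show "(\<Sum>v\<in>V. hopf_act (a v) x * v) = 0"
        using zero[OF x] hopf_act_sum_product[OF cH OE_D(1)[OF xE] yF] by (simp add: a_def)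
    qed
  qed
  then have "f v (hopf_act (c b) y) = 0" if v: "v \<in> V" for v
    using lattice_basis_coord[OF B, of "\<lambda>b. f v (hopf_act (c b) y)" b] b v
      F_expand(2)[OF hopf_act_F[OF cH yF]] K_linear_zero[OF basis(3)[OF b]] by (simp add: a_def)
  then show ?thesis using F_expand(1)[OF hopf_act_F[OF cH[OF b] yF]] by simp
qed

end

end

text \<open>Arithmetic disjointness enters here, as generation of \<open>OL\<close> by products of
  integers of \<open>E\<close> and \<open>F\<close>.\<close>

locale arithmetically_disjoint_hopf_galois = hopf_galois +
  assumes OL_tensor: "z \<in> OL \<Longrightarrow> \<exists>w\<in>free_module R (OE \<times> OF). z = linear_extension (*) (*) w"
begin

text \<open>The scalars of a tensor are absorbed into its left factor, so additivity reduces claims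
  about \<open>OL\<close> to single products.\<close>

lemma OL_induct [consumes 1]:
  assumes "z \<in> OL" and "P 0" and "\<And>x y. \<lbrakk>P x; P y\<rbrakk> \<Longrightarrow> P (x + y)"
    and "\<And>x y. \<lbrakk>x \<in> OE; y \<in> OF\<rbrakk> \<Longrightarrow> P (x * y)"
  shows "P z"
proof -
  obtain w where w: "w \<in> free_module R (OE \<times> OF)" "z = linear_extension (*) (*) w"
    using OL_tensor[OF assms(1)] by blast
  have sum: "P (sum h I)" if "\<And>i. i \<in> I \<Longrightarrow> P (h i)" for h :: "'a \<times> 'a \<Rightarrow> 'a" and I
    using that by (induction I rule: infinite_finite_induct) (auto intro: assms(2,3))
  show ?thesis
    unfolding w(2) linear_extension_def
  proof (rule sum, clarify)
    fix x y assume p: "(x, y) \<in> Poly_Mapping.keys w"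
    then have "x \<in> OE" "y \<in> OF" "Poly_Mapping.lookup w (x, y) \<in> R"
      using w(1) by (auto simp: free_module_def)
    then have "P ((Poly_Mapping.lookup w (x, y) * x) * y)"
      using assms(4) submodule_scale[OF OE_submodule] by simp
    then show "P (Poly_Mapping.lookup w (x, y) * (x * y))" by (simp add: mult.assoc)
  qed
qed

lemma OL_expand:
  assumes V: "lattice_basis (*) OF V f" and "z \<in> OL"
  shows "\<exists>e. (\<forall>v\<in>V. e v \<in> OE) \<and> z = (\<Sum>v\<in>V. e v * v)"
  using assms(2)
proof (induction rule: OL_induct)
  case 1
  show ?case by (rule exI[of _ "\<lambda>_. 0"]) (simp add: submodule_zero[OF OE_submodule])
next
  case (2 x y)
  then obtain d e where "\<forall>v\<in>V. d v \<in> OE" "x = (\<Sum>v\<in>V. d v * v)" "\<forall>v\<in>V. e v \<in> OE" "y = (\<Sum>v\<in>V. e v * v)"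
    by blast
  then show ?case
    by (intro exI[of _ "\<lambda>v. d v + e v"])
      (simp add: submodule_add[OF OE_submodule] distrib_right sum.distrib)
next
  case (3 x y)
  note V' = lattice_basisD[OF V]
  have "x * y = (\<Sum>v\<in>V. (f v y * x) * v)"
    using arg_cong[OF V'(6)[OF 3(2)], of "\<lambda>y. x * y"] by (simp add: sum_distrib_left mult_ac)
  then show ?case
    using submodule_scale[OF OE_submodule V'(5)[OF 3(2)] 3(1)]
    by (intro exI[of _ "\<lambda>v. f v y * x"]) simp
qed

lemma product_in_A:
  assumes a: "a \<in> A1" and c: "c \<in> A2"
  shows "product a c \<in> A"
  unfolding associated_order_def
proof (intro CollectI conjI ballI)
  show H: "product a c \<in> H" using product_in_H A1_D(1) A2_D(1) a c by blast
  fix z assume "z \<in> OL"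
  then show "hopf_act (product a c) z \<in> OL"
  proof (induction rule: OL_induct)
    case (3 x y)
    then show ?case
      using hopf_act_product[OF A1_D(1)[OF a] A2_D(1)[OF c] OE_D(1) OF_D(1)]
        OE_D(2)[OF A1_D(2)[OF a]] OF_D(2)[OF A2_D(2)[OF c]] by (simp add: OL_mult)
  qed (use H in \<open>auto simp: hopf_act_right R_subset_OL R_zero OL_add\<close>)
qed

context
  fixes B :: "((('a \<Rightarrow> 'a) \<Rightarrow> ('a \<Rightarrow> 'a)) \<Rightarrow>\<^sub>0 'a) set" and g and V :: "'a set" and f
  assumes B: "lattice_basis scalar_mult A1 B g" and V: "lattice_basis (*) OF V f"
begin

lemma A_coordinates:
  assumes c: "\<And>b. b \<in> B \<Longrightarrow> c b \<in> H2" and A: "(\<Sum>b\<in>B. product b (c b)) \<in> A" and b: "b \<in> B"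
  shows "c b \<in> A2"
  unfolding A2_iff
proof (intro conjI ballI)
  show "c b \<in> H2" using c b .
  fix y assume y: "y \<in> OF"
  note yF = OF_D(1)[OF y]
  define a where "a = (\<lambda>v. \<Sum>b\<in>B. scalar_mult (f v (hopf_act (c b) y)) b)"
  have kK: "f v (hopf_act (c b) y) \<in> K" if "v \<in> V" "b \<in> B" for v b
    using F_expand(2)[OF B V hopf_act_F[OF c[OF that(2)] yF] that(1)] .
  have aH: "a v \<in> H1" if v: "v \<in> V" for v
    unfolding a_def using kK[OF v] basis_H1[OF B V] by (intro H_sum H_scale) auto
  have aA: "a v \<in> A1" if v: "v \<in> V" for v
    unfolding A1_iff
  proof (intro conjI ballI)
    show "a v \<in> H1" by (rule aH[OF v])
    fix x assume x: "x \<in> OE"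
    have "hopf_act (\<Sum>b\<in>B. product b (c b)) (x * y) \<in> OL"
      using A_D(2)[OF A] OL_mult[OF OE_D(2)[OF x] OF_D(2)[OF y]] by blast
    then have "(\<Sum>v\<in>V. hopf_act (a v) x * v) \<in> OL"
      using hopf_act_sum_product[OF B V c OE_D(1)[OF x] yF] by (simp add: a_def)
    then obtain e where e: "\<forall>v\<in>V. e v \<in> OE" "(\<Sum>v\<in>V. hopf_act (a v) x * v) = (\<Sum>v\<in>V. e v * v)"
      using OL_expand[OF V] by blast
    \<comment> \<open>Both sides of \<open>e(2)\<close> are expansions over \<open>E\<close> in the
      same basis of \<open>OF\<close>, so their coefficients agree. The sign is written as a factor
      to use closure of \<open>E\<close> under sums and products.\<close>
    have "hopf_act (a v) x + (- 1) * e v = 0"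
    proof (rule E_independent[OF V _ _ v])
      show "hopf_act (a v) x + (- 1) * e v \<in> E" if "v \<in> V" for v
        using hopf_act_E[OF aH[OF that] OE_D(1)[OF x]] OE_D(1) e(1) that
          E_closed(1)[OF K_uminus[OF K_one]] by (intro E_closed(2,3)) auto
      show "(\<Sum>v\<in>V. (hopf_act (a v) x + (- 1) * e v) * v) = 0"
        using e(2) by (simp add: distrib_right sum.distrib sum_negf left_diff_distrib sum_subtractf)
    qed
    then show "hopf_act (a v) x \<in> OL" using e(1) v OE_D(2) by simp
  qed
  \<comment> \<open>These elements of \<open>K\<close> are the coordinates of \<open>a v\<close>,
    which belongs to \<open>A1\<close>; so they lie in \<open>R\<close>.\<close>
  have "f v (hopf_act (c b) y) \<in> R" if v: "v \<in> V" for v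
    using lattice_basis_coord[OF B kK[OF v] b] lattice_basisD(5)[OF B aA[OF v] b]
    by (simp add: a_def)
  moreover have "v \<in> OL" if "v \<in> V" for v using lattice_basisD(2)[OF V] OF_D(2) that by blast
  ultimately have "(\<Sum>v\<in>V. f v (hopf_act (c b) y) * v) \<in> OL"
    using R_subset_OL by (intro OL_sum OL_mult) auto
  then show "hopf_act (c b) y \<in> OL"
    using F_expand(1)[OF B V hopf_act_F[OF c[OF b] yF]] by simp
qed

lemma A_expand:
  assumes "\<alpha> \<in> A"
  shows "\<exists>c. (\<forall>b\<in>B. c b \<in> A2) \<and> \<alpha> = (\<Sum>b\<in>B. product b (c b))"
proof -
  obtain c where c: "\<forall>b\<in>B. c b \<in> H2" "\<alpha> = (\<Sum>b\<in>B. product b (c b))"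
    using H_expand[OF B V A_D(1)[OF assms]] by blast
  then have "c b \<in> A2" if "b \<in> B" for b using A_coordinates[of c] assms that by blast
  then show ?thesis using c(2) by blast
qed

theorem tensor_associated_orders:
  "bij_betw (tensor_map scalar_mult product) (tensor_product R scalar_mult A1 scalar_mult A2) A"
proof (rule bij_betw_tensor_map[OF module_scalar_mult module_scalar_mult A1_submodule A2_submodule B
      module_scalar_mult])
  show "bilinear_on scalar_mult R product scalar_mult A1 scalar_mult A2"
    unfolding bilinear_on_def[OF module_scalar_mult]
    by (simp add: group_algebra_product_add_left group_algebra_product_add_right
        group_algebra_product_scalar_mult)
  show "(\<Sum>b\<in>B. product b (y b)) \<in> A" if "\<And>b. b \<in> B \<Longrightarrow> y b \<in> A2" for y
    using product_in_A basis_A1[OF B V] that by (intro submodule_sum[OF A_submodule]) auto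
  show "y b = 0" if y: "\<And>b. b \<in> B \<Longrightarrow> y b \<in> A2" and 0: "(\<Sum>b\<in>B. product b (y b)) = 0" and b: "b \<in> B" for y b
  proof (rule H2_faithful[OF A2_D(1)[OF y[OF b]]])
    fix x assume x: "x \<in> OF"
    show "hopf_act (y b) x = 0"
      \<comment> \<open>On all of \<open>OE\<close> the separation property is the faithfulness of
        \<open>H1\<close>.\<close>
      by (rule sum_product_zero[OF B V y subset_refl x _ _ b])
        (auto simp: 0 hopf_act_zero_left intro: H1_faithful A1_D(1))
  qed
qed (use A_expand in blast)

theorem free_generator_product:
  assumes \<gamma>: "free_generator A1 OE \<gamma>" and \<delta>: "free_generator A2 OF \<delta>"
  shows "free_generator A OL (\<gamma> * \<delta>)"
proof -
  have \<gamma>O: "\<gamma> \<in> OE" and \<delta>O: "\<delta> \<in> OF" using \<gamma> \<delta> by (auto simp: free_generator_def)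
  have inj1: "inj_on (\<lambda>a. hopf_act a \<gamma>) A1" and surj1: "(\<lambda>a. hopf_act a \<gamma>) ` A1 = OE"
    using \<gamma> by (auto simp: free_generator_def bij_betw_def)
  have inj2: "inj_on (\<lambda>a. hopf_act a \<delta>) A2" and surj2: "(\<lambda>a. hopf_act a \<delta>) ` A2 = OF"
    using \<delta> by (auto simp: free_generator_def bij_betw_def)
  have OL: "\<gamma> * \<delta> \<in> OL" using OL_mult OE_D(2)[OF \<gamma>O] OF_D(2)[OF \<delta>O] .
  have zero: "\<alpha> = 0" if \<alpha>: "\<alpha> \<in> A" and 0: "hopf_act \<alpha> (\<gamma> * \<delta>) = 0" for \<alpha>
  proof -
    obtain c where c: "\<And>b. b \<in> B \<Longrightarrow> c b \<in> A2" "\<alpha> = (\<Sum>b\<in>B. product b (c b))"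
      using A_expand[OF \<alpha>] by blast
    have "c b = 0" if b: "b \<in> B" for b
    proof (rule inj_onD[OF inj2])
      have "hopf_act (c b) \<delta> = 0"
      \<comment> \<open>Freeness says that an element of \<open>A1\<close> is determined by its
        value at \<open>\<gamma>\<close>, so this one point is a sufficient test set.\<close>
      proof (rule sum_product_zero[OF B V c(1) _ \<delta>O _ _ b, where Y = "{\<gamma>}"])
        show "a = 0" if "a \<in> A1" "\<And>x. x \<in> {\<gamma>} \<Longrightarrow> hopf_act a x = 0" for a
          using inj_onD[OF inj1 _ that(1) submodule_zero[OF A1_submodule]] that(2)
          by (simp add: hopf_act_zero_left)
      qed (use \<gamma>O 0 c(2) in auto)
      then show "hopf_act (c b) \<delta> = hopf_act 0 \<delta>" by (simp add: hopf_act_zero_left)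
    qed (use c b submodule_zero[OF A2_submodule] in auto)
    then show ?thesis using c(2) by (simp add: group_algebra_product_zero)
  qed
  have "inj_on (\<lambda>a. hopf_act a (\<gamma> * \<delta>)) A"
  proof (rule inj_onI)
    fix \<alpha> \<beta> assume "\<alpha> \<in> A" "\<beta> \<in> A" "hopf_act \<alpha> (\<gamma> * \<delta>) = hopf_act \<beta> (\<gamma> * \<delta>)"
    then have "\<alpha> - \<beta> = 0"
      by (intro zero submodule_diff[OF module_scalar_mult A_submodule]) (simp_all add: hopf_act_diff_left)
    then show "\<alpha> = \<beta>" by simp
  qed
  moreover have "(\<lambda>a. hopf_act a (\<gamma> * \<delta>)) ` A = OL"
  proof
    show "(\<lambda>a. hopf_act a (\<gamma> * \<delta>)) ` A \<subseteq> OL" using A_D(2) OL by blast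
    show "OL \<subseteq> (\<lambda>a. hopf_act a (\<gamma> * \<delta>)) ` A"
    proof
      fix z assume "z \<in> OL"
      then have "\<exists>\<alpha>\<in>A. hopf_act \<alpha> (\<gamma> * \<delta>) = z"
      proof (induction rule: OL_induct)
        case 1
        show ?case by (rule bexI[OF _ submodule_zero[OF A_submodule]]) (rule hopf_act_zero_left)
      next
        case (2 x y)
        then obtain \<alpha> \<beta> where *: "\<alpha> \<in> A" "\<beta> \<in> A" "hopf_act \<alpha> (\<gamma> * \<delta>) = x" "hopf_act \<beta> (\<gamma> * \<delta>) = y"
          by blast
        then show ?case
          by (intro bexI[OF _ submodule_add[OF A_submodule *(1,2)]]) (simp add: hopf_act_add_left)
      next
        \<comment> \<open>Writing x and y as values at \<open>\<gamma>\<close> and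
          \<open>\<delta>\<close> makes their product the value of a pure tensor at
          \<open>\<gamma> * \<delta>\<close>.\<close>
        case (3 x y)
        then obtain a c where a: "a \<in> A1" "x = hopf_act a \<gamma>" and c: "c \<in> A2" "y = hopf_act c \<delta>"
          using surj1 surj2 by blast
        then have "hopf_act (product a c) (\<gamma> * \<delta>) = x * y"
          using hopf_act_product[OF A1_D(1) A2_D(1) OE_D(1)[OF \<gamma>O] OF_D(1)[OF \<delta>O]] by simp
        then show ?case by (rule bexI[OF _ product_in_A[OF a(1) c(1)]])
      qed
      then show "z \<in> (\<lambda>a. hopf_act a (\<gamma> * \<delta>)) ` A" by blast
    qed
  qed
  ultimately show ?thesis using OL by (simp add: free_generator_def bij_betw_def)
qed

end

end

subsection \<open>Galois groups of a field\<close>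

text \<open>Negation in the record is derived from its additive monoid, so it is matched with that
  of the type by uniqueness of inverses. The carrier is variable, to cover the whole field as well
  as the subring.\<close>

lemma uminus_ring_of_type_algebra:
  fixes x :: "'a::field"
  assumes "ring ((ring_of_type_algebra :: 'a ring)\<lparr>carrier := R\<rparr>)" "x \<in> R" "- x \<in> R"
  shows "\<ominus>\<^bsub>ring_of_type_algebra\<lparr>carrier := R\<rparr>\<^esub> x = - x"
proof -
  interpret ring "(ring_of_type_algebra :: 'a ring)\<lparr>carrier := R\<rparr>" by (rule assms(1))
  show ?thesis
    by (rule minus_equality) (use assms in \<open>auto simp: ring_of_type_algebra_def\<close>)
qed

lemma pid_subring_principal_domain:
  fixes R :: "'a::field set"
  assumes R: "subring R ring_of_type_algebra"
    and pid: "principal_domain (ring_of_type_algebra \<lparr>carrier := R\<rparr>)"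
  shows "pid_subring R"
proof -
  let ?L = "ring_of_type_algebra :: 'a ring"
  let ?S = "?L\<lparr>carrier := R\<rparr>"
  interpret principal_domain ?S by (rule pid)
  have "ring ?L" by (rule ring_from_type_algebra)
  then have "\<ominus>\<^bsub>?L\<^esub> x = - x" for x
    using uminus_ring_of_type_algebra[of UNIV x] by (simp add: ring_of_type_algebra_def)
  note closed = subringE[OF R, unfolded this] and sel = ring_of_type_algebra_def
  have zero: "0 \<in> R" and one: "1 \<in> R"
    and add: "\<And>x y. \<lbrakk>x \<in> R; y \<in> R\<rbrakk> \<Longrightarrow> x + y \<in> R" and mult: "\<And>x y. \<lbrakk>x \<in> R; y \<in> R\<rbrakk> \<Longrightarrow> x * y \<in> R"
    and uminus: "\<And>x. x \<in> R \<Longrightarrow> - x \<in> R"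
    using closed by (simp_all add: sel)
  show ?thesis
  proof
    fix I :: "'a set"
    assume I: "I \<subseteq> R" "0 \<in> I" "\<And>x y. \<lbrakk>x \<in> I; y \<in> I\<rbrakk> \<Longrightarrow> x + y \<in> I"
      "\<And>r x. \<lbrakk>r \<in> R; x \<in> I\<rbrakk> \<Longrightarrow> r * x \<in> I"
    have neg: "- x \<in> I" if "x \<in> I" for x using I(4)[OF uminus[OF one] that] by simp
    have I_right: "x * r \<in> I" if "r \<in> R" "x \<in> I" for r x
      using I(4)[OF that] by (simp only: Groups.mult_ac(2))
    have "ideal I ?S"
    proof (rule idealI)
      show "ring ?S" by (rule ring_axioms)
      show "subgroup I (add_monoid ?S)"
      proof (rule group.subgroupI[OF a_group])
        fix x assume x: "x \<in> I"
        have "inv\<^bsub>add_monoid ?S\<^esub> x = - x"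
          using uminus_ring_of_type_algebra[OF ring_axioms, of x] x I(1) uminus by (auto simp: a_inv_def)
        then show "inv\<^bsub>add_monoid ?S\<^esub> x \<in> I" using neg[OF x] by simp
      qed (use I in \<open>auto simp: sel\<close>)
    qed (use I I_right in \<open>auto simp: sel\<close>)
    then obtain d where d: "d \<in> R" "I = PIdl\<^bsub>?S\<^esub> d" using exists_gen by (auto simp: sel)
    then have "I = {r * d | r. r \<in> R}" by (simp add: cgenideal_def sel)
    moreover have "d = 1 * d" by simp
    ultimately show "\<exists>d\<in>I. \<forall>x\<in>I. \<exists>r\<in>R. x = r * d" using one by blast
  qed (use zero one add mult uminus in auto)
qed

lemma Gal_carrier:
  "g \<in> carrier (Gal K) \<longleftrightarrow> bij g \<and> (\<forall>x y. g (x + y) = g x + g y) \<and>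
    (\<forall>x y. g (x * y) = g x * g y) \<and> g 1 = 1 \<and> (\<forall>k\<in>K. g k = k)" for K :: "'a::field set"
  by (auto simp: Gal_def ring_iso_def ring_hom_def ring_of_type_algebra_def)

text \<open>
  An automorphism over \<open>K\<close> is determined by its values at generators of the \<open>K\<close>-vector space, and
  these are roots of polynomials over \<open>K\<close>.
\<close>

lemma finite_Gal:
  fixes K :: "'a::field set"
  assumes "finite_Galois K"
  shows "finite (carrier (Gal K))"
proof -
  let ?L = "ring_of_type_algebra :: 'a ring"
  interpret L: field ?L by (rule field_from_type_algebra)
  have K: "subfield K ?L" and fin: "L.finite_dimension K UNIV"
    using assms by (auto simp: finite_Galois_def)
  have sel: "carrier ?L = UNIV" "\<zero>\<^bsub>?L\<^esub> = 0" "\<And>x y. x \<oplus>\<^bsub>?L\<^esub> y = x + y" "\<And>x y. x \<otimes>\<^bsub>?L\<^esub> y = x * y"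
    "\<one>\<^bsub>?L\<^esub> = 1"
    by (simp_all add: ring_of_type_algebra_def)
  obtain us where us: "L.Span K us = UNIV"
    using fin L.exists_base[OF K] by (metis L.finite_dimensionE')
  have root: "\<exists>Y. finite Y \<and> (\<forall>g\<in>carrier (Gal K). g u \<in> Y)" for u
  proof -
    have "(L.algebraic over K) u"
      by (rule L.finite_dimension_imp_algebraic[OF K _ fin]) (use L.carrier_is_subring in \<open>simp_all add: sel\<close>)
    then obtain p where p: "p \<in> carrier (K[X]\<^bsub>?L\<^esub>)" "p \<noteq> []" "L.eval p u = 0"
      using L.algebraicE[OF subfieldE(1)[OF K], of u] by (auto simp: sel)
    have pK: "set p \<subseteq> K" using p(1,2) by (auto simp: univ_poly_carrier[symmetric] polynomial_def)
    have pL: "p \<in> carrier (poly_ring ?L)"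
      using p(1) by (auto simp: univ_poly_carrier[symmetric] polynomial_def sel)
    have "L.is_root p (g u)" if g: "g \<in> carrier (Gal K)" for g
    proof -
      have g0: "g 0 = 0" using g unfolding Gal_carrier by (metis add_cancel_right_right add_0)
      have pow: "x [^]\<^bsub>?L\<^esub> n = x ^ n" for x and n :: nat
        by (induction n) (simp_all add: sel mult.commute)
      have gpow: "g (x ^ n) = g x ^ n" for x n
        using g by (induction n) (simp_all add: Gal_carrier)
      have "set q \<subseteq> K \<Longrightarrow> L.eval q (g u) = g (L.eval q u)" for q
        by (induction q) (use g in \<open>auto simp: g0 sel pow gpow Gal_carrier\<close>)
      then show ?thesis using pK p g0 by (simp add: L.is_root_def sel)
    qed
    then show ?thesis using L.finite_number_of_roots[OF pL] by blast
  qed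
  then obtain Y where Y: "\<And>u. finite (Y u)" "\<And>u g. g \<in> carrier (Gal K) \<Longrightarrow> g u \<in> Y u" by metis
  have "inj_on (\<lambda>g. map g us) (carrier (Gal K))"
  proof (rule inj_onI)
    fix g h assume g: "g \<in> carrier (Gal K)" and h: "h \<in> carrier (Gal K)" and eq: "map g us = map h us"
    have 0: "g 0 = 0" "h 0 = 0" using g h unfolding Gal_carrier by (metis add_cancel_right_right add_0)+
    \<comment> \<open>Generalized from \<open>us\<close> to arbitrary lists, so that the recursion
      of \<open>Span\<close> can be followed.\<close>
    have "map g vs = map h vs \<Longrightarrow> x \<in> L.Span K vs \<Longrightarrow> g x = h x" for vs x
      by (induction vs arbitrary: x)
        (use g h in \<open>auto simp: 0 sel Gal_carrier L.line_extension_def set_add_def set_mult_def r_coset_def\<close>)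
    then show "g = h" using eq us by blast
  qed
  moreover have "(\<lambda>g. map g us) ` carrier (Gal K) \<subseteq> {xs. set xs \<subseteq> (\<Union>u\<in>set us. Y u) \<and> length xs = length us}"
    using Y(2) by fastforce
  moreover have "finite {xs. set xs \<subseteq> (\<Union>u\<in>set us. Y u) \<and> length xs = length us}"
    using Y(1) by (intro finite_lists_length_eq) auto
  ultimately show ?thesis by (rule inj_on_finite)
qed

lemma galois_pid_Gal:
  fixes R :: "'a::field set"
  assumes "pid_subring R" and "finite_Galois (quotient_field R)"
  shows "galois_pid R (carrier (Gal (quotient_field R)))"
proof -
  interpret pid_subring R by (rule assms(1))
  let ?G = "carrier (Gal K)"
  show ?thesis
  proof
    show "inv_into UNIV g \<in> ?G" if g: "g \<in> ?G" for g
    proof -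
      have *: "bij g" "\<And>x y. g (x + y) = g x + g y" "\<And>x y. g (x * y) = g x * g y" "g 1 = 1"
        "\<And>k. k \<in> K \<Longrightarrow> g k = k" using g by (auto simp: Gal_carrier)
      have inv: "inv_into UNIV g y = x" if "y = g x" for x y using * that by (simp add: bij_is_inj)
      have g_inv: "g (inv_into UNIV g x) = x" for x using * by (simp add: bij_is_surj surj_f_inv_f)
      show ?thesis unfolding Gal_carrier
        using * by (auto intro!: inv simp: g_inv bij_imp_bij_inv)
    qed
    show "(\<forall>g\<in>?G. g x = x) \<longleftrightarrow> x \<in> K" for x
      using assms(2) by (auto simp: finite_Galois_def fixed_field_def)
  qed (use finite_Gal[OF assms(2)] in \<open>auto simp: Gal_carrier intro: bij_comp\<close>)
qed

lemma semidirect_galois_Gal: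
  fixes R :: "'a::field set"
  assumes "pid_subring R" and "finite_Galois (quotient_field R)"
    and sd: "semidirect (Gal (quotient_field R)) J G'"
  shows "semidirect_galois R (carrier (Gal (quotient_field R))) J G'"
proof -
  interpret galois_pid R "carrier (Gal (quotient_field R))"
    using galois_pid_Gal[OF assms(1,2)] .
  let ?G = "Gal K"
  have mult: "monoid.mult ?G = (\<circ>)" and one: "\<one>\<^bsub>?G\<^esub> = id" by (simp_all add: Gal_def)
  have norm: "normal J ?G" and sub: "subgroup G' ?G" and int: "J \<inter> G' = {id}"
    and prod: "J <#>\<^bsub>?G\<^esub> G' = carrier ?G"
    using sd by (auto simp: semidirect_def one)
  have grp: "group ?G" and subJ: "subgroup J ?G"
    using norm by (auto simp: normal_def normal_imp_subgroup)
  have inv: "inv\<^bsub>?G\<^esub> g = inv_into UNIV g" if "g \<in> carrier ?G" for g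
    by (rule group.inv_equality[OF grp]) (use that in \<open>simp_all add: mult one G_inv inv_G\<close>)
  show ?thesis
  proof
    show J: "J \<subseteq> carrier ?G" and G': "G' \<subseteq> carrier ?G" using subJ sub by (auto dest: subgroup.subset)
    show "id \<in> J" "id \<in> G'" using subJ sub one by (metis subgroup.one_closed)+
    show "g \<circ> h \<in> J" if "g \<in> J" "h \<in> J" for g h using subgroup.m_closed[OF subJ that] mult by simp
    show "g \<circ> h \<in> G'" if "g \<in> G'" "h \<in> G'" for g h using subgroup.m_closed[OF sub that] mult by simp
    show "inv_into UNIV g \<in> J" if "g \<in> J" for g
      using subgroup.m_inv_closed[OF subJ that] inv J that by auto
    show "inv_into UNIV g \<in> G'" if "g \<in> G'" for g
      using subgroup.m_inv_closed[OF sub that] inv G' that by auto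
    show "g \<circ> h \<circ> inv_into UNIV g \<in> J" if "g \<in> carrier ?G" "h \<in> J" for g h
      using normal.inv_op_closed2[OF norm that] that by (simp add: mult inv)
    show "\<exists>\<sigma>\<in>J. \<exists>\<tau>\<in>G'. g = \<sigma> \<circ> \<tau>" if "g \<in> carrier ?G" for g
      using that unfolding prod[symmetric] by (auto simp: set_mult_def mult)
  qed (use int in auto)
qed

theorem theorem1p5:
  fixes OK K E F OE OF OL :: "'a::field set"
    and G J G' :: "('a \<Rightarrow> 'a) set"
    and N1 N2 N :: "(('a \<Rightarrow> 'a) \<Rightarrow> ('a \<Rightarrow> 'a)) set"
    and H1 H2 H A1 A2 A :: "((('a \<Rightarrow> 'a) \<Rightarrow> ('a \<Rightarrow> 'a)) \<Rightarrow>\<^sub>0 'a) set"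
  assumes "subring OK ring_of_type_algebra"
    and "principal_domain (ring_of_type_algebra \<lparr>carrier := OK\<rparr>)"
    and "K = quotient_field OK"
    and "finite_Galois K"
    and "G = carrier (Gal K)"
    and "semidirect (Gal K) J G'"
    and "E = fixed_field G'"
    and "F = fixed_field J"
    and "OL = integral_closure OK UNIV"
    and "OE = integral_closure OK E"
    and "OF = integral_closure OK F"
    and "regular J N1" and "normalized_by N1 (lambda_c J G') G"
    and "regular G' N2" and "normalized_by N2 (left_regular G') G'"
    and "N = (\<lambda>(\<phi>, \<psi>). iota G J G' \<phi> \<psi>) ` (N1 \<times> N2)"
    and "H1 = fixed_group_algebra UNIV N1 G (lambda_c J G')"
    and "H2 = fixed_group_algebra F N2 G' (left_regular G')"
    and "H = fixed_group_algebra UNIV N G (left_regular G)"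
    and "A1 = associated_order H1 OE"
    and "A2 = associated_order H2 OF"
    and "A = associated_order H OL"
    and "arithmetically_disjoint OK K E F"
  shows "bij_betw (tensor_map scalar_mult (group_algebra_product (iota G J G')))
           (tensor_product OK scalar_mult A1 scalar_mult A2) A \<and>
         (is_free A1 OE \<and> is_free A2 OF \<longrightarrow> is_free A OL) \<and>
         (\<forall>\<gamma> \<delta>. free_generator A1 OE \<gamma> \<and> free_generator A2 OF \<delta>
            \<longrightarrow> free_generator A OL (\<gamma> * \<delta>))"
proof -
  note eqs = assms(3,5,7-11,16-22)
  interpret semidirect_galois OK "carrier (Gal (quotient_field OK))" J G'
    using semidirect_galois_Gal[OF pid_subring_principal_domain[OF assms(1,2)]] assms(4,6)
    unfolding assms(3) .
  have reg: "n permutes Y" "y \<in> Y \<Longrightarrow> \<exists>!m. m \<in> M \<and> m y = id"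
    if "regular Y M" "id \<in> Y" "n \<in> M" for Y M n y
    using that subgroup.subset[of M "Perm Y"] by (auto simp: regular_def Perm_def)
  \<comment> \<open>The second part of \<open>reg\<close> still carries a member n among its
    premises; nonemptiness of a regular subgroup supplies it.\<close>
  have ex: "\<exists>n. n \<in> M" if "regular Y M" for Y M
    using that by (auto simp: regular_def dest: subgroup.one_closed)
  interpret arithmetically_disjoint_hopf_galois OK "carrier (Gal (quotient_field OK))" J G' N1 N2
  proof
    show "n permutes J" if "n \<in> N1" for n using reg(1)[OF assms(12) id_J that] .
    show "n permutes G'" if "n \<in> N2" for n using reg(1)[OF assms(14) id_G' that] .
    show "\<exists>!n. n \<in> N1 \<and> n \<sigma> = id" if "\<sigma> \<in> J" for \<sigma>
      using reg(2)[OF assms(12) id_J _ that] ex[OF assms(12)] by blast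
    show "\<exists>!n. n \<in> N2 \<and> n \<tau> = id" if "\<tau> \<in> G'" for \<tau>
      using reg(2)[OF assms(14) id_G' _ that] ex[OF assms(14)] by blast
    show "conj_perm (lambda_c J G' g) ` N1 = N1" if "g \<in> carrier (Gal (quotient_field OK))" for g
      using assms(13) that by (simp add: normalized_by_def assms(3,5))
    show "conj_perm (left_regular G' \<tau>) ` N2 = N2" if "\<tau> \<in> G'" for \<tau>
      using assms(15) that by (simp add: normalized_by_def)
    \<comment> \<open>As \<open>E\<close> and \<open>F\<close> generate the whole field, the target
      of the tensor map in the assumption is all of \<open>OL\<close>, so z has a preimage.\<close>
    fix z assume z: "z \<in> integral_closure OK UNIV"
    let ?OE = "integral_closure OK (fixed_field G')" and ?OF = "integral_closure OK (fixed_field J)"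
    have "bij_betw (tensor_map (*) (*)) (tensor_product OK (*) ?OE (*) ?OF) (integral_closure OK UNIV)"
      using assms(23) compositum_eq_UNIV by (simp add: arithmetically_disjoint_def eqs)
    then have "z \<in> tensor_map (*) (*) ` tensor_product OK (*) ?OE (*) ?OF"
      using z by (simp add: bij_betw_def)
    also have "\<dots> = linear_extension (*) (*) ` free_module OK (?OE \<times> ?OF)"
      by (rule tensor_map_image[OF module_times module_times OE_submodule OF_submodule module_times])
        (simp add: bilinear_on_def[OF module_times] algebra_simps)
    finally show "\<exists>w\<in>free_module OK (?OE \<times> ?OF). z = linear_extension (*) (*) w" by blast
  qed
  obtain B g where B: "lattice_basis scalar_mult
      (associated_order (fixed_group_algebra UNIV N1 (carrier (Gal (quotient_field OK))) (lambda_c J G'))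
        (integral_closure OK (fixed_field G'))) B g"
    using ex_A1_basis by blast
  obtain V f where V: "lattice_basis (*) (integral_closure OK (fixed_field J)) V f"
    using ex_OF_basis by blast
  show ?thesis
    unfolding eqs is_free_def using tensor_associated_orders[OF B V] free_generator_product[OF B V] by blast
qed

end
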